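(* Let $\mathbf{A}_0,\mathbf{A}_1,\mathbf{A}_2\in\mathbb{R}^{n\times n}[x]$, $E\in\mathbb{R}^{2n\times 4n}$ and $\mathbf{F}\in\mathbb{R}^{2n\times n}[x]$, and let $m$ and the operators $\mathcal{T},\mathcal{A}:\mathbb{R}^m\times L_2^n[a,b]\to L_2^n[a,b]$ and $\mathcal{K}:\mathbb{R}^m\times L_2^n[a,b]\to\mathbb{R}^m$ be those associated with $\{\mathbf{A}_i,E,\mathbf{F}\}$ as defined in the context. Let $\mathcal{S}\in\mathbf{\Pi}^{(0,n)\times(0,n)}$, and define $\tilde{\mathcal{T}}:=(I_n-\mathcal{S})\circ\mathcal{T}$ and $\tilde{\mathcal{A}}:=(I_n-\mathcal{S})\circ\mathcal{A}$. If there exist $\epsilon>0$, $\alpha\ge0$, $\mathcal{P}\in\mathbf{\Pi}^{(0,n)\times(0,n)}$ and $\mathcal{X}\in\mathbf{\Pi}^{(m,n)\times(m,0)}$ such that $$\mathcal{P}=\mathcal{P}^*\succeq\epsilon^2I,\qquad \tilde{\mathcal{A}}^*\mathcal{P}\tilde{\mathcal{T}}+\tilde{\mathcal{T}}^*\mathcal{P}\tilde{\mathcal{A}}\preceq-2\alpha\,\tilde{\mathcal{T}}^*\mathcal{P}\tilde{\mathcal{T}}-\mathcal{X}\mathcal{K}-\mathcal{K}^*\mathcal{X}^*,$$ then trajectories defined by $\mathcal{S}$ are exponentially stable with rate $\alpha$ for the PDE defined by $\{\mathbf{A}_i,E,\mathbf{F}\}$; that is, there exists $M\in\mathbb{R}$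 such that every solution $\mathbf{u}$ to that PDE satisfies $$\|\mathbf{u}(t)-\mathcal{S}\mathbf{u}(t)\|_{L_2}\le Me^{-\alpha t}\|\mathbf{u}(0)-\mathcal{S}\mathbf{u}(0)\|_{L_2}\qquad\forall t\ge0.$$
   Context: $[a,b]\subset\mathbb{R}$ is a fixed interval with $a<b$, and $n\ge1$ is an integer. $\mathbb{R}^{k\times l}[x]$, $\mathbb{R}^{k\times l}[x,\theta]$ denote $k\times l$ matrix-valued real polynomials. $L_2^n[a,b]$ is the space of square-integrable $\mathbb{R}^n$-valued functions, and $W_2^{2,n}[a,b]:=\{\mathbf{u}\in L_2^n[a,b]\mid \mathbf{u}_x,\mathbf{u}_{xx}\in L_2^n[a,b]\}$, with point values taken from continuous representatives. $\mathbb{R}^m\times L_2^n[a,b]$ carries its standard product inner product $\langle\cdot,\cdot\rangle$; adjoints $(\cdot)^*$ are with respect to these inner products, and for self-adjoint bounded operators $\mathcal{B}\preceq\mathcal{C}$ (equivalently $\mathcal{C}\succeq\mathcal{B}$) means $\langle\mathbf{v},(\mathcal{C}-\mathcal{B})\mathbf{v}\rangle\ge0$ for all $\mathbf{v}$ in the whole space. Blocks with zero rows or columns are understood to be empty. 4-PI operators: $\mathcal{P}\in\mathbf{\Pi}^{(m,n)\times(p,q)}$ means that $\mathcal{P}:\mathbb{R}^p\times L_2^q[a,b]\to\mathbb{R}^m\times L_2^n[a,b]$ and there exist $P\in\mathbb{R}^{m\times p}$, $\mathbf{Q}_1\in\mathbb{R}^{m\times q}[x]$, $\mathbf{Q}_2\in\mathbb{R}^{n\times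 p}[x]$, $\mathbf{R}_0\in\mathbb{R}^{n\times q}[x]$, $\mathbf{R}_1,\mathbf{R}_2\in\mathbb{R}^{n\times q}[x,\theta]$ with $$\Big(\mathcal{P}\begin{bmatrix}v_0\\ \mathbf{v}_1\end{bmatrix}\Big)(x)=\begin{bmatrix}Pv_0+\int_a^b\mathbf{Q}_1(x)\mathbf{v}_1(x)dx\\ \mathbf{Q}_2(x)v_0+\mathbf{R}_0(x)\mathbf{v}_1(x)+\int_a^x\mathbf{R}_1(x,\theta)\mathbf{v}_1(\theta)d\theta+\int_a^b\mathbf{R}_2(x,\theta)\mathbf{v}_1(\theta)d\theta\end{bmatrix}.$$ A dimension equal to $0$ means that the corresponding component is absent. For $E\in\mathbb{R}^{k\times 4n}$ and $\mathbf{F}\in L_2^{k\times n}[a,b]$ (any $k$), define $$G_{E,\mathbf{F}}:=E\begin{bmatrix}I_n&0_n\\ I_n&(b-a)I_n\\ 0_n&I_n\\ 0_n&I_n\end{bmatrix}+\int_a^b\mathbf{F}(x)\begin{bmatrix}I_n&(x-a)I_n\end{bmatrix}dx,\qquad \mathbf{H}_{E,\mathbf{F}}(x):=-E\begin{bmatrix}0_n\\ (b-x)I_n\\ 0_n\\ I_n\end{bmatrix}-\int_x^b(\theta-x)\mathbf{F}(\theta)\,d\theta.$$ Spaces and operators associated with $\{\mathbf{A}_i,E,\mathbf{F}\}$: - $X:=\{\mathbf{u}\in W_2^{2,n}[a,b]\mid E\,[\mathbf{u}(a);\mathbf{u}(b);\mathbf{u}_x(a);\mathbf{u}_x(b)]+\int_a^b\mathbf{F}(x)\mathbf{u}(x)dx=0\}$,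 where $[\cdot;\cdot]$ is vertical stacking. - $0\le m\le 2n$ and an invertible $J\in\mathbb{R}^{2n\times2n}$ are chosen such that, with $E_1,\mathbf{F}_1$ the first $2n-m$ rows and $E_2,\mathbf{F}_2$ the last $m$ rows of $JE,J\mathbf{F}$, $G_{E_1,\mathbf{F}_1}$ has full row rank and $G_{E_2,\mathbf{F}_2}=0_{m\times2n}$. - $\mathcal{K}[v_0;\mathbf{v}_1]:=\int_a^b\mathbf{H}_{E_2,\mathbf{F}_2}(x)\mathbf{v}_1(x)dx$. - $\mathbf{F}_3\in\mathbb{R}^{m\times n}[x]$ is chosen such that $\hat G:=G_{[E_1;0_{m\times4n}],[\mathbf{F}_1;\mathbf{F}_3]}\in\mathbb{R}^{2n\times2n}$ is invertible; $\hat{\mathbf{H}}:=\mathbf{H}_{[E_1;0_{m\times4n}],[\mathbf{F}_1;\mathbf{F}_3]}$. - $\mathbf{T}_0(x):=\begin{bmatrix}I_n&(x-a)I_n\end{bmatrix}\hat G^{-1}\begin{bmatrix}0_{(2n-m)\times m}\\ I_m\end{bmatrix}$ and $\mathbf{T}_1(x,\theta):=\begin{bmatrix}I_n&(x-a)I_n\end{bmatrix}\hat G^{-1}\hat{\mathbf{H}}(\theta)$. - For $\mathbf{v}=[v_0;\mathbf{v}_1]\in\mathbb{R}^m\times L_2^n[a,b]$: $(\mathcal{T}\mathbf{v})(x):=\mathbf{T}_0(x)v_0+\int_a^b\mathbf{T}_1(x,\theta)\mathbf{v}_1(\theta)d\theta+\int_a^x(x-\theta)\mathbf{v}_1(\theta)d\theta$,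 $(\mathcal{R}\mathbf{v})(x):=\partial_x\mathbf{T}_0(x)v_0+\int_a^b\partial_x\mathbf{T}_1(x,\theta)\mathbf{v}_1(\theta)d\theta+\int_a^x\mathbf{v}_1(\theta)d\theta$, and $\mathcal{A}\mathbf{v}:=\mathbf{A}_0(\mathcal{T}\mathbf{v})+\mathbf{A}_1(\mathcal{R}\mathbf{v})+\mathbf{A}_2\mathbf{v}_1$ (pointwise multiplication by $\mathbf{A}_i(x)$). PDE solution: $\mathbf{u}$ is a solution to the PDE defined by $\{\mathbf{A}_i,E,\mathbf{F}\}$ with initial state $\mathbf{u}^0\in X$ if $t\mapsto\mathbf{u}(t)$ is Fréchet differentiable on $t\ge0$ (as a map into $X$ with the $W_2^{2,n}$ Sobolev norm), $\mathbf{u}(0)=\mathbf{u}^0$, and for all $t\ge0$, $\mathbf{u}(t)\in X$ and $\mathbf{u}_t(t,x)=\mathbf{A}_0(x)\mathbf{u}(t,x)+\mathbf{A}_1(x)\mathbf{u}_x(t,x)+\mathbf{A}_2(x)\mathbf{u}_{xx}(t,x)$. *)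

theory Defs
  imports
    "HOL-Analysis.Analysis"
    "HOL-Computational_Algebra.Polynomial"
    "Jordan_Normal_Form.Gauss_Jordan_Elimination"
    "Jordan_Normal_Form.DL_Rank"
begin

hide_type (open) Finite_Cartesian_Product.vec
hide_const (open) Finite_Cartesian_Product.vec Finite_Cartesian_Product.mat
  Finite_Cartesian_Product.row Finite_Cartesian_Product.rows
unbundle no vec_syntax
unbundle no inner_syntax

section \<open>Matrices, polynomial matrices and entrywise calculus\<close>

text \<open>Matrices and vectors are those of \<^theory>\<open>Jordan_Normal_Form.Matrix\<close>, where the dimension is
  part of the value; zero dimensions are allowed and give empty blocks.\<close>

definition pmat_at :: "real poly mat \<Rightarrow> real \<Rightarrow> real mat" where
  "pmat_at Q x = map_mat (\<lambda>p. poly p x) Q"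

text \<open>A polynomial in \<open>(x, \<theta>)\<close> is a polynomial in \<open>x\<close> with coefficients polynomial in \<open>\<theta>\<close>.\<close>

definition pmat_at2 :: "real poly poly mat \<Rightarrow> real \<Rightarrow> real \<Rightarrow> real mat" where
  "pmat_at2 R x \<theta> = map_mat (\<lambda>p. poly (poly p [:\<theta>:]) x) R"

definition append_cols :: "real mat \<Rightarrow> real mat \<Rightarrow> real mat"  (infixr \<open>|||\<close> 66) where
  "A ||| B = four_block_mat A B (0\<^sub>m 0 (dim_col A)) (0\<^sub>m 0 (dim_col B))"

definition first_rows :: "nat \<Rightarrow> real mat \<Rightarrow> real mat" where
  "first_rows k A = mat k (dim_col A) (\<lambda>(i, j). A $$ (i, j))"

definition last_rows :: "nat \<Rightarrow> real mat \<Rightarrow> real mat" where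
  "last_rows k A = mat k (dim_col A) (\<lambda>(i, j). A $$ (dim_row A - k + i, j))"

definition full_row_rank :: "real mat \<Rightarrow> bool" where
  "full_row_rank A \<longleftrightarrow> vec_space.rank (dim_row A) A = dim_row A"

definition vec_integral :: "nat \<Rightarrow> real set \<Rightarrow> (real \<Rightarrow> real vec) \<Rightarrow> real vec" where
  "vec_integral k S f = vec k (\<lambda>i. LINT x|lebesgue_on S. f x $ i)"

definition mat_integral :: "nat \<Rightarrow> nat \<Rightarrow> real set \<Rightarrow> (real \<Rightarrow> real mat) \<Rightarrow> real mat" where
  "mat_integral k l S F = mat k l (\<lambda>(i, j). LINT x|lebesgue_on S. F x $$ (i, j))"

definition mat_deriv :: "(real \<Rightarrow> real mat) \<Rightarrow> real \<Rightarrow> real mat" where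
  "mat_deriv F x = mat (dim_row (F x)) (dim_col (F x)) (\<lambda>(i, j). deriv (\<lambda>y. F y $$ (i, j)) x)"

section \<open>The spaces \<open>L\<^sub>2\<^sup>n[a,b]\<close> and \<open>\<real>\<^sup>m \<times> L\<^sub>2\<^sup>n[a,b]\<close>\<close>

text \<open>Elements of \<open>L\<^sub>2\<close> are represented by functions; only their restriction to \<open>[a,b]\<close> matters, and
  two of them are the same element when they agree almost everywhere on \<open>[a,b]\<close>.\<close>

definition L2 :: "real \<Rightarrow> real \<Rightarrow> nat \<Rightarrow> (real \<Rightarrow> real vec) set" where
  "L2 a b n = {f. (\<forall>x\<in>{a..b}. f x \<in> carrier_vec n) \<and>
     (\<forall>i<n. (\<lambda>x. f x $ i) \<in> borel_measurable (lebesgue_on {a..b}) \<and>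
            integrable (lebesgue_on {a..b}) (\<lambda>x. (f x $ i)\<^sup>2))}"

definition L2_eq :: "real \<Rightarrow> real \<Rightarrow> (real \<Rightarrow> real vec) \<Rightarrow> (real \<Rightarrow> real vec) \<Rightarrow> bool" where
  "L2_eq a b f g \<longleftrightarrow> (AE x in lebesgue_on {a..b}. f x = g x)"

definition L2_inner :: "real \<Rightarrow> real \<Rightarrow> (real \<Rightarrow> real vec) \<Rightarrow> (real \<Rightarrow> real vec) \<Rightarrow> real" where
  "L2_inner a b f g = (LINT x|lebesgue_on {a..b}. f x \<bullet> g x)"

definition L2_norm :: "real \<Rightarrow> real \<Rightarrow> (real \<Rightarrow> real vec) \<Rightarrow> real" where
  "L2_norm a b f = sqrt (L2_inner a b f f)"

type_synonym zelem = "real vec \<times> (real \<Rightarrow> real vec)"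

definition Z :: "real \<Rightarrow> real \<Rightarrow> nat \<times> nat \<Rightarrow> zelem set" where
  "Z a b d = carrier_vec (fst d) \<times> L2 a b (snd d)"

definition Z_eq :: "real \<Rightarrow> real \<Rightarrow> zelem \<Rightarrow> zelem \<Rightarrow> bool" where
  "Z_eq a b v w \<longleftrightarrow> fst v = fst w \<and> L2_eq a b (snd v) (snd w)"

definition Z_inner :: "real \<Rightarrow> real \<Rightarrow> zelem \<Rightarrow> zelem \<Rightarrow> real" where
  "Z_inner a b v w = fst v \<bullet> fst w + L2_inner a b (snd v) (snd w)"

text \<open>\<open>L\<^sub>2\<^sup>n\<close> is identified with \<open>\<real>\<^sup>0 \<times> L\<^sub>2\<^sup>n\<close>, and \<open>\<real>\<^sup>m\<close> with \<open>\<real>\<^sup>m \<times> L\<^sub>2\<^sup>0\<close>, by the following maps.\<close>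

definition of_L2 :: "(real \<Rightarrow> real vec) \<Rightarrow> zelem" where
  "of_L2 f = (0\<^sub>v 0, f)"

definition of_vec :: "real vec \<Rightarrow> zelem" where
  "of_vec v = (v, \<lambda>x. 0\<^sub>v 0)"

section \<open>Operators\<close>

type_synonym operator = "zelem \<Rightarrow> zelem"

definition op_add :: "operator \<Rightarrow> operator \<Rightarrow> operator"  (infixl \<open>\<oplus>\<^sub>o\<close> 65) where
  "(B \<oplus>\<^sub>o C) v = (fst (B v) + fst (C v), \<lambda>x. snd (B v) x + snd (C v) x)"

definition op_sub :: "operator \<Rightarrow> operator \<Rightarrow> operator"  (infixl \<open>\<ominus>\<^sub>o\<close> 65) where
  "(B \<ominus>\<^sub>o C) v = (fst (B v) - fst (C v), \<lambda>x. snd (B v) x - snd (C v) x)"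

definition op_scale :: "real \<Rightarrow> operator \<Rightarrow> operator"  (infixr \<open>\<odot>\<^sub>o\<close> 75) where
  "(c \<odot>\<^sub>o B) v = (c \<cdot>\<^sub>v fst (B v), \<lambda>x. c \<cdot>\<^sub>v snd (B v) x)"

definition op_eq :: "real \<Rightarrow> real \<Rightarrow> nat \<times> nat \<Rightarrow> operator \<Rightarrow> operator \<Rightarrow> bool" where
  "op_eq a b d B C \<longleftrightarrow> (\<forall>v\<in>Z a b d. Z_eq a b (B v) (C v))"

definition op_le :: "real \<Rightarrow> real \<Rightarrow> nat \<times> nat \<Rightarrow> operator \<Rightarrow> operator \<Rightarrow> bool" where
  "op_le a b d B C \<longleftrightarrow> (\<forall>v\<in>Z a b d. 0 \<le> Z_inner a b v ((C \<ominus>\<^sub>o B) v))"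

text \<open>The adjoint of an operator from \<open>Z a b d\<close> to \<open>Z a b e\<close>; it is unique up to almost everywhere
  equality.\<close>

definition adj :: "real \<Rightarrow> real \<Rightarrow> nat \<times> nat \<Rightarrow> nat \<times> nat \<Rightarrow> operator \<Rightarrow> operator" where
  "adj a b d e B = (SOME B'. (\<forall>w\<in>Z a b e. B' w \<in> Z a b d) \<and>
     (\<forall>v\<in>Z a b d. \<forall>w\<in>Z a b e. Z_inner a b (B v) w = Z_inner a b v (B' w)))"

definition pi_op :: "real \<Rightarrow> real \<Rightarrow> nat \<Rightarrow> nat \<Rightarrow> real mat \<Rightarrow> real poly mat \<Rightarrow> real poly mat \<Rightarrow>
    real poly mat \<Rightarrow> real poly poly mat \<Rightarrow> real poly poly mat \<Rightarrow> operator" where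
  "pi_op a b m n P Q1 Q2 R0 R1 R2 = (\<lambda>(v0, v1).
     (P *\<^sub>v v0 + vec_integral m {a..b} (\<lambda>x. pmat_at Q1 x *\<^sub>v v1 x),
      \<lambda>x. pmat_at Q2 x *\<^sub>v v0 + pmat_at R0 x *\<^sub>v v1 x
          + vec_integral n {a..x} (\<lambda>\<theta>. pmat_at2 R1 x \<theta> *\<^sub>v v1 \<theta>)
          + vec_integral n {a..b} (\<lambda>\<theta>. pmat_at2 R2 x \<theta> *\<^sub>v v1 \<theta>)))"

text \<open>\<open>PI_ops a b (m, n) (p, q)\<close> are the 4-PI operators from \<open>Z a b (p, q)\<close> to \<open>Z a b (m, n)\<close>.\<close>

definition PI_ops :: "real \<Rightarrow> real \<Rightarrow> nat \<times> nat \<Rightarrow> nat \<times> nat \<Rightarrow> operator set" where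
  "PI_ops a b = (\<lambda>(m, n) (p, q). {B. (\<forall>v\<in>Z a b (p, q). B v \<in> Z a b (m, n)) \<and>
     (\<exists>P\<in>carrier_mat m p. \<exists>Q1\<in>carrier_mat m q. \<exists>Q2\<in>carrier_mat n p.
      \<exists>R0\<in>carrier_mat n q. \<exists>R1\<in>carrier_mat n q. \<exists>R2\<in>carrier_mat n q.
        op_eq a b (p, q) B (pi_op a b m n P Q1 Q2 R0 R1 R2))})"

section \<open>The Sobolev space \<open>W\<^sub>2\<^sup>2\<^sup>,\<^sup>n[a,b]\<close>\<close>

text \<open>Test functions are continuously differentiable with compact support in \<open>(a,b)\<close>.\<close>

definition is_weak_deriv ::
    "real \<Rightarrow> real \<Rightarrow> nat \<Rightarrow> (real \<Rightarrow> real vec) \<Rightarrow> (real \<Rightarrow> real vec) \<Rightarrow> bool" where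
  "is_weak_deriv a b n u g \<longleftrightarrow>
     (\<forall>\<phi> \<phi>' c d. a < c \<longrightarrow> c < d \<longrightarrow> d < b \<longrightarrow>
        (\<forall>x. (\<phi> has_real_derivative \<phi>' x) (at x)) \<longrightarrow> continuous_on UNIV \<phi>' \<longrightarrow>
        (\<forall>x. x \<notin> {c..d} \<longrightarrow> \<phi> x = 0) \<longrightarrow>
        (\<forall>i<n. (LINT x|lebesgue_on {a..b}. u x $ i * \<phi>' x)
               = - (LINT x|lebesgue_on {a..b}. g x $ i * \<phi> x)))"

definition wderiv :: "real \<Rightarrow> real \<Rightarrow> nat \<Rightarrow> (real \<Rightarrow> real vec) \<Rightarrow> real \<Rightarrow> real vec" where
  "wderiv a b n u = (SOME g. g \<in> L2 a b n \<and> is_weak_deriv a b n u g)"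

definition W22 :: "real \<Rightarrow> real \<Rightarrow> nat \<Rightarrow> (real \<Rightarrow> real vec) set" where
  "W22 a b n = {u\<in>L2 a b n. \<exists>g\<in>L2 a b n. \<exists>h\<in>L2 a b n.
     is_weak_deriv a b n u g \<and> is_weak_deriv a b n g h}"

definition W22_norm :: "real \<Rightarrow> real \<Rightarrow> nat \<Rightarrow> (real \<Rightarrow> real vec) \<Rightarrow> real" where
  "W22_norm a b n u = sqrt ((L2_norm a b u)\<^sup>2 + (L2_norm a b (wderiv a b n u))\<^sup>2
     + (L2_norm a b (wderiv a b n (wderiv a b n u)))\<^sup>2)"

text \<open>The continuous representative, used to evaluate at points of \<open>[a,b]\<close>.\<close>

definition cont_rep :: "real \<Rightarrow> real \<Rightarrow> nat \<Rightarrow> (real \<Rightarrow> real vec) \<Rightarrow> real \<Rightarrow> real vec" where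
  "cont_rep a b n u = (SOME c. (\<forall>x\<in>{a..b}. c x \<in> carrier_vec n) \<and>
     (\<forall>i<n. continuous_on {a..b} (\<lambda>x. c x $ i)) \<and> L2_eq a b u c)"

section \<open>The PDE\<close>

definition X_space :: "real \<Rightarrow> real \<Rightarrow> nat \<Rightarrow> real mat \<Rightarrow> real poly mat \<Rightarrow> (real \<Rightarrow> real vec) set" where
  "X_space a b n E F = {u\<in>W22 a b n.
     (let u\<^sub>c = cont_rep a b n u; ux\<^sub>c = cont_rep a b n (wderiv a b n u) in
      E *\<^sub>v (u\<^sub>c a @\<^sub>v u\<^sub>c b @\<^sub>v ux\<^sub>c a @\<^sub>v ux\<^sub>c b)
        + vec_integral (dim_row E) {a..b} (\<lambda>x. pmat_at F x *\<^sub>v u x) = 0\<^sub>v (dim_row E))}"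

text \<open>The function \<open>ut\<close> is the Frechet derivative of \<open>u\<close> on \<open>[0,\<infinity>)\<close>, one-sided at \<open>0\<close>.\<close>

definition pde_solution :: "real \<Rightarrow> real \<Rightarrow> nat \<Rightarrow> real poly mat \<Rightarrow> real poly mat \<Rightarrow> real poly mat \<Rightarrow>
    real mat \<Rightarrow> real poly mat \<Rightarrow> (real \<Rightarrow> real vec) \<Rightarrow> (real \<Rightarrow> real \<Rightarrow> real vec) \<Rightarrow> bool" where
  "pde_solution a b n A0 A1 A2 E F u0 u \<longleftrightarrow>
     (\<forall>t\<ge>0. u t \<in> X_space a b n E F) \<and> L2_eq a b (u 0) u0 \<and>
     (\<exists>ut. \<forall>t\<ge>0. ut t \<in> X_space a b n E F \<and>
        ((\<lambda>s. W22_norm a b n (\<lambda>x. u s x - u t x - (s - t) \<cdot>\<^sub>v ut t x) / \<bar>s - t\<bar>) \<longlongrightarrow> 0)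
          (at t within {0..}) \<and>
        L2_eq a b (ut t) (\<lambda>x. pmat_at A0 x *\<^sub>v u t x
          + pmat_at A1 x *\<^sub>v wderiv a b n (u t) x
          + pmat_at A2 x *\<^sub>v wderiv a b n (wderiv a b n (u t)) x))"

section \<open>The associated operators\<close>

definition G_mat :: "real \<Rightarrow> real \<Rightarrow> nat \<Rightarrow> real mat \<Rightarrow> (real \<Rightarrow> real mat) \<Rightarrow> real mat" where
  "G_mat a b n E F =
     E * ((1\<^sub>m n ||| 0\<^sub>m n n) @\<^sub>r (1\<^sub>m n ||| (b - a) \<cdot>\<^sub>m 1\<^sub>m n) @\<^sub>r (0\<^sub>m n n ||| 1\<^sub>m n) @\<^sub>r (0\<^sub>m n n ||| 1\<^sub>m n))
     + mat_integral (dim_row E) (2 * n) {a..b} (\<lambda>x. F x * (1\<^sub>m n ||| (x - a) \<cdot>\<^sub>m 1\<^sub>m n))"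

definition H_mat :: "real \<Rightarrow> nat \<Rightarrow> real mat \<Rightarrow> (real \<Rightarrow> real mat) \<Rightarrow> real \<Rightarrow> real mat" where
  "H_mat b n E F x =
     - (E * (0\<^sub>m n n @\<^sub>r ((b - x) \<cdot>\<^sub>m 1\<^sub>m n) @\<^sub>r 0\<^sub>m n n @\<^sub>r 1\<^sub>m n))
     - mat_integral (dim_row E) n {x..b} (\<lambda>\<theta>. (\<theta> - x) \<cdot>\<^sub>m F \<theta>)"

definition K_op :: "real \<Rightarrow> real \<Rightarrow> nat \<Rightarrow> nat \<Rightarrow> real mat \<Rightarrow> (real \<Rightarrow> real mat) \<Rightarrow> operator" where
  "K_op a b n m E2 F2 v = of_vec (vec_integral m {a..b} (\<lambda>x. H_mat b n E2 F2 x *\<^sub>v snd v x))"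

text \<open>Below, \<open>G\<close> and \<open>H\<close> stand for the completed matrix (with hat) and its companion function.\<close>

definition T0_mat :: "real \<Rightarrow> nat \<Rightarrow> nat \<Rightarrow> real mat \<Rightarrow> real \<Rightarrow> real mat" where
  "T0_mat a n m G x = (1\<^sub>m n ||| (x - a) \<cdot>\<^sub>m 1\<^sub>m n) * the (mat_inverse G) * (0\<^sub>m (2 * n - m) m @\<^sub>r 1\<^sub>m m)"

definition T1_mat :: "real \<Rightarrow> nat \<Rightarrow> real mat \<Rightarrow> (real \<Rightarrow> real mat) \<Rightarrow> real \<Rightarrow> real \<Rightarrow> real mat" where
  "T1_mat a n G H x \<theta> = (1\<^sub>m n ||| (x - a) \<cdot>\<^sub>m 1\<^sub>m n) * the (mat_inverse G) * H \<theta>"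

definition T_op :: "real \<Rightarrow> real \<Rightarrow> nat \<Rightarrow> nat \<Rightarrow> real mat \<Rightarrow> (real \<Rightarrow> real mat) \<Rightarrow> operator" where
  "T_op a b n m G H v = of_L2 (\<lambda>x. T0_mat a n m G x *\<^sub>v fst v
     + vec_integral n {a..b} (\<lambda>\<theta>. T1_mat a n G H x \<theta> *\<^sub>v snd v \<theta>)
     + vec_integral n {a..x} (\<lambda>\<theta>. (x - \<theta>) \<cdot>\<^sub>v snd v \<theta>))"

definition R_op :: "real \<Rightarrow> real \<Rightarrow> nat \<Rightarrow> nat \<Rightarrow> real mat \<Rightarrow> (real \<Rightarrow> real mat) \<Rightarrow> operator" where
  "R_op a b n m G H v = of_L2 (\<lambda>x. mat_deriv (T0_mat a n m G) x *\<^sub>v fst v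
     + vec_integral n {a..b} (\<lambda>\<theta>. mat_deriv (\<lambda>y. T1_mat a n G H y \<theta>) x *\<^sub>v snd v \<theta>)
     + vec_integral n {a..x} (snd v))"

definition A_op :: "real \<Rightarrow> real \<Rightarrow> nat \<Rightarrow> nat \<Rightarrow> real poly mat \<Rightarrow> real poly mat \<Rightarrow> real poly mat \<Rightarrow>
    real mat \<Rightarrow> (real \<Rightarrow> real mat) \<Rightarrow> operator" where
  "A_op a b n m A0 A1 A2 G H v = of_L2 (\<lambda>x. pmat_at A0 x *\<^sub>v snd (T_op a b n m G H v) x
     + pmat_at A1 x *\<^sub>v snd (R_op a b n m G H v) x + pmat_at A2 x *\<^sub>v snd v x)"

end

theory Submission
  imports Defs
begin

text \<open>For a solution \<open>u\<close> put \<open>v = (\<integral> F\<^sub>3 u, u\<^sub>x\<^sub>x)\<close>. Taylor's formula with integral remainder writes \<open>u\<close> and \<open>u\<^sub>x\<close> in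
  terms of \<open>u(a)\<close>, \<open>u\<^sub>x(a)\<close> and \<open>u\<^sub>x\<^sub>x\<close>, and the boundary conditions determine \<open>u(a)\<close> and \<open>u\<^sub>x(a)\<close> from \<open>v\<close>; hence
  \<open>T v = u\<close> and \<open>A v = u\<^sub>t\<close>, while the rows with \<open>G = 0\<close> give \<open>K v = 0\<close>. Therefore \<open>V(t) = \<langle>w, P w\<rangle>\<close> with
  \<open>w = u - S u\<close> has the derivative \<open>\<langle>A' v, P T' v\<rangle> + \<langle>T' v, P A' v\<rangle>\<close>, where \<open>T' = (I - S) T\<close> and \<open>A' = (I - S) A\<close>.
  The terms with \<open>X\<close> vanish, so the operator inequality gives \<open>V' \<le> - 2 \<alpha> V\<close>, and
  \<open>\<epsilon>\<^sup>2 \<parallel>w\<parallel>\<^sup>2 \<le> V \<le> C \<parallel>w\<parallel>\<^sup>2\<close> yields the claim with \<open>M = sqrt C / \<epsilon>\<close>.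

  Adjoints are defined by a choice and must be shown to exist. All the operators are integral operators
  with bounded measurable kernels, whose adjoints are given by the transposed kernels (Fubini).\<close>

section \<open>Square-integrable functions and bounded kernels on an interval\<close>

text \<open>Functions are representatives and operators are arbitrary maps on them, linear at most
  up to null sets; adjoints, weak derivatives and point values are choices. Each choice has to be
  pinned down: adjoints by exhibiting one, weak derivatives and continuous representatives by
  uniqueness, which is where the lemma of du Bois-Reymond enters. Boundary data of a Sobolev
  function can be read off only after it has been written as a twofold primitive.

  The component in R^m is there because 2 n - m independent conditions leave m of the 2 n numbers
  (u(a), u_x(a)) undetermined once u_xx is given; F3 is chosen to measure them. The other m rows
  restrict u_xx alone.

  The state v is not known to be differentiable in time, and I - S is linear only almost everywhere.
  The weight is therefore pulled back to the adjoint of I - S times P times I - S, so that V is a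
  quadratic form in u itself and only the Frechet derivative of u is needed. The constant C bounds
  the form of P and does not depend on the solution, hence neither does M.\<close>

locale compact_interval =
  fixes a b :: real
  assumes ab: "a < b"
begin

abbreviation "M \<equiv> lebesgue_on {a..b}"

definition sq_int :: "(real \<Rightarrow> real) \<Rightarrow> bool" where
  "sq_int f \<longleftrightarrow> f \<in> borel_measurable M \<and> integrable M (\<lambda>x. (f x)\<^sup>2)"

text \<open>The bound holds at every point of [a, b], not only almost everywhere: kernels are
  restricted to slices \<open>k x\<close>, where an exceptional null set of the square could not be
  ignored.\<close>

definition bdd :: "(real \<Rightarrow> real) \<Rightarrow> bool" where
  "bdd f \<longleftrightarrow> f \<in> borel_measurable M \<and> (\<exists>B. \<forall>x\<in>{a..b}. \<bar>f x\<bar> \<le> B)"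

text \<open>Measurability refers to the product of the two Lebesgue sigma-algebras, the one for
  which Fubini's theorem on \<open>M \<Otimes>\<^sub>M M\<close> is stated.\<close>

definition bdd2 :: "(real \<Rightarrow> real \<Rightarrow> real) \<Rightarrow> bool" where
  "bdd2 k \<longleftrightarrow> (\<lambda>(x, \<theta>). k x \<theta>) \<in> borel_measurable (M \<Otimes>\<^sub>M M) \<and>
     (\<exists>B. \<forall>x\<in>{a..b}. \<forall>\<theta>\<in>{a..b}. \<bar>k x \<theta>\<bar> \<le> B)"

lemma finite_measure_M: "finite_measure M"
  by (rule finite_measure_lebesgue_on) simp

sublocale M: finite_measure M
  by (rule finite_measure_M)

sublocale MM: pair_sigma_finite M M ..

lemma integral_1_M: "(LINT x|M. 1) = b - a"
  using ab by (simp add: measure_restrict_space)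

lemma bdd_measurable [measurable_dest]: "bdd f \<Longrightarrow> f \<in> borel_measurable M"
  by (simp add: bdd_def)

lemma sq_int_measurable [measurable_dest]: "sq_int f \<Longrightarrow> f \<in> borel_measurable M"
  by (simp add: sq_int_def)

lemma bddE:
  assumes "bdd f"
  obtains B where "B \<ge> 0" "\<forall>x\<in>{a..b}. \<bar>f x\<bar> \<le> B"
proof -
  from assms obtain B where B: "\<forall>x\<in>{a..b}. \<bar>f x\<bar> \<le> B" by (auto simp: bdd_def)
  show ?thesis by (rule that[of "max B 0"]) (use B in \<open>auto simp: le_max_iff_disj\<close>)
qed

lemma bdd2E:
  assumes "bdd2 k"
  obtains B where "B \<ge> 0" "\<forall>x\<in>{a..b}. \<forall>\<theta>\<in>{a..b}. \<bar>k x \<theta>\<bar> \<le> B"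
proof -
  from assms obtain B where B: "\<forall>x\<in>{a..b}. \<forall>\<theta>\<in>{a..b}. \<bar>k x \<theta>\<bar> \<le> B" by (auto simp: bdd2_def)
  show ?thesis by (rule that[of "max B 0"]) (use B in \<open>auto simp: le_max_iff_disj\<close>)
qed

section \<open>Closure properties of bounded measurable functions\<close>

lemma bdd_const [simp]: "bdd (\<lambda>x. c)"
  by (auto simp: bdd_def)

lemma bdd_add:
  assumes "bdd f" "bdd g"
  shows "bdd (\<lambda>x. f x + g x)"
proof -
  note assms [measurable]
  obtain B where B: "B \<ge> 0" "\<forall>x\<in>{a..b}. \<bar>f x\<bar> \<le> B" by (rule bddE[OF assms(1)])
  obtain C where C: "C \<ge> 0" "\<forall>x\<in>{a..b}. \<bar>g x\<bar> \<le> C" by (rule bddE[OF assms(2)])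
  have "\<bar>f x + g x\<bar> \<le> B + C" if "x \<in> {a..b}" for x
    using B(2)[rule_format, OF that] C(2)[rule_format, OF that] by linarith
  moreover have "(\<lambda>x. f x + g x) \<in> borel_measurable M" by measurable
  ultimately show ?thesis unfolding bdd_def by (auto intro!: exI[of _ "B + C"])
qed

lemma bdd_mult:
  assumes "bdd f" "bdd g"
  shows "bdd (\<lambda>x. f x * g x)"
proof -
  note assms [measurable]
  obtain B where B: "B \<ge> 0" "\<forall>x\<in>{a..b}. \<bar>f x\<bar> \<le> B" by (rule bddE[OF assms(1)])
  obtain C where C: "C \<ge> 0" "\<forall>x\<in>{a..b}. \<bar>g x\<bar> \<le> C" by (rule bddE[OF assms(2)])
  have "\<bar>f x * g x\<bar> \<le> B * C" if "x \<in> {a..b}" for x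
    using B(2)[rule_format, OF that] C(2)[rule_format, OF that] B(1) C(1) by (simp add: abs_mult mult_mono)
  moreover have "(\<lambda>x. f x * g x) \<in> borel_measurable M" by measurable
  ultimately show ?thesis unfolding bdd_def by (auto intro!: exI[of _ "B * C"])
qed

lemma bdd_sum: "(\<And>i. i \<in> I \<Longrightarrow> bdd (f i)) \<Longrightarrow> bdd (\<lambda>x. \<Sum>i\<in>I. f i x)"
  by (induction I rule: infinite_finite_induct) (auto intro!: bdd_add)

lemma bdd_minus: "bdd f \<Longrightarrow> bdd (\<lambda>x. - f x)"
  using bdd_mult[OF bdd_const[of "-1"], of f] by simp

lemma bdd_diff: "bdd f \<Longrightarrow> bdd g \<Longrightarrow> bdd (\<lambda>x. f x - g x)"
  using bdd_add[OF _ bdd_minus, of f g] by simp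

lemma bdd_continuous:
  assumes "continuous_on {a..b} f"
  shows "bdd f"
proof -
  have "bounded (f ` {a..b})"
    using assms by (intro compact_imp_bounded compact_continuous_image) auto
  then obtain B where "\<forall>x\<in>{a..b}. \<bar>f x\<bar> \<le> B"
    by (auto simp: bounded_iff)
  moreover have "f \<in> borel_measurable M"
    using assms by (intro continuous_imp_measurable_on_sets_lebesgue) auto
  ultimately show ?thesis by (auto simp: bdd_def)
qed

lemma bdd_cong:
  assumes "bdd f" "\<And>x. x \<in> {a..b} \<Longrightarrow> f x = g x"
  shows "bdd g"
proof -
  have "g \<in> borel_measurable M \<longleftrightarrow> f \<in> borel_measurable M"
    by (intro measurable_cong) (use assms in auto)
  then show ?thesis using assms by (auto simp: bdd_def)
qed

text \<open>Borel sets are Lebesgue measurable, so the identity from the square to the Borel plane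
  is measurable. This imports Borel kernels such as the triangle.\<close>

lemma borel_measurable_pair_borel:
  assumes [measurable]: "(\<lambda>(x, y). k x y) \<in> borel_measurable (borel \<Otimes>\<^sub>M borel)"
  shows "(\<lambda>(x, y). k x y) \<in> borel_measurable (M \<Otimes>\<^sub>M M)"
proof -
  have "(\<lambda>p. p) \<in> measurable (M \<Otimes>\<^sub>M M) (borel \<Otimes>\<^sub>M (borel :: real measure))"
  proof (rule measurable_pair)
    have id: "(\<lambda>x. x) \<in> borel_measurable M"
      by (intro continuous_imp_measurable_on_sets_lebesgue) auto
    show "fst \<circ> (\<lambda>p. p) \<in> borel_measurable (M \<Otimes>\<^sub>M M)"
      using measurable_comp[OF measurable_fst id] by (simp add: o_def)
    show "snd \<circ> (\<lambda>p. p) \<in> borel_measurable (M \<Otimes>\<^sub>M M)"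
      using measurable_comp[OF measurable_snd id] by (simp add: o_def)
  qed
  from measurable_comp[OF this assms] show ?thesis by (simp add: o_def)
qed

section \<open>Bounded kernels on the square\<close>

lemma bdd2_const [simp]: "bdd2 (\<lambda>x \<theta>. c)"
  by (auto simp: bdd2_def)

lemma bdd2_add:
  assumes "bdd2 f" "bdd2 g"
  shows "bdd2 (\<lambda>x \<theta>. f x \<theta> + g x \<theta>)"
proof -
  have m: "(\<lambda>(x, \<theta>). f x \<theta>) \<in> borel_measurable (M \<Otimes>\<^sub>M M)"
    "(\<lambda>(x, \<theta>). g x \<theta>) \<in> borel_measurable (M \<Otimes>\<^sub>M M)"
    using assms by (auto simp: bdd2_def)
  obtain B where B: "B \<ge> 0" "\<forall>x\<in>{a..b}. \<forall>\<theta>\<in>{a..b}. \<bar>f x \<theta>\<bar> \<le> B" by (rule bdd2E[OF assms(1)])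
  obtain C where C: "C \<ge> 0" "\<forall>x\<in>{a..b}. \<forall>\<theta>\<in>{a..b}. \<bar>g x \<theta>\<bar> \<le> C" by (rule bdd2E[OF assms(2)])
  have "\<bar>f x \<theta> + g x \<theta>\<bar> \<le> B + C" if "x \<in> {a..b}" "\<theta> \<in> {a..b}" for x \<theta>
    using B(2)[rule_format, OF that] C(2)[rule_format, OF that] by linarith
  moreover have "(\<lambda>(x, \<theta>). f x \<theta> + g x \<theta>) \<in> borel_measurable (M \<Otimes>\<^sub>M M)"
    using borel_measurable_add[OF m] by (simp add: case_prod_beta')
  ultimately show ?thesis unfolding bdd2_def by (auto intro!: exI[of _ "B + C"])
qed

lemma bdd2_mult:
  assumes "bdd2 f" "bdd2 g"
  shows "bdd2 (\<lambda>x \<theta>. f x \<theta> * g x \<theta>)"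
proof -
  have m: "(\<lambda>(x, \<theta>). f x \<theta>) \<in> borel_measurable (M \<Otimes>\<^sub>M M)"
    "(\<lambda>(x, \<theta>). g x \<theta>) \<in> borel_measurable (M \<Otimes>\<^sub>M M)"
    using assms by (auto simp: bdd2_def)
  obtain B where B: "B \<ge> 0" "\<forall>x\<in>{a..b}. \<forall>\<theta>\<in>{a..b}. \<bar>f x \<theta>\<bar> \<le> B" by (rule bdd2E[OF assms(1)])
  obtain C where C: "C \<ge> 0" "\<forall>x\<in>{a..b}. \<forall>\<theta>\<in>{a..b}. \<bar>g x \<theta>\<bar> \<le> C" by (rule bdd2E[OF assms(2)])
  have "\<bar>f x \<theta> * g x \<theta>\<bar> \<le> B * C" if "x \<in> {a..b}" "\<theta> \<in> {a..b}" for x \<theta>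
    using B(2)[rule_format, OF that] C(2)[rule_format, OF that] B(1) C(1) by (simp add: abs_mult mult_mono)
  moreover have "(\<lambda>(x, \<theta>). f x \<theta> * g x \<theta>) \<in> borel_measurable (M \<Otimes>\<^sub>M M)"
    using borel_measurable_times[OF m] by (simp add: case_prod_beta')
  ultimately show ?thesis unfolding bdd2_def by (auto intro!: exI[of _ "B * C"])
qed

lemma bdd2_swap:
  assumes "bdd2 k"
  shows "bdd2 (\<lambda>x \<theta>. k \<theta> x)"
proof -
  have [measurable]: "(\<lambda>(x, \<theta>). k x \<theta>) \<in> borel_measurable (M \<Otimes>\<^sub>M M)"
    using assms by (auto simp: bdd2_def)
  have "(\<lambda>(x, \<theta>). k \<theta> x) \<in> borel_measurable (M \<Otimes>\<^sub>M M)"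
    using measurable_pair_swap[of "\<lambda>(x, \<theta>). k x \<theta>" M M borel] by simp
  then show ?thesis using assms by (auto simp: bdd2_def)
qed

lemma bdd2_fst: "bdd f \<Longrightarrow> bdd2 (\<lambda>x \<theta>. f x)"
  using measurable_comp[OF measurable_fst, of f M borel M] by (auto simp: bdd_def bdd2_def o_def case_prod_beta')

lemma bdd2_snd: "bdd f \<Longrightarrow> bdd2 (\<lambda>x \<theta>. f \<theta>)"
  using measurable_comp[OF measurable_snd, of f M borel M] by (auto simp: bdd_def bdd2_def o_def case_prod_beta')

text \<open>Multiplying by this kernel turns an integral over [a, x] into one over [a, b], so that
  Volterra operators become ordinary kernel operators.\<close>

lemma bdd2_triangle: "bdd2 (\<lambda>x \<theta>. if \<theta> \<le> x then 1 else 0)"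
proof -
  have "(\<lambda>(x, \<theta>). if \<theta> \<le> (x::real) then 1 else 0 :: real) \<in> borel_measurable (borel \<Otimes>\<^sub>M borel)"
    by measurable
  from borel_measurable_pair_borel[OF this] show ?thesis
    unfolding bdd2_def by (auto intro!: exI[of _ 1])
qed

lemma bdd2_diff_var: "bdd2 (\<lambda>x \<theta>. x - \<theta>)"
proof -
  have id: "bdd (\<lambda>x. x)" by (intro bdd_continuous continuous_intros)
  have "bdd2 (\<lambda>x \<theta>. x + (- 1) * \<theta>)"
    by (rule bdd2_add[OF bdd2_fst[OF id] bdd2_mult[OF bdd2_const bdd2_snd[OF id]]])
  then show ?thesis by simp
qed

lemma bdd2_slice: "bdd2 k \<Longrightarrow> x \<in> {a..b} \<Longrightarrow> bdd (k x)"
  using measurable_Pair2[of "\<lambda>(x, \<theta>). k x \<theta>" M M borel x] unfolding bdd2_def bdd_def by fastforce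

lemma bdd_poly: "bdd (poly p)"
  by (intro bdd_continuous continuous_intros)

text \<open>Horner's scheme in the outer variable, which is evaluated at \<theta>; the coefficients
  are polynomials evaluated at x.\<close>

lemma bdd2_poly: "bdd2 (\<lambda>x \<theta>. poly (poly p [:\<theta>:]) x)"
proof (induction p)
  case (pCons q p)
  have "bdd2 (\<lambda>x \<theta>. \<theta>)"
    by (intro bdd2_snd bdd_continuous continuous_intros)
  with pCons show ?case by (auto intro!: bdd2_add bdd2_mult bdd2_fst bdd_poly)
qed auto

section \<open>Square-integrable functions\<close>

lemma sq_int_integrable_mult:
  assumes "sq_int f" "sq_int g"
  shows "integrable M (\<lambda>x. f x * g x)"
proof (rule Bochner_Integration.integrable_bound)
  show "integrable M (\<lambda>x. (f x)\<^sup>2 + (g x)\<^sup>2)" using assms by (auto simp: sq_int_def)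
  show "(\<lambda>x. f x * g x) \<in> borel_measurable M"
    using assms[THEN sq_int_measurable] by measurable
  have "\<bar>f x * g x\<bar> \<le> (f x)\<^sup>2 + (g x)\<^sup>2" for x
    using sum_squares_bound[of "\<bar>f x\<bar>" "\<bar>g x\<bar>"] zero_le_square[of "f x"] zero_le_square[of "g x"]
      abs_ge_zero[of "f x * g x"]
    by (simp only: abs_mult power2_abs)
  then show "AE x in M. norm (f x * g x) \<le> norm ((f x)\<^sup>2 + (g x)\<^sup>2)" by auto
qed

lemma sq_int_add:
  assumes "sq_int f" "sq_int g"
  shows "sq_int (\<lambda>x. f x + g x)"
proof -
  have "integrable M (\<lambda>x. (f x)\<^sup>2 + (g x)\<^sup>2 + 2 * (f x * g x))"
    using assms sq_int_integrable_mult[OF assms] by (auto simp: sq_int_def)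
  moreover have "(\<lambda>x. f x + g x) \<in> borel_measurable M"
    using assms[THEN sq_int_measurable] by measurable
  ultimately show ?thesis by (simp add: sq_int_def power2_sum algebra_simps)
qed

lemma sq_int_bdd_mult:
  assumes "bdd r" "sq_int f"
  shows "sq_int (\<lambda>x. r x * f x)"
proof -
  note [measurable] = assms
  obtain B where B: "B \<ge> 0" "\<forall>x\<in>{a..b}. \<bar>r x\<bar> \<le> B" by (rule bddE[OF assms(1)])
  have "integrable M (\<lambda>x. (r x * f x)\<^sup>2)"
  proof (rule Bochner_Integration.integrable_bound)
    show "integrable M (\<lambda>x. B\<^sup>2 * (f x)\<^sup>2)" using assms by (auto simp: sq_int_def)
    have "(r x)\<^sup>2 \<le> B\<^sup>2" if "x \<in> {a..b}" for x
      using B(2)[rule_format, OF that] by (metis abs_ge_zero power2_abs power_mono)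
    then show "AE x in M. norm ((r x * f x)\<^sup>2) \<le> norm (B\<^sup>2 * (f x)\<^sup>2)"
      by (intro AE_I2) (auto simp: power_mult_distrib mult_right_mono)
  qed measurable
  then show ?thesis by (simp add: sq_int_def)
qed

lemma bdd_sq_int: "bdd f \<Longrightarrow> sq_int f"
proof -
  assume f: "bdd f"
  note [measurable] = f
  obtain B where B: "B \<ge> 0" "\<forall>x\<in>{a..b}. \<bar>f x\<bar> \<le> B" by (rule bddE[OF f])
  have "(f x)\<^sup>2 \<le> B\<^sup>2" if "x \<in> {a..b}" for x
    using B(2)[rule_format, OF that] by (metis abs_ge_zero power2_abs power_mono)
  then have "integrable M (\<lambda>x. (f x)\<^sup>2)"
    by (intro M.integrable_const_bound[of _ "B\<^sup>2"] AE_I2) auto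
  then show "sq_int f" by (simp add: sq_int_def)
qed

lemma sq_int_cmult: "sq_int f \<Longrightarrow> sq_int (\<lambda>x. c * f x)"
  by (rule sq_int_bdd_mult) auto

lemma sq_int_const [simp]: "sq_int (\<lambda>x. c)"
  by (intro bdd_sq_int bdd_const)

lemma sq_int_minus: "sq_int f \<Longrightarrow> sq_int (\<lambda>x. - f x)"
  using sq_int_cmult[of f "-1"] by simp

lemma sq_int_diff: "sq_int f \<Longrightarrow> sq_int g \<Longrightarrow> sq_int (\<lambda>x. f x - g x)"
  using sq_int_add[OF _ sq_int_minus, of f g] by simp

lemma sq_int_sum: "(\<And>i. i \<in> I \<Longrightarrow> sq_int (f i)) \<Longrightarrow> sq_int (\<lambda>x. \<Sum>i\<in>I. f i x)"
  by (induction I rule: infinite_finite_induct) (auto intro!: sq_int_add)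

lemma sq_int_integrable: "sq_int f \<Longrightarrow> integrable M f"
  using sq_int_integrable_mult[of f "\<lambda>x. 1"] by simp

lemma bdd_integrable_mult: "bdd r \<Longrightarrow> sq_int f \<Longrightarrow> integrable M (\<lambda>x. r x * f x)"
  by (intro sq_int_integrable sq_int_bdd_mult)

lemma sq_int_cong:
  assumes "sq_int f" "\<And>x. x \<in> {a..b} \<Longrightarrow> f x = g x"
  shows "sq_int g"
proof -
  have "g \<in> borel_measurable M \<longleftrightarrow> f \<in> borel_measurable M"
    by (intro measurable_cong) (use assms in auto)
  moreover have "integrable M (\<lambda>x. (g x)\<^sup>2) \<longleftrightarrow> integrable M (\<lambda>x. (f x)\<^sup>2)"
    by (intro Bochner_Integration.integrable_cong) (use assms in auto)
  ultimately show ?thesis using assms by (auto simp: sq_int_def)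
qed

section \<open>Integral operators with a bounded kernel\<close>

lemma kernel_abs_le:
  assumes k: "bdd2 k" and f: "sq_int f" and x: "x \<in> {a..b}"
    and B: "\<And>x \<theta>. x \<in> {a..b} \<Longrightarrow> \<theta> \<in> {a..b} \<Longrightarrow> \<bar>k x \<theta>\<bar> \<le> B"
  shows "\<bar>LINT \<theta>|M. k x \<theta> * f \<theta>\<bar> \<le> B * (LINT \<theta>|M. \<bar>f \<theta>\<bar>)"
proof -
  have "\<bar>LINT \<theta>|M. k x \<theta> * f \<theta>\<bar> \<le> (LINT \<theta>|M. \<bar>k x \<theta> * f \<theta>\<bar>)"
    by (rule integral_abs_bound)
  also have "\<dots> \<le> (LINT \<theta>|M. B * \<bar>f \<theta>\<bar>)"
  proof (rule integral_mono_AE)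
    show "integrable M (\<lambda>\<theta>. \<bar>k x \<theta> * f \<theta>\<bar>)" "integrable M (\<lambda>\<theta>. B * \<bar>f \<theta>\<bar>)"
      using bdd_integrable_mult[OF bdd2_slice[OF k x] f] sq_int_integrable[OF f] by auto
    show "AE \<theta> in M. \<bar>k x \<theta> * f \<theta>\<bar> \<le> B * \<bar>f \<theta>\<bar>"
      using B[OF x] by (intro AE_I2) (auto simp: abs_mult intro!: mult_right_mono)
  qed
  finally show ?thesis by simp
qed

text \<open>The bound, a multiple of the integral of |f|, does not depend on x; a kernel operator
  therefore maps square-integrable functions to bounded ones.\<close>

lemma bdd_kernel:
  assumes k: "bdd2 k" and f: "sq_int f"
  shows "bdd (\<lambda>x. LINT \<theta>|M. k x \<theta> * f \<theta>)"
proof -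
  have [measurable]: "(\<lambda>(x, \<theta>). k x \<theta>) \<in> borel_measurable (M \<Otimes>\<^sub>M M)" "f \<in> borel_measurable M"
    using assms by (auto simp: bdd2_def sq_int_def)
  obtain B where B: "B \<ge> 0" "\<forall>x\<in>{a..b}. \<forall>\<theta>\<in>{a..b}. \<bar>k x \<theta>\<bar> \<le> B"
    by (rule bdd2E[OF k])
  note le = kernel_abs_le[OF k f _ B(2)[rule_format]]
  have "\<bar>LINT \<theta>|M. k x \<theta> * f \<theta>\<bar> \<le> B * (LINT \<theta>|M. \<bar>f \<theta>\<bar>)" if "x \<in> {a..b}" for x using that by (rule le)
  moreover have "(\<lambda>x. LINT \<theta>|M. k x \<theta> * f \<theta>) \<in> borel_measurable M" by measurable
  ultimately show ?thesis unfolding bdd_def by (auto intro!: exI[of _ "B * (LINT \<theta>|M. \<bar>f \<theta>\<bar>)"])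
qed

text \<open>The integrand is dominated by \<open>B * (g x * f \<theta>)\<close>, whose absolute
  integral factors. Every exchange of integrals below is an instance: adjoints, integration by
  parts, the twofold primitive and the moment of F in the boundary form.\<close>

lemma kernel_Fubini:
  assumes k: "bdd2 k" and f: "sq_int f" and g: "sq_int g"
  shows "(LINT x|M. g x * (LINT \<theta>|M. k x \<theta> * f \<theta>)) = (LINT \<theta>|M. (LINT x|M. k x \<theta> * g x) * f \<theta>)"
proof -
  have [measurable]: "(\<lambda>(x, \<theta>). k x \<theta>) \<in> borel_measurable (M \<Otimes>\<^sub>M M)"
    "f \<in> borel_measurable M" "g \<in> borel_measurable M"
    using assms by (auto simp: bdd2_def sq_int_def)
  obtain B where B: "B \<ge> 0" "\<forall>x\<in>{a..b}. \<forall>\<theta>\<in>{a..b}. \<bar>k x \<theta>\<bar> \<le> B"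
    by (rule bdd2E[OF k])
  have "integrable (M \<Otimes>\<^sub>M M) (\<lambda>(x, \<theta>). B * (g x * f \<theta>))"
  proof (rule MM.Fubini_integrable)
    show "(\<lambda>(x, \<theta>). B * (g x * f \<theta>)) \<in> borel_measurable (M \<Otimes>\<^sub>M M)" by measurable
    have "integrable M (\<lambda>x. \<bar>g x\<bar> * (B * (LINT y|M. \<bar>f y\<bar>)))"
      using sq_int_integrable[OF g] by auto
    then show "integrable M (\<lambda>x. LINT y|M. norm (case (x, y) of (x, \<theta>) \<Rightarrow> B * (g x * f \<theta>)))"
      using B(1) by (simp add: abs_mult mult.assoc mult.left_commute)
    show "AE x in M. integrable M (\<lambda>y. case (x, y) of (x, \<theta>) \<Rightarrow> B * (g x * f \<theta>))"
      using sq_int_integrable[OF f] by auto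
  qed
  then have "integrable (M \<Otimes>\<^sub>M M) (\<lambda>(x, \<theta>). g x * k x \<theta> * f \<theta>)"
  proof (rule Bochner_Integration.integrable_bound)
    have "\<bar>g x * k x \<theta> * f \<theta>\<bar> \<le> B * (\<bar>g x\<bar> * \<bar>f \<theta>\<bar>)" if "x \<in> {a..b}" "\<theta> \<in> {a..b}" for x \<theta>
      using mult_right_mono[OF B(2)[rule_format, OF that], of "\<bar>g x\<bar> * \<bar>f \<theta>\<bar>"] by (simp add: abs_mult mult_ac)
    then show "AE p in M \<Otimes>\<^sub>M M. norm (case p of (x, \<theta>) \<Rightarrow> g x * k x \<theta> * f \<theta>)
        \<le> norm (case p of (x, \<theta>) \<Rightarrow> B * (g x * f \<theta>))"
      using B(1) by (intro AE_I2) (auto simp: space_pair_measure abs_mult)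
  qed measurable
  from MM.Fubini_integral[OF this]
  have "(LINT \<theta>|M. LINT x|M. g x * k x \<theta> * f \<theta>) = (LINT x|M. LINT \<theta>|M. g x * k x \<theta> * f \<theta>)"
    by simp
  also have "(LINT x|M. LINT \<theta>|M. g x * k x \<theta> * f \<theta>) = (LINT x|M. g x * (LINT \<theta>|M. k x \<theta> * f \<theta>))"
    by (simp add: mult.assoc)
  also have "(LINT \<theta>|M. LINT x|M. g x * k x \<theta> * f \<theta>) = (LINT \<theta>|M. (LINT x|M. k x \<theta> * g x) * f \<theta>)"
    by (simp add: mult.commute)
  finally show ?thesis by simp
qed

end

section \<open>Weak derivatives and primitives\<close>

text \<open>A countable cover that works for \<open>lborel\<close> works for its completion.\<close>

lemma sigma_finite_lebesgue: "sigma_finite_measure (lebesgue :: real measure)"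
proof
  obtain A :: "real set set" where "countable A" "A \<subseteq> sets lborel" "\<Union>A = space lborel"
    "\<forall>a\<in>A. emeasure lborel a \<noteq> \<infinity>"
    using lborel.sigma_finite_countable by blast
  then show "\<exists>A. countable A \<and> A \<subseteq> sets (lebesgue :: real measure) \<and> \<Union>A = space lebesgue \<and>
      (\<forall>a\<in>A. emeasure lebesgue a \<noteq> \<infinity>)"
    by (intro exI[of _ A]) (auto simp: subset_iff)
qed

text \<open>Open intervals generate the Borel sets and are stable under intersection, so by Dynkin's
  argument the integral vanishes over every Borel set. A Lebesgue set differs from a Borel set by a
  null set, and a density all of whose integrals vanish is zero.\<close>

lemma AE_eq_0_if_integral_box_eq_0:
  fixes h :: "real \<Rightarrow> real"
  assumes h: "integrable lebesgue h" and all0: "integral\<^sup>L lebesgue h = 0"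
    and box0: "\<And>c d. set_lebesgue_integral lebesgue (box c d) h = 0"
  shows "AE x in lebesgue. h x = 0"
proof (rule sigma_finite_measure.density_zero[OF sigma_finite_lebesgue h])
  have int [simp]: "set_integrable lebesgue A h" if "A \<in> sets lebesgue" for A
    unfolding set_integrable_def using that h by (rule integrable_mult_indicator)
  have borel0: "set_lebesgue_integral lebesgue A h = 0" if "A \<in> sets borel" for A
  proof -
    let ?G = "range (\<lambda>(c, d). box c d :: real set)"
    have A: "A \<in> sigma_sets UNIV ?G"
      using that by (subst (asm) borel_eq_box) (simp del: box_real)
    have leb: "B \<in> sets lebesgue" if "B \<in> sigma_sets UNIV ?G" for B
    proof -
      have "B \<in> sets borel"
        using that by (subst borel_eq_box) (simp del: box_real)
      then show ?thesis by auto
    qed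
    have "Int_stable ?G"
      by (auto simp: Int_stable_def Int_interval box_real)
    moreover have "?G \<subseteq> Pow UNIV" by simp
    ultimately show ?thesis using A
    proof (induction rule: sigma_sets_induct_disjoint)
      fix B assume "B \<in> ?G"
      then show "set_lebesgue_integral lebesgue B h = 0" using box0 by auto
    next
      show "set_lebesgue_integral lebesgue {} h = 0" by (simp add: set_lebesgue_integral_def)
    next
      \<comment> \<open>Closure under complements is where the vanishing total integral
        enters.\<close>
      fix B assume B: "B \<in> sigma_sets UNIV ?G" and B0: "set_lebesgue_integral lebesgue B h = 0"
      have "set_lebesgue_integral lebesgue (B \<union> (UNIV - B)) h
          = set_lebesgue_integral lebesgue B h + set_lebesgue_integral lebesgue (UNIV - B) h"
        by (intro set_integral_Un int leb B sigma_sets.Compl) auto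
      then show "set_lebesgue_integral lebesgue (UNIV - B) h = 0"
        using B0 all0 by (simp add: set_lebesgue_integral_def)
    next
      fix B :: "nat \<Rightarrow> real set"
      assume disj: "disjoint_family B" and B: "range B \<subseteq> sigma_sets UNIV ?G"
        and B0: "\<And>i. set_lebesgue_integral lebesgue (B i) h = 0"
      have [simp]: "B i \<in> sets lebesgue" for i using B leb by auto
      have "set_lebesgue_integral lebesgue (\<Union>i. B i) h = (\<Sum>i. set_lebesgue_integral lebesgue (B i) h)"
        using disj B
        by (intro lebesgue_integral_countable_add int leb sigma_sets.Union) (auto simp: disjoint_family_on_def)
      then show "set_lebesgue_integral lebesgue (\<Union>i. B i) h = 0" using B0 by simp
    qed
  qed
  fix A :: "real set" assume "A \<in> sets lebesgue"
  then obtain S N N' where A: "A = S \<union> N" "N \<subseteq> N'" "N' \<in> null_sets lborel" "S \<in> sets lborel"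
    by (rule sets_completionE)
  have "AE x in lebesgue. x \<notin> N'"
    using A(3) by (intro AE_completion AE_not_in)
  then have "set_lebesgue_integral lebesgue A h = set_lebesgue_integral lebesgue S h"
    unfolding set_lebesgue_integral_def
    using A \<open>A \<in> sets lebesgue\<close> borel_measurable_integrable[OF h]
    by (intro integral_cong_AE borel_measurable_scaleR borel_measurable_indicator)
      (auto simp: indicator_def elim!: eventually_mono)
  then show "set_lebesgue_integral lebesgue A h = 0"
    using borel0 A(4) by simp
qed

context compact_interval
begin

section \<open>The interval as a part of the line: null sets and vanishing integrals\<close>

lemma AE_M_neq: "AE x in M. x \<noteq> c"
  using AE_completion[OF AE_lborel_singleton[of c]] by (simp add: AE_restrict_space_iff eventually_mono)

lemma AE_M_iff: "(AE x in M. P x) \<longleftrightarrow> (AE x in lebesgue. x \<in> {a..b} \<longrightarrow> P x)"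
  by (simp add: AE_restrict_space_iff)

lemma indicator_measurable_M:
  assumes "A \<in> sets lebesgue"
  shows "(indicator A :: real \<Rightarrow> real) \<in> borel_measurable M"
  using assms by (intro measurable_restrict_space1 borel_measurable_indicator)

lemma integral_M: "(LINT x|M. f x) = (LINT x|lebesgue. indicator {a..b} x * f x)" for f :: "real \<Rightarrow> real"
  by (simp add: integral_restrict_space)

lemma integrable_M: "integrable M f \<longleftrightarrow> integrable lebesgue (\<lambda>x. indicator {a..b} x * f x)" for f :: "real \<Rightarrow> real"
  by (simp add: integrable_restrict_space)

text \<open>Extending g by 0 reduces the claim to the one on the whole line.\<close>

lemma AE_eq_0_if_integral_interval_eq_0:
  fixes g :: "real \<Rightarrow> real"
  assumes g: "integrable M g"
    and int0: "\<And>c d. a \<le> c \<Longrightarrow> c < d \<Longrightarrow> d \<le> b \<Longrightarrow> (LINT x|M. indicator {c<..<d} x * g x) = 0"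
  shows "AE x in M. g x = 0"
proof -
  define h where "h x = indicator {a..b} x * g x" for x
  have box0: "set_lebesgue_integral lebesgue (box c d) h = 0" for c d
  proof -
    have m: "(\<lambda>x. indicator {c<..<d} x * g x) \<in> borel_measurable M" for c d
      using borel_measurable_integrable[OF g] by (intro borel_measurable_times indicator_measurable_M) auto
    have "set_lebesgue_integral lebesgue (box c d) h = (LINT x|M. indicator {c<..<d} x * g x)"
      by (simp add: set_lebesgue_integral_def h_def integral_M box_real mult_ac)
    \<comment> \<open>On [a, b] an interval and its part inside (a, b) differ at most in the points
      a and b.\<close>
    also have "\<dots> = (LINT x|M. indicator {max a c<..<min b d} x * g x)"
    proof (rule integral_cong_AE)
      show "AE x in M. indicator {c<..<d} x * g x = indicator {max a c<..<min b d} x * g x"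
        using AE_M_neq[of a] AE_M_neq[of b] AE_space[of M]
        by eventually_elim (auto simp: indicator_def)
    qed (rule m)+
    also have "\<dots> = 0"
    proof (cases "max a c < min b d")
      case True
      then show ?thesis by (intro int0) auto
    next
      case False
      then have e: "{max a c<..<min b d} = {}" by auto
      show ?thesis unfolding e by simp
    qed
    finally show ?thesis .
  qed
  have all0: "integral\<^sup>L lebesgue h = 0"
  proof -
    have "integral\<^sup>L lebesgue h = set_lebesgue_integral lebesgue (box (a - 1) (b + 1)) h"
      unfolding set_lebesgue_integral_def
      by (intro Bochner_Integration.integral_cong) (auto simp: h_def indicator_def box_real)
    then show ?thesis using box0 by simp
  qed
  have "AE x in lebesgue. h x = 0"
    by (intro AE_eq_0_if_integral_box_eq_0 box0 all0) (use g in \<open>simp add: integrable_M h_def\<close>)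
  then show ?thesis
    unfolding AE_M_iff by eventually_elim (auto simp: h_def indicator_def)
qed

text \<open>The function |f - g| is continuous and nonnegative with integral 0, hence identically
  0.\<close>

lemma continuous_AE_eq:
  fixes f g :: "real \<Rightarrow> real"
  assumes f: "continuous_on {a..b} f" and g: "continuous_on {a..b} g"
    and eq: "AE x in M. f x = g x" and x: "x \<in> {a..b}"
  shows "f x = g x"
proof -
  let ?h = "\<lambda>x. \<bar>f x - g x\<bar>"
  have h: "continuous_on {a..b} ?h"
    by (intro continuous_intros f g)
  have int: "integrable M ?h"
    by (intro sq_int_integrable bdd_sq_int bdd_continuous h)
  have "integral\<^sup>L M ?h = 0"
    by (rule integral_eq_zero_AE) (use eq in \<open>auto elim!: eventually_mono\<close>)
  then have "(?h has_integral 0) (cbox a b)"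
    using has_integral_integral_lebesgue_on[OF int] by simp
  then have "?h x = 0"
    using h x ab by (intro has_integral_0_cbox_imp_0[of a b ?h]) (auto simp: box_real)
  then show ?thesis by simp
qed

text \<open>A trapezoid: for k > 0 it vanishes where \<open>min (x - c) (d - x)\<close> is at most
  1/k and equals 1 where it is at least 2/k. The shift by 1 puts the support strictly inside (c, d),
  as required of a test function.\<close>

definition bump :: "nat \<Rightarrow> real \<Rightarrow> real \<Rightarrow> real \<Rightarrow> real" where
  "bump k c d x = min 1 (max 0 (real k * min (x - c) (d - x) - 1))"

lemma bump_limit:
  assumes f: "integrable M f" and cd: "c < d"
  shows "(\<lambda>k. LINT x|M. bump k c d x * f x) \<longlonglongrightarrow> (LINT x|M. indicator {c<..<d} x * f x)"
proof (rule integral_dominated_convergence)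
  show "integrable M (\<lambda>x. \<bar>f x\<bar>)" using f by simp
  have [measurable]: "f \<in> borel_measurable M" using f by simp
  have "bump k c d \<in> borel_measurable M" for k
    unfolding bump_def by (intro continuous_imp_measurable_on_sets_lebesgue continuous_intros) auto
  then show "(\<lambda>x. bump k c d x * f x) \<in> borel_measurable M" for k by measurable
  show "(\<lambda>x. indicator {c<..<d} x * f x) \<in> borel_measurable M"
    by (intro borel_measurable_times indicator_measurable_M) auto
  have "\<bar>bump k c d x\<bar> \<le> 1" for k x by (auto simp: bump_def)
  then show "AE x in M. norm (bump k c d x * f x) \<le> \<bar>f x\<bar>" for k
    by (auto simp: abs_mult intro!: mult_left_le_one_le)
  have "(\<lambda>k. bump k c d x) \<longlonglongrightarrow> indicator {c<..<d} x" for x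
  proof (cases "x \<in> {c<..<d}")
    case True
    define \<delta> where "\<delta> = min (x - c) (d - x)"
    have "\<delta> > 0" using True by (auto simp: \<delta>_def)
    \<comment> \<open>For k \<ge> 2 / \<delta> the ramp has reached its plateau at x, since then
      \<open>real k * \<delta> - 1\<close> is at least 1.\<close>
    have "eventually (\<lambda>k. bump k c d x = 1) sequentially"
      using eventually_ge_at_top[of "nat \<lceil>2 / \<delta>\<rceil>"]
    proof eventually_elim
      case (elim k)
      then have "2 / \<delta> \<le> real k" by linarith
      then have "2 \<le> real k * \<delta>" using \<open>\<delta> > 0\<close> by (simp add: field_simps)
      then show ?case unfolding bump_def \<delta>_def[symmetric] by auto
    qed
    then show ?thesis using True by (auto intro: tendsto_eventually)
  next
    case False
    then have "min (x - c) (d - x) \<le> 0" by auto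
    then have le: "real k * min (x - c) (d - x) \<le> 0" for k by (intro mult_nonneg_nonpos) auto
    have "max 0 (real k * min (x - c) (d - x) - 1) = 0" for k using le[of k] by (intro max_absorb1) linarith
    then have "bump k c d x = 0" for k unfolding bump_def by simp
    then show ?thesis using False by simp
  qed
  then show "AE x in M. (\<lambda>k. bump k c d x * f x) \<longlonglongrightarrow> indicator {c<..<d} x * f x"
    by (intro AE_I2 tendsto_mult tendsto_const)
qed

text \<open>Only continuity is asked, because these functions stand for the derivatives of the
  continuously differentiable test functions in the definition of weak derivatives.\<close>

definition test_fun :: "(real \<Rightarrow> real) \<Rightarrow> bool" where
  "test_fun \<psi> \<longleftrightarrow> continuous_on UNIV \<psi> \<and> (\<exists>c d. a < c \<and> c < d \<and> d < b \<and> (\<forall>x. x \<notin> {c..d} \<longrightarrow> \<psi> x = 0))"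

lemma test_fun_bump:
  assumes "a \<le> c" "c < d" "d \<le> b"
  shows "test_fun (bump k c d)"
proof -
  \<comment> \<open>The first bound keeps \<open>real k * min (x - c) (d - x)\<close> at most 1
    outside the shrunk interval, with k + 1 so as to cover k = 0; the second keeps that interval
    nondegenerate.\<close>
  define \<delta> where "\<delta> = min (1 / (real k + 1)) ((d - c) / 3)"
  have \<delta>: "\<delta> > 0" "\<delta> \<le> (d - c) / 3" "\<delta> \<le> 1 / (real k + 1)"
    using assms unfolding \<delta>_def by (simp, linarith, linarith)
  have "bump k c d x = 0" if "x \<notin> {c + \<delta>..d - \<delta>}" for x
  proof -
    have "min (x - c) (d - x) \<le> \<delta>" using that by auto
    then have "real k * min (x - c) (d - x) \<le> real k * (1 / (real k + 1))"
      using \<delta>(3) by (intro mult_left_mono) auto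
    also have "\<dots> \<le> 1" by simp
    finally show ?thesis unfolding bump_def by auto
  qed
  moreover have "a < c + \<delta>" "c + \<delta> < d - \<delta>" "d - \<delta> < b"
    using assms \<delta> by auto
  moreover have "continuous_on UNIV (bump k c d)"
    unfolding bump_def by (intro continuous_intros)
  ultimately show ?thesis unfolding test_fun_def by blast
qed

lemma test_fun_lincomb:
  assumes "test_fun \<psi>" "test_fun \<chi>"
  shows "test_fun (\<lambda>x. s * \<psi> x + t * \<chi> x)"
proof -
  obtain c d where 1: "a < c" "c < d" "d < b" "\<forall>x. x \<notin> {c..d} \<longrightarrow> \<psi> x = 0"
    using assms(1) unfolding test_fun_def by blast
  obtain c' d' where 2: "a < c'" "c' < d'" "d' < b" "\<forall>x. x \<notin> {c'..d'} \<longrightarrow> \<chi> x = 0"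
    using assms(2) unfolding test_fun_def by blast
  have "\<forall>x. x \<notin> {min c c'..max d d'} \<longrightarrow> s * \<psi> x + t * \<chi> x = 0"
    using 1(4) 2(4) by (simp add: not_le)
  moreover have "a < min c c'" "min c c' < max d d'" "max d d' < b" using 1 2 by auto
  moreover have "continuous_on UNIV (\<lambda>x. s * \<psi> x + t * \<chi> x)"
    using assms by (auto simp: test_fun_def intro!: continuous_intros)
  ultimately show ?thesis unfolding test_fun_def by blast
qed

lemma bdd_continuous_UNIV: "continuous_on UNIV f \<Longrightarrow> bdd f"
  by (rule bdd_continuous) (rule continuous_on_subset, auto)

lemma test_fun_bdd: "test_fun \<psi> \<Longrightarrow> bdd \<psi>"
  by (auto simp: test_fun_def intro: bdd_continuous_UNIV)

lemma integral_M_deriv: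
  assumes "a \<le> c" "c \<le> d" "d \<le> b"
    and F: "\<And>x. (F has_real_derivative f x) (at x)" and f: "continuous_on UNIV f"
  shows "(LINT x|M. indicator {c..d} x * f x) = F d - F c"
proof -
  have "(f has_integral (F d - F c)) {c..d}"
    using F by (intro fundamental_theorem_of_calculus assms)
      (auto simp: has_real_derivative_iff_has_vector_derivative intro: has_vector_derivative_at_within)
  then have "integral {c..d} f = F d - F c" by (rule integral_unique)
  moreover have "continuous_on {c..d} f" using f continuous_on_subset by blast
  ultimately have "(LINT x|lebesgue_on {c..d}. f x) = F d - F c"
    by (subst lebesgue_integral_eq_integral) (auto intro: continuous_imp_integrable_real)
  moreover have "(LINT x|M. indicator {c..d} x * f x) = (LINT x|lebesgue_on {c..d}. f x)"
    unfolding integral_M by (subst integral_restrict_space)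
      (use assms in \<open>auto intro!: Bochner_Integration.integral_cong simp: indicator_def\<close>)
  ultimately show ?thesis by simp
qed

text \<open>An antiderivative is constant on either side of the support. The two constants agree
  because the mean of \<psi> is 0, and subtracting them leaves compact support.\<close>

lemma test_fun_primitive:
  assumes "test_fun \<psi>" and int: "(LINT x|M. \<psi> x) = 0"
  obtains \<phi> c d where "a < c" "c < d" "d < b" "\<And>x. (\<phi> has_real_derivative \<psi> x) (at x)"
    "\<And>x. x \<notin> {c..d} \<Longrightarrow> \<phi> x = 0"
proof -
  obtain c d where cd: "a < c" "c < d" "d < b" and supp: "\<And>x. x \<notin> {c..d} \<Longrightarrow> \<psi> x = 0"
    using assms(1) unfolding test_fun_def by blast
  have cont: "continuous_on UNIV \<psi>" using assms(1) by (simp add: test_fun_def)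
  have "isCont \<psi> x" for x using cont by (simp add: continuous_on_eq_continuous_at)
  then have "\<exists>F. \<forall>x::real. -\<infinity> < ereal x \<longrightarrow> ereal x < \<infinity> \<longrightarrow> (F has_vector_derivative \<psi> x) (at x)"
    by (intro einterval_antiderivative) auto
  then obtain F where F: "\<And>x. (F has_real_derivative \<psi> x) (at x)"
    by (auto simp: has_real_derivative_iff_has_vector_derivative)
  have left: "F x = F c" if "x < c" for x
  proof -
    obtain z where "x < z" "z < c" "F c - F x = (c - x) * \<psi> z"
      using MVT2[OF \<open>x < c\<close> F] by blast
    then show ?thesis using supp[of z] by simp
  qed
  have right: "F x = F d" if "d < x" for x
  proof -
    obtain z where "d < z" "z < x" "F x - F d = (x - d) * \<psi> z"
      using MVT2[OF \<open>d < x\<close> F] by blast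
    then show ?thesis using supp[of z] by simp
  qed
  have "F b - F a = (LINT x|M. indicator {a..b} x * \<psi> x)"
    using ab by (intro integral_M_deriv[symmetric] F cont) auto
  also have "\<dots> = (LINT x|M. \<psi> x)"
    by (intro Bochner_Integration.integral_cong) auto
  finally have "F d = F c" using int left[of a] right[of b] cd by simp
  then show ?thesis
    using left right F cd
    by (intro that[of c d "\<lambda>x. F x - F c"]) (auto intro!: derivative_eq_intros simp: not_le)
qed

text \<open>A multiple of a fixed test function \<chi> of nonzero mean corrects the mean of any
  \<psi> to 0, so after subtracting a suitable constant from f the hypothesis reaches all test
  functions, in particular approximate indicators of intervals.\<close>

lemma du_Bois_Reymond:
  assumes f: "sq_int f"
    and test: "\<And>\<psi>. test_fun \<psi> \<Longrightarrow> (LINT x|M. \<psi> x) = 0 \<Longrightarrow> (LINT x|M. \<psi> x * f x) = 0"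
  shows "\<exists>C. AE x in M. f x = C"
proof -
  have one: "integrable M (\<lambda>x. 1 :: real)" by simp
  have "(LINT x|M. indicator {a<..<b} x * 1) = (LINT x|M. 1 :: real)"
  proof (rule integral_cong_AE)
    show "AE x in M. indicator {a<..<b} x * 1 = (1::real)"
      using AE_M_neq[of a] AE_M_neq[of b] AE_space[of M] by eventually_elim auto
    show "(\<lambda>x. indicator {a<..<b} x * 1 :: real) \<in> borel_measurable M"
      using indicator_measurable_M[of "{a<..<b}"] by simp
  qed simp
  then have lim: "(\<lambda>k. LINT x|M. bump k a b x * 1) \<longlonglongrightarrow> b - a"
    using bump_limit[OF one ab] integral_1_M by simp
  \<comment> \<open>The means of the trapezoids tend to b - a > 0, so they cannot all be 0.\<close>
  have "\<exists>k. (LINT x|M. bump k a b x) \<noteq> 0"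
  proof (rule ccontr)
    assume "\<nexists>k. (LINT x|M. bump k a b x) \<noteq> 0"
    then have "(\<lambda>k. LINT x|M. bump k a b x * 1) = (\<lambda>k. 0)" by simp
    with lim have "(\<lambda>k::nat. 0) \<longlonglongrightarrow> b - a" by simp
    then have "b - a = 0" by (simp add: LIMSEQ_const_iff)
    then show False using ab by simp
  qed
  then obtain \<chi> where \<chi>: "test_fun \<chi>" "(LINT x|M. \<chi> x) \<noteq> 0"
    using test_fun_bump[of a b] ab by auto
  define I where "I = (LINT x|M. \<chi> x)"
  \<comment> \<open>The average of f with weight \<chi>: the only constant for which \<chi> is
    orthogonal to f - C.\<close>
  define C where "C = (LINT x|M. \<chi> x * f x) / I"
  have I: "I \<noteq> 0" using \<chi> by (simp add: I_def)
  have zero: "(LINT x|M. \<psi> x * (f x - C)) = 0" if \<psi>: "test_fun \<psi>" for \<psi>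
  proof -
    define J where "J = (LINT x|M. \<psi> x)"
    note bd = test_fun_bdd[OF \<psi>] test_fun_bdd[OF \<chi>(1)]
    note int = bdd_integrable_mult[OF bd(1) f] bdd_integrable_mult[OF bd(2) f]
      sq_int_integrable[OF bdd_sq_int[OF bd(1)]] sq_int_integrable[OF bdd_sq_int[OF bd(2)]]
    have "(LINT x|M. I * \<psi> x + (- J) * \<chi> x) = I * J - J * I"
      using int by (simp add: I_def J_def)
    then have "(LINT x|M. (I * \<psi> x + (- J) * \<chi> x) * f x) = 0"
      by (intro test test_fun_lincomb \<psi> \<chi>) simp
    also have "(LINT x|M. (I * \<psi> x + (- J) * \<chi> x) * f x) = (LINT x|M. I * (\<psi> x * f x) + (- J) * (\<chi> x * f x))"
      by (simp add: algebra_simps)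
    also have "\<dots> = I * (LINT x|M. \<psi> x * f x) - J * (C * I)"
      using int I by (simp add: C_def)
    finally have "(LINT x|M. \<psi> x * f x) = C * J" using I by simp
    moreover have "(LINT x|M. \<psi> x * (f x - C)) = (LINT x|M. \<psi> x * f x) - C * J"
      using int by (simp add: J_def right_diff_distrib mult.commute[of _ C])
    ultimately show ?thesis by simp
  qed
  have fC: "integrable M (\<lambda>x. f x - C)" using sq_int_integrable[OF f] by simp
  have "AE x in M. f x - C = 0"
  proof (rule AE_eq_0_if_integral_interval_eq_0[OF fC])
    fix c d assume cd: "a \<le> c" "c < d" "d \<le> b"
    have "(\<lambda>k. LINT x|M. bump k c d x * (f x - C)) \<longlonglongrightarrow> (LINT x|M. indicator {c<..<d} x * (f x - C))"
      by (rule bump_limit[OF fC cd(2)])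
    then show "(LINT x|M. indicator {c<..<d} x * (f x - C)) = 0"
      using zero[OF test_fun_bump[OF cd]] by (simp add: LIMSEQ_const_iff)
  qed
  then show ?thesis by (intro exI[of _ C]) (auto elim!: eventually_mono)
qed

text \<open>The notion for a single component of \<open>is_weak_deriv\<close>, so that the analysis
  can be done for scalar functions.\<close>

definition weak_deriv :: "(real \<Rightarrow> real) \<Rightarrow> (real \<Rightarrow> real) \<Rightarrow> bool" where
  "weak_deriv f g \<longleftrightarrow> (\<forall>\<phi> \<phi>' c d. a < c \<longrightarrow> c < d \<longrightarrow> d < b \<longrightarrow>
     (\<forall>x. (\<phi> has_real_derivative \<phi>' x) (at x)) \<longrightarrow> continuous_on UNIV \<phi>' \<longrightarrow>
     (\<forall>x. x \<notin> {c..d} \<longrightarrow> \<phi> x = 0) \<longrightarrow>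
     (LINT x|M. f x * \<phi>' x) = - (LINT x|M. g x * \<phi> x))"

lemma is_weak_deriv_iff:
  "is_weak_deriv a b n u g \<longleftrightarrow> (\<forall>i<n. weak_deriv (\<lambda>x. u x $ i) (\<lambda>x. g x $ i))"
  unfolding is_weak_deriv_def weak_deriv_def by (rule iffI; meson)

section \<open>Primitives and their weak derivatives\<close>

definition prim :: "(real \<Rightarrow> real) \<Rightarrow> real \<Rightarrow> real" where
  "prim g x = (LINT \<theta>|lebesgue_on {a..x}. g \<theta>)"

lemma integral_initial_segment:
  fixes g :: "real \<Rightarrow> real"
  assumes "x \<in> {a..b}"
  shows "(LINT \<theta>|lebesgue_on {a..x}. g \<theta>) = (LINT \<theta>|M. (if \<theta> \<le> x then 1 else 0) * g \<theta>)"
  unfolding integral_M using assms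
  by (subst integral_restrict_space) (auto intro!: Bochner_Integration.integral_cong simp: indicator_def)

lemma prim_eq: "x \<in> {a..b} \<Longrightarrow> prim g x = (LINT \<theta>|M. (if \<theta> \<le> x then 1 else 0) * g \<theta>)"
  unfolding prim_def by (rule integral_initial_segment)

lemma prim_a [simp]: "prim g a = 0"
proof -
  have "prim g a = (LINT \<theta>|lebesgue. indicator {a} \<theta> *\<^sub>R g \<theta>)"
    unfolding prim_def by (subst integral_restrict_space) auto
  also have "\<dots> = 0"
    by (rule integral_eq_zero_AE)
      (use AE_completion[OF AE_lborel_singleton[of a]] in \<open>auto elim!: eventually_mono\<close>)
  finally show ?thesis .
qed

lemma continuous_on_prim: "sq_int g \<Longrightarrow> continuous_on {a..b} (prim g)"
  unfolding prim_def by (intro indefinite_integral_continuous_real sq_int_integrable)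

lemma bdd_prim: "sq_int g \<Longrightarrow> bdd (prim g)"
  by (intro bdd_continuous continuous_on_prim)

lemma kernel_triangle_deriv:
  assumes "\<theta> \<in> {a..b}" "\<And>x. (F has_real_derivative f x) (at x)" "continuous_on UNIV f"
  shows "(LINT x|M. (if \<theta> \<le> x then 1 else 0) * f x) = F b - F \<theta>"
proof -
  have "(LINT x|M. (if \<theta> \<le> x then 1 else 0) * f x) = (LINT x|M. indicator {\<theta>..b} x * f x)"
    by (intro Bochner_Integration.integral_cong) (auto simp: indicator_def)
  also have "\<dots> = F b - F \<theta>"
    using assms by (intro integral_M_deriv) auto
  finally show ?thesis .
qed

text \<open>With the primitive written through the triangle kernel, integration by parts becomes
  Fubini's theorem: the inner integral of \<open>\<phi>'\<close> over [\<theta>, b] is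
  \<open>\<phi> b - \<phi> \<theta>\<close>, and \<open>\<phi> b = 0\<close>.\<close>

lemma weak_deriv_prim:
  assumes g: "sq_int g"
  shows "weak_deriv (prim g) g"
  unfolding weak_deriv_def
proof (intro allI impI)
  fix \<phi> \<phi>' :: "real \<Rightarrow> real" and c d :: real
  assume cd: "a < c" "c < d" "d < b" and deriv: "\<forall>x. (\<phi> has_real_derivative \<phi>' x) (at x)"
    and cont: "continuous_on UNIV \<phi>'" and supp: "\<forall>x. x \<notin> {c..d} \<longrightarrow> \<phi> x = 0"
  have \<phi>': "sq_int \<phi>'" by (intro bdd_sq_int bdd_continuous_UNIV cont)
  have "(LINT x|M. prim g x * \<phi>' x) = (LINT x|M. \<phi>' x * (LINT \<theta>|M. (if \<theta> \<le> x then 1 else 0) * g \<theta>))"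
    by (intro Bochner_Integration.integral_cong) (auto simp: prim_eq)
  also have "\<dots> = (LINT \<theta>|M. (LINT x|M. (if \<theta> \<le> x then 1 else 0) * \<phi>' x) * g \<theta>)"
    by (rule kernel_Fubini[OF bdd2_triangle g \<phi>'])
  also have "\<dots> = (LINT \<theta>|M. - (g \<theta> * \<phi> \<theta>))"
    using deriv supp cd
    by (intro Bochner_Integration.integral_cong) (auto simp: kernel_triangle_deriv[where F = \<phi>] cont)
  finally show "(LINT x|M. prim g x * \<phi>' x) = - (LINT x|M. g x * \<phi> x)" by simp
qed

lemma integrable_weak:
  assumes "sq_int f" "sq_int g" "\<forall>x. (\<phi> has_real_derivative \<phi>' x) (at x)" "continuous_on UNIV \<phi>'"
  shows "integrable M (\<lambda>x. f x * \<phi>' x)" "integrable M (\<lambda>x. g x * \<phi> x)"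
proof -
  have "continuous_on UNIV \<phi>"
    using assms(3) by (meson DERIV_continuous_on has_field_derivative_at_within)
  then show "integrable M (\<lambda>x. f x * \<phi>' x)" "integrable M (\<lambda>x. g x * \<phi> x)"
    using assms by (auto intro!: sq_int_integrable_mult bdd_sq_int bdd_continuous_UNIV)
qed

lemma weak_deriv_diff:
  assumes "weak_deriv f g" "weak_deriv f' g'" "sq_int f" "sq_int g" "sq_int f'" "sq_int g'"
  shows "weak_deriv (\<lambda>x. f x - f' x) (\<lambda>x. g x - g' x)"
  unfolding weak_deriv_def
proof (intro allI impI)
  fix \<phi> \<phi>' :: "real \<Rightarrow> real" and c d :: real
  assume cd: "a < c" "c < d" "d < b" and deriv: "\<forall>x. (\<phi> has_real_derivative \<phi>' x) (at x)"
    and cont: "continuous_on UNIV \<phi>'" and supp: "\<forall>x. x \<notin> {c..d} \<longrightarrow> \<phi> x = 0"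
  note int = integrable_weak[OF assms(3,4) deriv cont] integrable_weak[OF assms(5,6) deriv cont]
  have "(LINT x|M. f x * \<phi>' x) = - (LINT x|M. g x * \<phi> x)" "(LINT x|M. f' x * \<phi>' x) = - (LINT x|M. g' x * \<phi> x)"
    using assms(1,2) cd deriv cont supp unfolding weak_deriv_def by blast+
  then show "(LINT x|M. (f x - f' x) * \<phi>' x) = - (LINT x|M. (g x - g' x) * \<phi> x)"
    using int by (simp add: left_diff_distrib)
qed

text \<open>A test function of mean 0 is the derivative of an admissible \<phi>, which is the
  situation of du Bois-Reymond.\<close>

lemma AE_const_if_weak_deriv_0:
  assumes f: "sq_int f" and w: "weak_deriv f (\<lambda>x. 0)"
  shows "\<exists>C. AE x in M. f x = C"
proof (rule du_Bois_Reymond[OF f])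
  fix \<psi> assume \<psi>: "test_fun \<psi>" "(LINT x|M. \<psi> x) = 0"
  from test_fun_primitive[OF this] obtain \<phi> c d where
    "a < c" "c < d" "d < b" "\<And>x. (\<phi> has_real_derivative \<psi> x) (at x)" "\<And>x. x \<notin> {c..d} \<Longrightarrow> \<phi> x = 0"
    by metis
  moreover have "continuous_on UNIV \<psi>" using \<psi>(1) by (simp add: test_fun_def)
  ultimately have "(LINT x|M. f x * \<psi> x) = - (LINT x|M. 0 * \<phi> x)"
    using w unfolding weak_deriv_def by blast
  then show "(LINT x|M. \<psi> x * f x) = 0" by (simp add: mult.commute)
qed

lemma weak_deriv_imp_prim:
  assumes f: "sq_int f" and g: "sq_int g" and w: "weak_deriv f g"
  shows "\<exists>C. AE x in M. f x = C + prim g x"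
proof -
  have p: "sq_int (prim g)" by (intro bdd_sq_int bdd_prim g)
  have "weak_deriv (\<lambda>x. f x - prim g x) (\<lambda>x. g x - g x)"
    by (intro weak_deriv_diff w weak_deriv_prim f g p)
  then have "\<exists>C. AE x in M. f x - prim g x = C"
    using AE_const_if_weak_deriv_0[OF sq_int_diff[OF f p]] by simp
  then show ?thesis by (auto simp: algebra_simps elim!: eventually_mono)
qed

text \<open>The integral of g over (c, d) is a difference of two values of its primitive.\<close>

lemma AE_eq_0_if_prim_const:
  assumes g: "sq_int g" and p: "\<And>x. x \<in> {a..b} \<Longrightarrow> prim g x = C"
  shows "AE x in M. g x = 0"
proof (rule AE_eq_0_if_integral_interval_eq_0[OF sq_int_integrable[OF g]])
  fix c d assume cd: "a \<le> c" "c < d" "d \<le> b"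
  have int: "integrable M (\<lambda>\<theta>. (if \<theta> \<le> x then 1 else 0) * g \<theta>)" if "x \<in> {a..b}" for x
    using bdd_integrable_mult[OF bdd2_slice[OF bdd2_triangle that] g] .
  have m: "(\<lambda>x. indicator {c<..<d} x * g x) \<in> borel_measurable M"
    using g by (intro borel_measurable_times indicator_measurable_M sq_int_measurable) auto
  have "(LINT x|M. indicator {c<..<d} x * g x)
      = (LINT x|M. (if x \<le> d then 1 else 0) * g x - (if x \<le> c then 1 else 0) * g x)"
  proof (rule integral_cong_AE[OF m])
    show "(\<lambda>x. (if x \<le> d then 1 else 0) * g x - (if x \<le> c then 1 else 0) * g x) \<in> borel_measurable M"
      using int[of c] int[of d] cd by (intro borel_measurable_diff borel_measurable_integrable) auto
    show "AE x in M. indicator {c<..<d} x * g x = (if x \<le> d then 1 else 0) * g x - (if x \<le> c then 1 else 0) * g x"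
      using AE_M_neq[of c] AE_M_neq[of d] by eventually_elim (use cd in \<open>auto simp: indicator_def\<close>)
  qed
  also have "\<dots> = prim g d - prim g c"
    using int[of c] int[of d] cd by (simp add: prim_eq)
  finally show "(LINT x|M. indicator {c<..<d} x * g x) = 0"
    using p[of c] p[of d] cd by simp
qed

text \<open>The difference g - h is a weak derivative of 0, so its primitive is constant almost
  everywhere and, being continuous, everywhere. This makes the choice in \<open>wderiv\<close>
  harmless.\<close>

lemma weak_deriv_unique:
  assumes "weak_deriv f g" "weak_deriv f h" and f: "sq_int f" and g: "sq_int g" and h: "sq_int h"
  shows "AE x in M. g x = h x"
proof -
  have w: "weak_deriv (\<lambda>x. 0) (\<lambda>x. g x - h x)"
    using weak_deriv_diff[OF assms(1,2) f g f h] by simp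
  have gh: "sq_int (\<lambda>x. g x - h x)" using g h by (rule sq_int_diff)
  from weak_deriv_imp_prim[OF sq_int_const gh w] obtain C where
    "AE x in M. 0 = C + prim (\<lambda>x. g x - h x) x" by blast
  then have "0 = C + prim (\<lambda>x. g x - h x) x" if "x \<in> {a..b}" for x
    using gh that by (intro continuous_AE_eq[of "\<lambda>x. 0" "\<lambda>x. C + prim (\<lambda>x. g x - h x) x"] continuous_intros continuous_on_prim) 
  then have "prim (\<lambda>x. g x - h x) x = - C" if "x \<in> {a..b}" for x
    using that by (metis add_eq_0_iff)
  from AE_eq_0_if_prim_const[OF gh this] show ?thesis by (auto elim!: eventually_mono)
qed

lemma weak_deriv_cong_AE:
  assumes w: "weak_deriv f h" and eq: "AE x in M. f x = g x" and f: "sq_int f" and g: "sq_int g"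
  shows "weak_deriv g h"
  unfolding weak_deriv_def
proof (intro allI impI)
  fix \<phi> \<phi>' :: "real \<Rightarrow> real" and c d :: real
  assume cd: "a < c" "c < d" "d < b" and deriv: "\<forall>x. (\<phi> has_real_derivative \<phi>' x) (at x)"
    and cont: "continuous_on UNIV \<phi>'" and supp: "\<forall>x. x \<notin> {c..d} \<longrightarrow> \<phi> x = 0"
  have "(LINT x|M. g x * \<phi>' x) = (LINT x|M. f x * \<phi>' x)"
    using integrable_weak[OF f f deriv cont] integrable_weak[OF g g deriv cont] eq
    by (intro integral_cong_AE borel_measurable_integrable) (auto elim!: eventually_mono)
  also have "\<dots> = - (LINT x|M. h x * \<phi> x)"
    using w cd deriv cont supp unfolding weak_deriv_def by blast
  finally show "(LINT x|M. g x * \<phi>' x) = - (LINT x|M. h x * \<phi> x)" .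
qed

end

section \<open>Integral operators with bounded kernels and their adjoints\<close>

lemma mult_mat_vec_index:
  fixes A :: "real mat"
  assumes "A \<in> carrier_mat m q" "v \<in> carrier_vec q" "i < m"
  shows "(A *\<^sub>v v) $ i = (\<Sum>j<q. A $$ (i, j) * v $ j)"
  using assms by (auto simp: scalar_prod_def atLeast0LessThan)

context compact_interval
begin

section \<open>Membership and inner products in L2 and in R^m x L2\<close>

lemma L2_iff: "f \<in> L2 a b n \<longleftrightarrow> (\<forall>x\<in>{a..b}. f x \<in> carrier_vec n) \<and> (\<forall>i<n. sq_int (\<lambda>x. f x $ i))"
  unfolding L2_def sq_int_def by simp

lemma L2_carrier: "f \<in> L2 a b n \<Longrightarrow> x \<in> {a..b} \<Longrightarrow> f x \<in> carrier_vec n"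
  by (simp add: L2_iff)

lemma L2_dim: "f \<in> L2 a b n \<Longrightarrow> a \<le> x \<Longrightarrow> x \<le> b \<Longrightarrow> dim_vec (f x) = n"
  using L2_carrier[of f n x] by auto

lemma L2_sq_int: "f \<in> L2 a b n \<Longrightarrow> i < n \<Longrightarrow> sq_int (\<lambda>x. f x $ i)"
  by (simp add: L2_iff)

lemma L2_integrable_mult:
  "f \<in> L2 a b n \<Longrightarrow> g \<in> L2 a b n \<Longrightarrow> i < n \<Longrightarrow> integrable M (\<lambda>x. f x $ i * g x $ i)"
  by (rule sq_int_integrable_mult) (simp_all add: L2_sq_int[of _ n])

lemma L2_inner_eq:
  assumes "f \<in> L2 a b n" "g \<in> L2 a b n"
  shows "L2_inner a b f g = (\<Sum>i<n. LINT x|M. f x $ i * g x $ i)"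
proof -
  have "L2_inner a b f g = (LINT x|M. (\<Sum>i<n. f x $ i * g x $ i))"
    unfolding L2_inner_def using L2_dim[OF assms(2)]
    by (intro Bochner_Integration.integral_cong) (auto simp: scalar_prod_def atLeast0LessThan)
  also have "\<dots> = (\<Sum>i<n. LINT x|M. f x $ i * g x $ i)"
    by (rule Bochner_Integration.integral_sum) (simp add: L2_integrable_mult[OF assms])
  finally show ?thesis .
qed

lemma L2_inner_commute: "f \<in> L2 a b n \<Longrightarrow> g \<in> L2 a b n \<Longrightarrow> L2_inner a b f g = L2_inner a b g f"
  by (simp add: L2_inner_eq mult.commute)

lemma L2_inner_cong_AE:
  assumes "f \<in> L2 a b n" "g \<in> L2 a b n" "f' \<in> L2 a b n" "g' \<in> L2 a b n"
    and "L2_eq a b f f'" "L2_eq a b g g'"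
  shows "L2_inner a b f g = L2_inner a b f' g'"
proof -
  have "AE x in M. f x = f' x" "AE x in M. g x = g' x" using assms(5,6) by (simp_all add: L2_eq_def)
  then have "(LINT x|M. f x $ i * g x $ i) = (LINT x|M. f' x $ i * g' x $ i)" if "i < n" for i
    using that assms(1-4)[THEN L2_sq_int, THEN sq_int_measurable]
    by (intro integral_cong_AE borel_measurable_times) auto
  then show ?thesis using assms by (simp add: L2_inner_eq)
qed

lemma L2I:
  assumes "\<And>x. x \<in> {a..b} \<Longrightarrow> f x \<in> carrier_vec n"
    and "\<And>i. i < n \<Longrightarrow> sq_int (g i)"
    and "\<And>i x. i < n \<Longrightarrow> x \<in> {a..b} \<Longrightarrow> f x $ i = g i x"
  shows "f \<in> L2 a b n"
  unfolding L2_iff by (intro conjI ballI allI impI assms(1) sq_int_cong[OF assms(2)]) (simp_all add: assms(3))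

lemma L2_add:
  assumes "f \<in> L2 a b n" "g \<in> L2 a b n"
  shows "(\<lambda>x. f x + g x) \<in> L2 a b n"
proof (rule L2I)
  fix i assume "i < n"
  then show "sq_int (\<lambda>x. f x $ i + g x $ i)"
    by (intro sq_int_add assms[THEN L2_sq_int])
qed (simp_all add: assms[THEN L2_carrier] assms[THEN L2_dim])

lemma L2_smult:
  assumes "f \<in> L2 a b n"
  shows "(\<lambda>x. c \<cdot>\<^sub>v f x) \<in> L2 a b n"
proof (rule L2I)
  fix i assume "i < n"
  then show "sq_int (\<lambda>x. c * f x $ i)"
    by (intro sq_int_cmult assms[THEN L2_sq_int])
qed (simp_all add: assms[THEN L2_carrier] assms[THEN L2_dim])

lemma L2_diff:
  assumes "f \<in> L2 a b n" "g \<in> L2 a b n"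
  shows "(\<lambda>x. f x - g x) \<in> L2 a b n"
proof (rule L2I)
  fix i assume "i < n"
  then show "sq_int (\<lambda>x. f x $ i - g x $ i)"
    by (intro sq_int_diff assms[THEN L2_sq_int])
qed (simp_all add: assms[THEN L2_carrier] assms[THEN L2_dim])

lemma L2_inner_add_right:
  assumes "f \<in> L2 a b n" "g \<in> L2 a b n" "h \<in> L2 a b n"
  shows "L2_inner a b f (\<lambda>x. g x + h x) = L2_inner a b f g + L2_inner a b f h"
proof -
  have "(LINT x|M. f x $ i * (g x + h x) $ i) = (LINT x|M. f x $ i * g x $ i) + (LINT x|M. f x $ i * h x $ i)"
    if "i < n" for i
  proof -
    have "(LINT x|M. f x $ i * (g x + h x) $ i) = (LINT x|M. f x $ i * g x $ i + f x $ i * h x $ i)"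
      using that by (intro Bochner_Integration.integral_cong)
        (auto simp: algebra_simps assms[THEN L2_dim])
    also have "\<dots> = (LINT x|M. f x $ i * g x $ i) + (LINT x|M. f x $ i * h x $ i)"
      by (intro Bochner_Integration.integral_add L2_integrable_mult[OF assms(1,2)] L2_integrable_mult[OF assms(1,3)] that)
    finally show ?thesis .
  qed
  then show ?thesis using assms L2_add[OF assms(2,3)] by (simp add: L2_inner_eq sum.distrib)
qed

lemma L2_inner_smult_right:
  assumes "f \<in> L2 a b n" "g \<in> L2 a b n"
  shows "L2_inner a b f (\<lambda>x. c \<cdot>\<^sub>v g x) = c * L2_inner a b f g"
proof -
  have "(LINT x|M. f x $ i * (c \<cdot>\<^sub>v g x) $ i) = c * (LINT x|M. f x $ i * g x $ i)" if "i < n" for i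
  proof -
    have "(LINT x|M. f x $ i * (c \<cdot>\<^sub>v g x) $ i) = (LINT x|M. c * (f x $ i * g x $ i))"
      using that by (intro Bochner_Integration.integral_cong)
        (auto simp: algebra_simps assms[THEN L2_dim])
    then show ?thesis by simp
  qed
  then show ?thesis using assms L2_smult[OF assms(2)] by (simp add: L2_inner_eq sum_distrib_left)
qed

lemma L2_inner_cong:
  assumes "\<And>x. x \<in> {a..b} \<Longrightarrow> f x = f' x" "\<And>x. x \<in> {a..b} \<Longrightarrow> g x = g' x"
  shows "L2_inner a b f g = L2_inner a b f' g'"
  unfolding L2_inner_def using assms by (intro Bochner_Integration.integral_cong) auto

lemma L2_inner_diff_right:
  assumes "f \<in> L2 a b n" "g \<in> L2 a b n" "h \<in> L2 a b n"
  shows "L2_inner a b f (\<lambda>x. g x - h x) = L2_inner a b f g - L2_inner a b f h"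
proof -
  have "L2_inner a b f (\<lambda>x. g x - h x) = L2_inner a b f (\<lambda>x. g x + (-1) \<cdot>\<^sub>v h x)"
    by (intro L2_inner_cong) (auto intro!: eq_vecI simp: assms[THEN L2_dim])
  also have "\<dots> = L2_inner a b f g + L2_inner a b f (\<lambda>x. (-1) \<cdot>\<^sub>v h x)"
    using assms by (intro L2_inner_add_right L2_smult)
  also have "\<dots> = L2_inner a b f g - L2_inner a b f h"
    using assms by (simp add: L2_inner_smult_right)
  finally show ?thesis .
qed

lemma Z_iff: "v \<in> Z a b (m, n) \<longleftrightarrow> fst v \<in> carrier_vec m \<and> snd v \<in> L2 a b n"
  by (auto simp: Z_def mem_Times_iff)

lemma Z_inner_commute: "v \<in> Z a b d \<Longrightarrow> w \<in> Z a b d \<Longrightarrow> Z_inner a b v w = Z_inner a b w v"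
  unfolding Z_inner_def Z_def
  using comm_scalar_prod[of "fst v" "fst d" "fst w"] L2_inner_commute[of "snd v" "snd d" "snd w"]
  by (auto simp: mem_Times_iff)

lemma Z_inner_cong:
  assumes "v \<in> Z a b d" "v' \<in> Z a b d" "w \<in> Z a b d" "w' \<in> Z a b d" "Z_eq a b v v'" "Z_eq a b w w'"
  shows "Z_inner a b v w = Z_inner a b v' w'"
  using assms L2_inner_cong_AE[of "snd v" "snd d" "snd w" "snd v'" "snd w'"]
  by (auto simp: Z_inner_def Z_def Z_eq_def mem_Times_iff)

lemma Z_eq_refl [simp]: "Z_eq a b v v"
  by (simp add: Z_eq_def L2_eq_def)

lemma Z_eq_sym: "Z_eq a b v w \<Longrightarrow> Z_eq a b w v"
  by (auto simp: Z_eq_def L2_eq_def elim!: eventually_mono)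

lemma Z_eq_trans:
  assumes "Z_eq a b u v" "Z_eq a b v w"
  shows "Z_eq a b u w"
proof -
  have "AE x in M. snd u x = snd v x" "AE x in M. snd v x = snd w x"
    using assms by (simp_all add: Z_eq_def L2_eq_def)
  then have "AE x in M. snd u x = snd w x" by eventually_elim simp
  then show ?thesis using assms by (simp add: Z_eq_def L2_eq_def)
qed

lemma Z_eqI:
  assumes "fst v = fst w" "\<And>x. x \<in> {a..b} \<Longrightarrow> snd v x = snd w x"
  shows "Z_eq a b v w"
  using assms by (auto simp: Z_eq_def L2_eq_def intro!: AE_I2)

lemma Z_op_add: "B v \<in> Z a b d \<Longrightarrow> C v \<in> Z a b d \<Longrightarrow> (B \<oplus>\<^sub>o C) v \<in> Z a b d"
  by (auto simp: Z_def op_add_def mem_Times_iff L2_add)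

lemma Z_op_sub: "B v \<in> Z a b d \<Longrightarrow> C v \<in> Z a b d \<Longrightarrow> (B \<ominus>\<^sub>o C) v \<in> Z a b d"
  by (auto simp: Z_def op_sub_def mem_Times_iff L2_diff)

lemma Z_op_scale: "B v \<in> Z a b d \<Longrightarrow> (c \<odot>\<^sub>o B) v \<in> Z a b d"
  by (auto simp: Z_def op_scale_def mem_Times_iff L2_smult)

lemma Z_inner_op_add:
  assumes "w \<in> Z a b d" "B v \<in> Z a b d" "C v \<in> Z a b d"
  shows "Z_inner a b w ((B \<oplus>\<^sub>o C) v) = Z_inner a b w (B v) + Z_inner a b w (C v)"
  using assms scalar_prod_add_distrib[of "fst w" "fst d" "fst (B v)" "fst (C v)"]
    L2_inner_add_right[of "snd w" "snd d" "snd (B v)" "snd (C v)"]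
  by (auto simp: Z_inner_def Z_def op_add_def mem_Times_iff)

lemma Z_inner_op_sub:
  assumes "w \<in> Z a b d" "B v \<in> Z a b d" "C v \<in> Z a b d"
  shows "Z_inner a b w ((B \<ominus>\<^sub>o C) v) = Z_inner a b w (B v) - Z_inner a b w (C v)"
  using assms scalar_prod_minus_distrib[of "fst w" "fst d" "fst (B v)" "fst (C v)"]
    L2_inner_diff_right[of "snd w" "snd d" "snd (B v)" "snd (C v)"]
  by (auto simp: Z_inner_def Z_def op_sub_def mem_Times_iff)

lemma Z_inner_op_scale:
  assumes "w \<in> Z a b d" "B v \<in> Z a b d"
  shows "Z_inner a b w ((c \<odot>\<^sub>o B) v) = c * Z_inner a b w (B v)"
  using assms scalar_prod_smult_distrib[of "fst w" "fst d" "fst (B v)" c]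
    L2_inner_smult_right[of "snd w" "snd d" "snd (B v)" c]
  by (auto simp: Z_inner_def Z_def op_scale_def mem_Times_iff distrib_left)

text \<open>Unlike the polynomial kernels, this class of kernels contains those of all the operators of the
  theorem and of their adjoints: a Volterra part is a kernel on the whole square that vanishes for
  \<open>\<theta> > x\<close>.\<close>

definition gen_op where
  "gen_op m n p q P Q1 Q2 R0 R v =
     (vec m (\<lambda>i. (\<Sum>j<p. P i j * fst v $ j) + (\<Sum>j<q. LINT x|M. Q1 i j x * snd v x $ j)),
      \<lambda>x. vec n (\<lambda>i. (\<Sum>j<p. Q2 i j x * fst v $ j)
        + (\<Sum>j<q. R0 i j x * snd v x $ j + (LINT \<theta>|M. R i j x \<theta> * snd v \<theta> $ j))))"

text \<open>The coefficients are families of scalar functions indexed by i and j rather than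
  matrices: transposition is an exchange of indices, and the scalar estimates apply entry by
  entry.\<close>

definition gen_ok where
  "gen_ok m n p q Q1 Q2 R0 R \<longleftrightarrow> (\<forall>i<m. \<forall>j<q. bdd (Q1 i j)) \<and> (\<forall>i<n. \<forall>j<p. bdd (Q2 i j)) \<and>
     (\<forall>i<n. \<forall>j<q. bdd (R0 i j) \<and> bdd2 (R i j))" for m n p q :: nat

lemma gen_op_Z:
  assumes ok: "gen_ok m n p q Q1 Q2 R0 R" and v: "v \<in> Z a b (p, q)"
  shows "gen_op m n p q P Q1 Q2 R0 R v \<in> Z a b (m, n)"
proof -
  have "sq_int (\<lambda>x. (\<Sum>j<p. Q2 i j x * fst v $ j)
        + (\<Sum>j<q. R0 i j x * snd v x $ j + (LINT \<theta>|M. R i j x \<theta> * snd v \<theta> $ j)))" if i: "i < n" for i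
  proof (intro sq_int_add sq_int_sum)
    fix j assume j: "j \<in> {..<q}"
    have vj: "sq_int (\<lambda>x. snd v x $ j)" using v j L2_sq_int[of "snd v" q j] by (simp add: Z_iff)
    have bd: "bdd (R0 i j)" "bdd2 (R i j)" using ok i j by (simp_all add: gen_ok_def)
    show "sq_int (\<lambda>x. R0 i j x * snd v x $ j)" by (rule sq_int_bdd_mult[OF bd(1) vj])
    show "sq_int (\<lambda>x. LINT \<theta>|M. R i j x \<theta> * snd v \<theta> $ j)" by (rule bdd_sq_int[OF bdd_kernel[OF bd(2) vj]])
  next
    fix j assume j: "j \<in> {..<p}"
    then show "sq_int (\<lambda>x. Q2 i j x * fst v $ j)"
      using ok i by (intro sq_int_bdd_mult sq_int_const) (simp add: gen_ok_def)
  qed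
  then have "(\<lambda>x. vec n (\<lambda>i. (\<Sum>j<p. Q2 i j x * fst v $ j)
        + (\<Sum>j<q. R0 i j x * snd v x $ j + (LINT \<theta>|M. R i j x \<theta> * snd v \<theta> $ j)))) \<in> L2 a b n"
    by (rule L2I[rotated]) (simp_all only: index_vec vec_carrier)
  then show ?thesis
    unfolding Z_iff gen_op_def fst_conv snd_conv by (intro conjI vec_carrier)
qed

text \<open>The inner product of the image of v with w, sorted by coefficient. In this form the
  exchange of v and w, together with the transposition of the coefficients, only reorders the first
  four sums.\<close>

definition gen_form where
  "gen_form m n p q P Q1 Q2 R0 R v w =
     (\<Sum>i<m. \<Sum>j<p. P i j * (fst w $ i * fst v $ j))
   + (\<Sum>i<m. \<Sum>j<q. fst w $ i * (LINT x|M. Q1 i j x * snd v x $ j))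
   + (\<Sum>i<n. \<Sum>j<p. fst v $ j * (LINT x|M. Q2 i j x * snd w x $ i))
   + (\<Sum>i<n. \<Sum>j<q. LINT x|M. R0 i j x * (snd w x $ i * snd v x $ j))
   + (\<Sum>i<n. \<Sum>j<q. LINT x|M. snd w x $ i * (LINT \<theta>|M. R i j x \<theta> * snd v \<theta> $ j))"

lemma Z_inner_gen_op:
  assumes ok: "gen_ok m n p q Q1 Q2 R0 R" and v: "v \<in> Z a b (p, q)" and w: "w \<in> Z a b (m, n)"
  shows "Z_inner a b (gen_op m n p q P Q1 Q2 R0 R v) w = gen_form m n p q P Q1 Q2 R0 R v w"
proof -
  let ?B = "gen_op m n p q P Q1 Q2 R0 R"
  obtain v0 v1 where v_eq: "v = (v0, v1)" by fastforce
  obtain w0 w1 where w_eq: "w = (w0, w1)" by fastforce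
  have v0: "v0 \<in> carrier_vec p" and v1: "v1 \<in> L2 a b q" and w0: "w0 \<in> carrier_vec m" and w1: "w1 \<in> L2 a b n"
    using v w by (auto simp: Z_iff v_eq w_eq)
  have Q2: "bdd (Q2 i j)" if "i < n" "j < p" for i j using ok that by (auto simp: gen_ok_def)
  have R0: "bdd (R0 i j)" if "i < n" "j < q" for i j using ok that by (auto simp: gen_ok_def)
  have R: "bdd2 (R i j)" if "i < n" "j < q" for i j using ok that by (auto simp: gen_ok_def)
  have B: "?B v \<in> Z a b (m, n)" by (rule gen_op_Z[OF ok v])
  have int1: "integrable M (\<lambda>x. v0 $ j * (Q2 i j x * w1 x $ i))" if "i < n" "j < p" for i j
    using bdd_integrable_mult[OF Q2[OF that] L2_sq_int[OF w1 that(1)]] by simp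
  have int2: "integrable M (\<lambda>x. R0 i j x * (w1 x $ i * v1 x $ j))" if "i < n" "j < q" for i j
    using sq_int_integrable_mult[OF sq_int_bdd_mult[OF R0[OF that] L2_sq_int[OF w1 that(1)]] L2_sq_int[OF v1 that(2)]]
    by (simp add: mult.assoc)
  have int3: "integrable M (\<lambda>x. w1 x $ i * (LINT \<theta>|M. R i j x \<theta> * v1 \<theta> $ j))" if "i < n" "j < q" for i j
    by (intro sq_int_integrable_mult L2_sq_int[OF w1 that(1)] bdd_sq_int bdd_kernel R that L2_sq_int[OF v1 that(2)])
  have fst_part: "fst (?B v) \<bullet> w0 = (\<Sum>i<m. \<Sum>j<p. P i j * (w0 $ i * v0 $ j))
      + (\<Sum>i<m. \<Sum>j<q. w0 $ i * (LINT x|M. Q1 i j x * v1 x $ j))"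
    using w0 by (simp add: scalar_prod_def gen_op_def v_eq atLeast0LessThan distrib_left sum_distrib_left
        sum.distrib mult_ac)
  have comp: "(LINT x|M. snd (?B v) x $ i * w1 x $ i)
      = (\<Sum>j<p. v0 $ j * (LINT x|M. Q2 i j x * w1 x $ i))
      + (\<Sum>j<q. LINT x|M. R0 i j x * (w1 x $ i * v1 x $ j))
      + (\<Sum>j<q. LINT x|M. w1 x $ i * (LINT \<theta>|M. R i j x \<theta> * v1 \<theta> $ j))" if i: "i < n" for i
  proof -
    define k where "k j x = (LINT \<theta>|M. R i j x \<theta> * v1 \<theta> $ j)" for j x
    have k: "integrable M (\<lambda>x. w1 x $ i * k j x)" if "j < q" for j
      unfolding k_def by (rule int3[OF i that])
    have "snd (?B v) x $ i * w1 x $ i = (\<Sum>j<p. v0 $ j * (Q2 i j x * w1 x $ i))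
      + (\<Sum>j<q. R0 i j x * (w1 x $ i * v1 x $ j)) + (\<Sum>j<q. w1 x $ i * k j x)" for x
    proof -
      have "snd (?B v) x $ i = (\<Sum>j<p. Q2 i j x * v0 $ j) + (\<Sum>j<q. R0 i j x * v1 x $ j + k j x)"
        using i by (simp add: gen_op_def v_eq k_def)
      then show ?thesis
        by (simp add: distrib_left sum_distrib_left sum.distrib mult_ac)
    qed
    then have "(LINT x|M. snd (?B v) x $ i * w1 x $ i) = (LINT x|M. (\<Sum>j<p. v0 $ j * (Q2 i j x * w1 x $ i))
      + (\<Sum>j<q. R0 i j x * (w1 x $ i * v1 x $ j)) + (\<Sum>j<q. w1 x $ i * k j x))"
      by (simp only:)
    also have "\<dots> = (LINT x|M. (\<Sum>j<p. v0 $ j * (Q2 i j x * w1 x $ i))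
      + (\<Sum>j<q. R0 i j x * (w1 x $ i * v1 x $ j))) + (LINT x|M. (\<Sum>j<q. w1 x $ i * k j x))"
      by (intro Bochner_Integration.integral_add Bochner_Integration.integrable_add
          Bochner_Integration.integrable_sum int1 int2 k i) (simp_all only: lessThan_iff)
    also have "(LINT x|M. (\<Sum>j<p. v0 $ j * (Q2 i j x * w1 x $ i)) + (\<Sum>j<q. R0 i j x * (w1 x $ i * v1 x $ j)))
      = (LINT x|M. (\<Sum>j<p. v0 $ j * (Q2 i j x * w1 x $ i))) + (LINT x|M. (\<Sum>j<q. R0 i j x * (w1 x $ i * v1 x $ j)))"
      by (intro Bochner_Integration.integral_add Bochner_Integration.integrable_sum int1 int2 i) (simp_all only: lessThan_iff)
    also have "(LINT x|M. (\<Sum>j<p. v0 $ j * (Q2 i j x * w1 x $ i))) = (\<Sum>j<p. LINT x|M. v0 $ j * (Q2 i j x * w1 x $ i))"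
      by (intro Bochner_Integration.integral_sum int1 i) (simp_all only: lessThan_iff)
    also have "\<dots> = (\<Sum>j<p. v0 $ j * (LINT x|M. Q2 i j x * w1 x $ i))"
      by (simp only: integral_mult_right_zero)
    also have "(LINT x|M. (\<Sum>j<q. R0 i j x * (w1 x $ i * v1 x $ j))) = (\<Sum>j<q. LINT x|M. R0 i j x * (w1 x $ i * v1 x $ j))"
      by (intro Bochner_Integration.integral_sum int2 i) (simp_all only: lessThan_iff)
    also have "(LINT x|M. (\<Sum>j<q. w1 x $ i * k j x)) = (\<Sum>j<q. LINT x|M. w1 x $ i * k j x)"
      by (intro Bochner_Integration.integral_sum k) (simp_all only: lessThan_iff)
    finally show ?thesis unfolding k_def .
  qed
  have "L2_inner a b (snd (?B v)) w1 = (\<Sum>i<n. LINT x|M. snd (?B v) x $ i * w1 x $ i)"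
    using B w1 by (intro L2_inner_eq) (simp_all add: Z_iff)
  also have "\<dots> = (\<Sum>i<n. \<Sum>j<p. v0 $ j * (LINT x|M. Q2 i j x * w1 x $ i))
      + (\<Sum>i<n. \<Sum>j<q. LINT x|M. R0 i j x * (w1 x $ i * v1 x $ j))
      + (\<Sum>i<n. \<Sum>j<q. LINT x|M. w1 x $ i * (LINT \<theta>|M. R i j x \<theta> * v1 \<theta> $ j))"
    unfolding sum.distrib[symmetric] by (rule sum.cong[OF refl], rule comp, simp only: lessThan_iff)
  finally have snd_part: "L2_inner a b (snd (?B v)) w1 = \<dots>" .
  have "fst v = v0" "snd v = v1" "fst w = w0" "snd w = w1" by (simp_all add: v_eq w_eq)
  then show ?thesis by (simp only: Z_inner_def gen_form_def fst_part snd_part add.assoc)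
qed

section \<open>Transposed kernels and adjoints\<close>

abbreviation transp where "transp Q \<equiv> (\<lambda>i j. Q j i)"

lemma gen_ok_transp:
  assumes "gen_ok m n p q Q1 Q2 R0 R"
  shows "gen_ok p q m n (transp Q2) (transp Q1) (transp R0) (\<lambda>i j x \<theta>. R j i \<theta> x)"
proof -
  have "bdd2 (\<lambda>x \<theta>. R j i \<theta> x)" if "i < q" "j < n" for i j
    using assms that by (auto simp: gen_ok_def intro: bdd2_swap[of "R j i"])
  then show ?thesis using assms by (simp add: gen_ok_def)
qed

text \<open>Both sides are values of \<open>gen_form\<close>. The kernel sum is the one that needs
  more than reordering: by Fubini the kernel passes to the other argument with x and \<theta>
  exchanged.\<close>

lemma gen_op_adjoint:
  assumes ok: "gen_ok m n p q Q1 Q2 R0 R" and v: "v \<in> Z a b (p, q)" and w: "w \<in> Z a b (m, n)"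
  shows "Z_inner a b (gen_op m n p q P Q1 Q2 R0 R v) w =
    Z_inner a b v (gen_op p q m n (transp P) (transp Q2) (transp Q1) (transp R0) (\<lambda>i j x \<theta>. R j i \<theta> x) w)"
proof -
  let ?B' = "gen_op p q m n (transp P) (transp Q2) (transp Q1) (transp R0) (\<lambda>i j x \<theta>. R j i \<theta> x)"
  note ok' = gen_ok_transp[OF ok]
  have Fub: "(LINT x|M. snd w x $ i * (LINT \<theta>|M. R i j x \<theta> * snd v \<theta> $ j))
      = (LINT x|M. snd v x $ j * (LINT \<theta>|M. R i j \<theta> x * snd w \<theta> $ i))" if "i < n" "j < q" for i j
  proof -
    have "bdd2 (R i j)" "sq_int (\<lambda>x. snd v x $ j)" "sq_int (\<lambda>x. snd w x $ i)"
      using ok v w that L2_sq_int[of "snd v" q j] L2_sq_int[of "snd w" n i] by (simp_all add: gen_ok_def Z_iff)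
    note kernel_Fubini[OF this]
    also have "(LINT \<theta>|M. (LINT x|M. R i j x \<theta> * snd w x $ i) * snd v \<theta> $ j)
        = (LINT x|M. snd v x $ j * (LINT \<theta>|M. R i j \<theta> x * snd w \<theta> $ i))"
      by (intro Bochner_Integration.integral_cong refl mult.commute)
    finally show ?thesis .
  qed
  have comm0: "fst v $ i * fst w $ j = fst w $ j * fst v $ i" for i j by (rule mult.commute)
  have comm1: "snd v x $ i * snd w x $ j = snd w x $ j * snd v x $ i" for i j x by (rule mult.commute)
  have "(\<Sum>i<p. \<Sum>j<m. P j i * (fst v $ i * fst w $ j)) = (\<Sum>i<m. \<Sum>j<p. P i j * (fst w $ i * fst v $ j))"
    by (subst sum.swap) (simp only: comm0)
  moreover have "(\<Sum>i<p. \<Sum>j<n. fst v $ i * (LINT x|M. Q2 j i x * snd w x $ j))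
      = (\<Sum>i<n. \<Sum>j<p. fst v $ j * (LINT x|M. Q2 i j x * snd w x $ i))"
    by (rule sum.swap)
  moreover have "(\<Sum>i<q. \<Sum>j<m. fst w $ j * (LINT x|M. Q1 j i x * snd v x $ i))
      = (\<Sum>i<m. \<Sum>j<q. fst w $ i * (LINT x|M. Q1 i j x * snd v x $ j))"
    by (rule sum.swap)
  moreover have "(\<Sum>i<q. \<Sum>j<n. LINT x|M. R0 j i x * (snd v x $ i * snd w x $ j))
      = (\<Sum>i<n. \<Sum>j<q. LINT x|M. R0 i j x * (snd w x $ i * snd v x $ j))"
    by (subst sum.swap) (simp only: comm1)
  moreover have "(\<Sum>i<q. \<Sum>j<n. LINT x|M. snd v x $ i * (LINT \<theta>|M. R j i \<theta> x * snd w \<theta> $ j))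
      = (\<Sum>i<n. \<Sum>j<q. LINT x|M. snd w x $ i * (LINT \<theta>|M. R i j x \<theta> * snd v \<theta> $ j))"
    by (subst sum.swap) (rule sum.cong[OF refl], rule sum.cong[OF refl], rule Fub[symmetric], simp_all only: lessThan_iff)
  ultimately have "gen_form m n p q P Q1 Q2 R0 R v w
      = gen_form p q m n (transp P) (transp Q2) (transp Q1) (transp R0) (\<lambda>i j x \<theta>. R j i \<theta> x) w v"
    unfolding gen_form_def by (simp only: add_ac)
  also have "\<dots> = Z_inner a b (?B' w) v"
    by (rule Z_inner_gen_op[OF ok' w v, symmetric])
  also have "\<dots> = Z_inner a b v (?B' w)"
    by (rule Z_inner_commute[OF gen_op_Z[OF ok' w] v])
  finally show ?thesis using Z_inner_gen_op[OF ok v w] by (rule trans[rotated])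
qed

text \<open>The choice made by \<open>adj\<close> can be evaluated only if an adjoint exists. This
  predicate records existence together with the mapping property; it is preserved by sums,
  differences, compositions and changes on null sets, so it can be derived along the construction of
  an operator.\<close>

definition has_adj where
  "has_adj d e B \<longleftrightarrow> (\<forall>v\<in>Z a b d. B v \<in> Z a b e) \<and> (\<exists>B'. (\<forall>w\<in>Z a b e. B' w \<in> Z a b d) \<and>
     (\<forall>v\<in>Z a b d. \<forall>w\<in>Z a b e. Z_inner a b (B v) w = Z_inner a b v (B' w)))"

lemma has_adjE:
  assumes "has_adj d e B"
  obtains B' where "\<forall>v\<in>Z a b d. B v \<in> Z a b e" "\<forall>w\<in>Z a b e. B' w \<in> Z a b d"
    "\<forall>v\<in>Z a b d. \<forall>w\<in>Z a b e. Z_inner a b (B v) w = Z_inner a b v (B' w)"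
  using assms unfolding has_adj_def by (elim conjE exE) (rule that)

lemma has_adjI:
  assumes "\<forall>v\<in>Z a b d. B v \<in> Z a b e" "\<forall>w\<in>Z a b e. B' w \<in> Z a b d"
    "\<forall>v\<in>Z a b d. \<forall>w\<in>Z a b e. Z_inner a b (B v) w = Z_inner a b v (B' w)"
  shows "has_adj d e B"
  unfolding has_adj_def by (intro conjI exI[of _ B'] assms)

lemma has_adj_Z: "has_adj d e B \<Longrightarrow> v \<in> Z a b d \<Longrightarrow> B v \<in> Z a b e"
  by (simp add: has_adj_def)

lemma adj_works:
  assumes "has_adj d e B"
  shows "(\<forall>w\<in>Z a b e. adj a b d e B w \<in> Z a b d) \<and>
     (\<forall>v\<in>Z a b d. \<forall>w\<in>Z a b e. Z_inner a b (B v) w = Z_inner a b v (adj a b d e B w))"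
proof -
  have "\<exists>B'. (\<forall>w\<in>Z a b e. B' w \<in> Z a b d) \<and>
     (\<forall>v\<in>Z a b d. \<forall>w\<in>Z a b e. Z_inner a b (B v) w = Z_inner a b v (B' w))"
    using assms by (simp add: has_adj_def)
  from someI_ex[OF this] show ?thesis unfolding adj_def .
qed

lemma adj_Z: "has_adj d e B \<Longrightarrow> w \<in> Z a b e \<Longrightarrow> adj a b d e B w \<in> Z a b d"
  using adj_works[of d e B] by simp

lemma Z_inner_adj:
  "has_adj d e B \<Longrightarrow> v \<in> Z a b d \<Longrightarrow> w \<in> Z a b e \<Longrightarrow>
    Z_inner a b v (adj a b d e B w) = Z_inner a b (B v) w"
  using adj_works[of d e B] by simp

lemma has_adj_gen_op:
  assumes ok: "gen_ok m n p q Q1 Q2 R0 R"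
  shows "has_adj (p, q) (m, n) (gen_op m n p q P Q1 Q2 R0 R)"
  by (rule has_adjI[where B' = "gen_op p q m n (transp P) (transp Q2) (transp Q1) (transp R0) (\<lambda>i j x \<theta>. R j i \<theta> x)"];
      intro ballI gen_op_Z[OF ok] gen_op_Z[OF gen_ok_transp[OF ok]] gen_op_adjoint[OF ok])

lemma has_adj_comp:
  assumes B: "has_adj d e B" and C: "has_adj e f C"
  shows "has_adj d f (C \<circ> B)"
proof -
  obtain B' where B': "\<forall>v\<in>Z a b d. B v \<in> Z a b e" "\<forall>w\<in>Z a b e. B' w \<in> Z a b d"
    "\<forall>v\<in>Z a b d. \<forall>w\<in>Z a b e. Z_inner a b (B v) w = Z_inner a b v (B' w)"
    by (rule has_adjE[OF B])
  obtain C' where C': "\<forall>v\<in>Z a b e. C v \<in> Z a b f" "\<forall>w\<in>Z a b f. C' w \<in> Z a b e"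
    "\<forall>v\<in>Z a b e. \<forall>w\<in>Z a b f. Z_inner a b (C v) w = Z_inner a b v (C' w)"
    by (rule has_adjE[OF C])
  show ?thesis by (rule has_adjI[of _ _ _ "B' \<circ> C'"]) (use B' C' in \<open>simp_all add: o_def\<close>)
qed

lemma Z_inner_op_add_left:
  "w \<in> Z a b d \<Longrightarrow> B v \<in> Z a b d \<Longrightarrow> C v \<in> Z a b d \<Longrightarrow>
    Z_inner a b ((B \<oplus>\<^sub>o C) v) w = Z_inner a b (B v) w + Z_inner a b (C v) w"
  using Z_inner_op_add[of w d B v C] Z_op_add[of B v d C] Z_inner_commute by metis

lemma Z_inner_op_sub_left:
  "w \<in> Z a b d \<Longrightarrow> B v \<in> Z a b d \<Longrightarrow> C v \<in> Z a b d \<Longrightarrow>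
    Z_inner a b ((B \<ominus>\<^sub>o C) v) w = Z_inner a b (B v) w - Z_inner a b (C v) w"
  using Z_inner_op_sub[of w d B v C] Z_op_sub[of B v d C] Z_inner_commute by metis

lemma has_adj_add:
  assumes B: "has_adj d e B" and C: "has_adj d e C"
  shows "has_adj d e (B \<oplus>\<^sub>o C)"
proof -
  obtain B' where B': "\<forall>v\<in>Z a b d. B v \<in> Z a b e" "\<forall>w\<in>Z a b e. B' w \<in> Z a b d"
    "\<forall>v\<in>Z a b d. \<forall>w\<in>Z a b e. Z_inner a b (B v) w = Z_inner a b v (B' w)"
    by (rule has_adjE[OF B])
  obtain C' where C': "\<forall>v\<in>Z a b d. C v \<in> Z a b e" "\<forall>w\<in>Z a b e. C' w \<in> Z a b d"
    "\<forall>v\<in>Z a b d. \<forall>w\<in>Z a b e. Z_inner a b (C v) w = Z_inner a b v (C' w)"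
    by (rule has_adjE[OF C])
  show ?thesis
    by (rule has_adjI[of _ _ _ "B' \<oplus>\<^sub>o C'"])
      (use B' C' in \<open>simp_all add: Z_op_add Z_inner_op_add[where d = d] Z_inner_op_add_left[where d = e]\<close>)
qed

lemma has_adj_sub:
  assumes B: "has_adj d e B" and C: "has_adj d e C"
  shows "has_adj d e (B \<ominus>\<^sub>o C)"
proof -
  obtain B' where B': "\<forall>v\<in>Z a b d. B v \<in> Z a b e" "\<forall>w\<in>Z a b e. B' w \<in> Z a b d"
    "\<forall>v\<in>Z a b d. \<forall>w\<in>Z a b e. Z_inner a b (B v) w = Z_inner a b v (B' w)"
    by (rule has_adjE[OF B])
  obtain C' where C': "\<forall>v\<in>Z a b d. C v \<in> Z a b e" "\<forall>w\<in>Z a b e. C' w \<in> Z a b d"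
    "\<forall>v\<in>Z a b d. \<forall>w\<in>Z a b e. Z_inner a b (C v) w = Z_inner a b v (C' w)"
    by (rule has_adjE[OF C])
  show ?thesis
    by (rule has_adjI[of _ _ _ "B' \<ominus>\<^sub>o C'"])
      (use B' C' in \<open>simp_all add: Z_op_sub Z_inner_op_sub[where d = d] Z_inner_op_sub_left[where d = e]\<close>)
qed

lemma has_adj_id: "has_adj d d id"
  by (rule has_adjI[of _ _ _ id]) simp_all

text \<open>Inner products do not see null sets, so an adjoint of C serves B. A 4-PI operator is
  given by its formula only up to null sets, hence this form.\<close>

lemma has_adj_cong:
  assumes C: "has_adj d e C" and B: "\<And>v. v \<in> Z a b d \<Longrightarrow> B v \<in> Z a b e"
    and eq: "\<And>v. v \<in> Z a b d \<Longrightarrow> Z_eq a b (B v) (C v)"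
  shows "has_adj d e B"
proof -
  obtain C' where C': "\<forall>v\<in>Z a b d. C v \<in> Z a b e" "\<forall>w\<in>Z a b e. C' w \<in> Z a b d"
    "\<forall>v\<in>Z a b d. \<forall>w\<in>Z a b e. Z_inner a b (C v) w = Z_inner a b v (C' w)"
    by (rule has_adjE[OF C])
  have "Z_inner a b (B v) w = Z_inner a b (C v) w" if "v \<in> Z a b d" "w \<in> Z a b e" for v w
    using that C'(1) B[OF that(1)] eq[OF that(1)] by (intro Z_inner_cong[where d = e]) simp_all
  then show ?thesis
    by (intro has_adjI[of _ _ _ C']) (use B C' in simp_all)
qed

lemma Z_cong:
  assumes "v \<in> Z a b (m, n)" "fst w = fst v" "\<And>x. x \<in> {a..b} \<Longrightarrow> snd w x = snd v x"
  shows "w \<in> Z a b (m, n)"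
proof -
  have "snd w \<in> L2 a b n"
    using assms(1,3) by (intro L2I[of "snd w" n "\<lambda>i x. snd v x $ i"]) (simp_all add: Z_iff L2_iff)
  then show ?thesis using assms by (simp add: Z_iff)
qed

text \<open>The weight c is 1 for an integral over [a, b] and the indicator of the triangle for a
  Volterra integral.\<close>

lemma integral_mult_mat_vec:
  assumes K: "\<And>\<theta>. \<theta> \<in> {a..b} \<Longrightarrow> K \<theta> \<in> carrier_mat n q"
    and bd: "\<And>j. j < q \<Longrightarrow> bdd (\<lambda>\<theta>. c \<theta> * K \<theta> $$ (i, j))"
    and v: "v \<in> L2 a b q" and i: "i < n"
  shows "(LINT \<theta>|M. c \<theta> * (K \<theta> *\<^sub>v v \<theta>) $ i) = (\<Sum>j<q. LINT \<theta>|M. c \<theta> * K \<theta> $$ (i, j) * v \<theta> $ j)"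
proof -
  have "(LINT \<theta>|M. c \<theta> * (K \<theta> *\<^sub>v v \<theta>) $ i) = (LINT \<theta>|M. (\<Sum>j<q. c \<theta> * K \<theta> $$ (i, j) * v \<theta> $ j))"
  proof (intro Bochner_Integration.integral_cong refl)
    fix \<theta> assume "\<theta> \<in> space M"
    then have "\<theta> \<in> {a..b}" by simp
    from mult_mat_vec_index[OF K[OF this] L2_carrier[OF v this] i]
    show "c \<theta> * (K \<theta> *\<^sub>v v \<theta>) $ i = (\<Sum>j<q. c \<theta> * K \<theta> $$ (i, j) * v \<theta> $ j)"
      by (simp add: sum_distrib_left mult.assoc)
  qed
  also have "\<dots> = (\<Sum>j<q. LINT \<theta>|M. c \<theta> * K \<theta> $$ (i, j) * v \<theta> $ j)"
  proof (rule Bochner_Integration.integral_sum)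
    fix j assume "j \<in> {..<q}"
    then have "j < q" by simp
    show "integrable M (\<lambda>\<theta>. c \<theta> * K \<theta> $$ (i, j) * v \<theta> $ j)"
      by (rule bdd_integrable_mult[OF bd[OF \<open>j < q\<close>] L2_sq_int[OF v \<open>j < q\<close>]])
  qed
  finally show ?thesis .
qed

lemmas integral_mult_mat_vec_1 = integral_mult_mat_vec[where c = "\<lambda>\<theta>. 1", simplified]

text \<open>The kernel \<open>R1\<close>, cut off to \<theta> \<le> x, and the kernel
  \<open>R2\<close> combine into one kernel on the square.\<close>

lemma pi_op_gen_op:
  assumes P: "P \<in> carrier_mat m p" and Q1: "Q1 \<in> carrier_mat m q" and Q2: "Q2 \<in> carrier_mat n p"
    and R0: "R0 \<in> carrier_mat n q" and R1: "R1 \<in> carrier_mat n q" and R2: "R2 \<in> carrier_mat n q"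
    and v: "v \<in> Z a b (p, q)"
  shows "Z_eq a b (pi_op a b m n P Q1 Q2 R0 R1 R2 v)
    (gen_op m n p q (\<lambda>i j. P $$ (i, j)) (\<lambda>i j. poly (Q1 $$ (i, j))) (\<lambda>i j. poly (Q2 $$ (i, j)))
      (\<lambda>i j. poly (R0 $$ (i, j)))
      (\<lambda>i j x \<theta>. (if \<theta> \<le> x then 1 else 0) * poly (poly (R1 $$ (i, j)) [:\<theta>:]) x + poly (poly (R2 $$ (i, j)) [:\<theta>:]) x) v)"
    (is "Z_eq a b ?pi ?gen")
proof (rule Z_eqI)
  obtain v0 v1 where v_eq: "v = (v0, v1)" by fastforce
  have v0: "v0 \<in> carrier_vec p" and v1: "v1 \<in> L2 a b q"
    using v by (simp_all add: Z_iff v_eq)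
  have "(LINT x|M. (pmat_at Q1 x *\<^sub>v v1 x) $ i) = (\<Sum>j<q. LINT x|M. poly (Q1 $$ (i, j)) x * v1 x $ j)" if "i < m" for i
    using Q1 that
    by (subst integral_mult_mat_vec_1[OF _ _ v1 that]) (auto simp: pmat_at_def intro: bdd_cong[OF bdd_poly])
  then show "fst ?pi = fst ?gen"
    using P Q1 v0 by (auto simp: pi_op_def gen_op_def v_eq vec_integral_def mult_mat_vec_index[OF P v0]
        simp del: index_mult_mat_vec intro!: eq_vecI)
  fix x assume x: "x \<in> {a..b}"
  have bR: "bdd (\<lambda>\<theta>. poly (poly p [:\<theta>:]) x)" for p :: "real poly poly"
    by (rule bdd2_slice[OF bdd2_poly x])
  have bt: "bdd (\<lambda>\<theta>. if \<theta> \<le> x then 1 else 0)"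
    by (rule bdd2_slice[OF bdd2_triangle x])
  have i2: "(LINT \<theta>|M. (pmat_at2 R2 x \<theta> *\<^sub>v v1 \<theta>) $ i) = (\<Sum>j<q. LINT \<theta>|M. poly (poly (R2 $$ (i, j)) [:\<theta>:]) x * v1 \<theta> $ j)"
    if "i < n" for i
  proof (subst integral_mult_mat_vec_1[OF _ _ v1 that])
    show "pmat_at2 R2 x \<theta> \<in> carrier_mat n q" for \<theta> using R2 by (simp add: pmat_at2_def)
    show "bdd (\<lambda>\<theta>. pmat_at2 R2 x \<theta> $$ (i, j))" if "j < q" for j
      using bR[of "R2 $$ (i, j)"] R2 that \<open>i < n\<close> by (simp add: pmat_at2_def)
    show "(\<Sum>j<q. LINT \<theta>|M. pmat_at2 R2 x \<theta> $$ (i, j) * v1 \<theta> $ j)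
        = (\<Sum>j<q. LINT \<theta>|M. poly (poly (R2 $$ (i, j)) [:\<theta>:]) x * v1 \<theta> $ j)"
      using R2 that by (simp add: pmat_at2_def)
  qed
  have i1: "(LINT \<theta>|lebesgue_on {a..x}. (pmat_at2 R1 x \<theta> *\<^sub>v v1 \<theta>) $ i)
      = (\<Sum>j<q. LINT \<theta>|M. (if \<theta> \<le> x then 1 else 0) * poly (poly (R1 $$ (i, j)) [:\<theta>:]) x * v1 \<theta> $ j)"
    if "i < n" for i
    unfolding integral_initial_segment[OF x]
  proof (subst integral_mult_mat_vec[OF _ _ v1 that])
    show "pmat_at2 R1 x \<theta> \<in> carrier_mat n q" for \<theta> using R1 by (simp add: pmat_at2_def)
    show "bdd (\<lambda>\<theta>. (if \<theta> \<le> x then 1 else 0) * pmat_at2 R1 x \<theta> $$ (i, j))" if "j < q" for j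
      using bdd_mult[OF bt bR[of "R1 $$ (i, j)"]] R1 that \<open>i < n\<close> by (simp add: pmat_at2_def)
    show "(\<Sum>j<q. LINT \<theta>|M. (if \<theta> \<le> x then 1 else 0) * pmat_at2 R1 x \<theta> $$ (i, j) * v1 \<theta> $ j)
        = (\<Sum>j<q. LINT \<theta>|M. (if \<theta> \<le> x then 1 else 0) * poly (poly (R1 $$ (i, j)) [:\<theta>:]) x * v1 \<theta> $ j)"
      using R1 that by (simp add: pmat_at2_def)
  qed
  have i12: "(LINT \<theta>|M. ((if \<theta> \<le> x then 1 else 0) * poly (poly (R1 $$ (i, j)) [:\<theta>:]) x + poly (poly (R2 $$ (i, j)) [:\<theta>:]) x) * v1 \<theta> $ j)
      = (LINT \<theta>|M. (if \<theta> \<le> x then 1 else 0) * poly (poly (R1 $$ (i, j)) [:\<theta>:]) x * v1 \<theta> $ j)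
      + (LINT \<theta>|M. poly (poly (R2 $$ (i, j)) [:\<theta>:]) x * v1 \<theta> $ j)" if "j < q" for i j
    unfolding distrib_right
    by (intro Bochner_Integration.integral_add bdd_integrable_mult[OF bdd_mult[OF bt bR] L2_sq_int[OF v1 that]]
        bdd_integrable_mult[OF bR L2_sq_int[OF v1 that]])
  have m2: "pmat_at Q2 x \<in> carrier_mat n p" "pmat_at R0 x \<in> carrier_mat n q"
    using Q2 R0 by (simp_all add: pmat_at_def)
  show "snd ?pi x = snd ?gen x"
  proof (rule eq_vecI)
    fix i assume "i < dim_vec (snd ?gen x)"
    then have i: "i < n" by (simp add: gen_op_def)
    have "snd ?pi x $ i = (pmat_at Q2 x *\<^sub>v v0) $ i + (pmat_at R0 x *\<^sub>v v1 x) $ i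
        + (LINT \<theta>|lebesgue_on {a..x}. (pmat_at2 R1 x \<theta> *\<^sub>v v1 \<theta>) $ i)
        + (LINT \<theta>|M. (pmat_at2 R2 x \<theta> *\<^sub>v v1 \<theta>) $ i)"
      using i m2 by (simp add: pi_op_def v_eq vec_integral_def)
    also have "\<dots> = (\<Sum>j<p. poly (Q2 $$ (i, j)) x * v0 $ j) + (\<Sum>j<q. poly (R0 $$ (i, j)) x * v1 x $ j)
        + (\<Sum>j<q. LINT \<theta>|M. (if \<theta> \<le> x then 1 else 0) * poly (poly (R1 $$ (i, j)) [:\<theta>:]) x * v1 \<theta> $ j)
        + (\<Sum>j<q. LINT \<theta>|M. poly (poly (R2 $$ (i, j)) [:\<theta>:]) x * v1 \<theta> $ j)"
      unfolding i1[OF i] i2[OF i] mult_mat_vec_index[OF m2(1) v0 i]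
        mult_mat_vec_index[OF m2(2) L2_carrier[OF v1 x] i]
      using Q2 R0 i by (simp add: pmat_at_def)
    also have "\<dots> = snd ?gen x $ i"
      using i i12 by (simp add: gen_op_def v_eq sum.distrib)
    finally show "snd ?pi x $ i = snd ?gen x $ i" .
  qed (use m2 in \<open>simp add: pi_op_def gen_op_def v_eq vec_integral_def\<close>)
qed

lemma PI_ops_gen_op:
  assumes "B \<in> PI_ops a b (m, n) (p, q)"
  obtains P Q1 Q2 R0 R where "gen_ok m n p q Q1 Q2 R0 R" "\<forall>v\<in>Z a b (p, q). B v \<in> Z a b (m, n)"
    "\<forall>v\<in>Z a b (p, q). Z_eq a b (B v) (gen_op m n p q P Q1 Q2 R0 R v)"
proof -
  from assms obtain P Q1 Q2 R0 R1 R2 where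
    mats: "P \<in> carrier_mat m p" "Q1 \<in> carrier_mat m q" "Q2 \<in> carrier_mat n p"
      "R0 \<in> carrier_mat n q" "R1 \<in> carrier_mat n q" "R2 \<in> carrier_mat n q"
    and eq: "op_eq a b (p, q) B (pi_op a b m n P Q1 Q2 R0 R1 R2)"
    and Z: "\<forall>v\<in>Z a b (p, q). B v \<in> Z a b (m, n)"
    unfolding PI_ops_def by auto
  have "bdd2 (\<lambda>x \<theta>. (if \<theta> \<le> x then 1 else 0) * poly (poly r [:\<theta>:]) x + poly (poly s [:\<theta>:]) x)" for r s
    by (rule bdd2_add[OF bdd2_mult[OF bdd2_triangle bdd2_poly] bdd2_poly])
  then have ok: "gen_ok m n p q (\<lambda>i j. poly (Q1 $$ (i, j))) (\<lambda>i j. poly (Q2 $$ (i, j))) (\<lambda>i j. poly (R0 $$ (i, j)))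
      (\<lambda>i j x \<theta>. (if \<theta> \<le> x then 1 else 0) * poly (poly (R1 $$ (i, j)) [:\<theta>:]) x + poly (poly (R2 $$ (i, j)) [:\<theta>:]) x)"
    by (simp add: gen_ok_def bdd_poly)
  show ?thesis
  proof (rule that[OF ok Z], rule ballI)
    fix v assume v: "v \<in> Z a b (p, q)"
    have "Z_eq a b (B v) (pi_op a b m n P Q1 Q2 R0 R1 R2 v)"
      using eq v by (simp add: op_eq_def)
    from Z_eq_trans[OF this pi_op_gen_op[OF mats v]]
    show "Z_eq a b (B v) (gen_op m n p q (\<lambda>i j. P $$ (i, j)) (\<lambda>i j. poly (Q1 $$ (i, j))) (\<lambda>i j. poly (Q2 $$ (i, j)))
      (\<lambda>i j. poly (R0 $$ (i, j)))
      (\<lambda>i j x \<theta>. (if \<theta> \<le> x then 1 else 0) * poly (poly (R1 $$ (i, j)) [:\<theta>:]) x + poly (poly (R2 $$ (i, j)) [:\<theta>:]) x) v)" .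
  qed
qed

lemma has_adj_PI:
  assumes "B \<in> PI_ops a b (m, n) (p, q)"
  shows "has_adj (p, q) (m, n) B"
proof -
  obtain P Q1 Q2 R0 R where ok: "gen_ok m n p q Q1 Q2 R0 R" and Z: "\<forall>v\<in>Z a b (p, q). B v \<in> Z a b (m, n)"
    and eq: "\<forall>v\<in>Z a b (p, q). Z_eq a b (B v) (gen_op m n p q P Q1 Q2 R0 R v)"
    by (rule PI_ops_gen_op[OF assms])
  show ?thesis by (rule has_adj_cong[OF has_adj_gen_op[OF ok] Z[rule_format] eq[rule_format]])
qed

text \<open>Altering v on a null set leaves its integrals unchanged and affects the multiplication
  term on a null set only.\<close>

lemma gen_op_cong:
  assumes ok: "gen_ok m n p q Q1 Q2 R0 R" and v: "v \<in> Z a b (p, q)" and w: "w \<in> Z a b (p, q)"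
    and eq: "Z_eq a b v w"
  shows "Z_eq a b (gen_op m n p q P Q1 Q2 R0 R v) (gen_op m n p q P Q1 Q2 R0 R w)"
proof -
  have fst_eq: "fst v = fst w" and AE: "AE x in M. snd v x = snd w x"
    using eq by (simp_all add: Z_eq_def L2_eq_def)
  have int: "(LINT x|M. r x * snd v x $ j) = (LINT x|M. r x * snd w x $ j)" if "bdd r" "j < q" for r j
  proof (rule integral_cong_AE)
    show "(\<lambda>x. r x * snd v x $ j) \<in> borel_measurable M" "(\<lambda>x. r x * snd w x $ j) \<in> borel_measurable M"
      using that v w L2_sq_int[of "snd v" q j] L2_sq_int[of "snd w" q j]
      by (simp_all add: Z_iff sq_int_measurable[OF sq_int_bdd_mult])
    show "AE x in M. r x * snd v x $ j = r x * snd w x $ j" using AE by eventually_elim simp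
  qed
  have 1: "fst (gen_op m n p q P Q1 Q2 R0 R v) = fst (gen_op m n p q P Q1 Q2 R0 R w)"
    using ok int by (auto simp: gen_op_def fst_eq gen_ok_def intro!: eq_vecI)
  have "AE x in M. snd (gen_op m n p q P Q1 Q2 R0 R v) x = snd (gen_op m n p q P Q1 Q2 R0 R w) x"
    using AE AE_space[of M]
  proof eventually_elim
    case (elim x)
    have "bdd (R i j x)" if "i < n" "j < q" for i j
      using ok that elim(2) by (intro bdd2_slice) (simp_all add: gen_ok_def)
    with int elim show ?case by (auto simp: gen_op_def fst_eq intro!: eq_vecI)
  qed
  with 1 show ?thesis by (simp add: Z_eq_def L2_eq_def)
qed

text \<open>Needed because S and P are applied to T v and A v in place of u and its time derivative,
  with which they agree only almost everywhere.\<close>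

lemma PI_ops_cong:
  assumes B: "B \<in> PI_ops a b (m, n) (p, q)" and "v \<in> Z a b (p, q)" "w \<in> Z a b (p, q)" "Z_eq a b v w"
  shows "Z_eq a b (B v) (B w)"
proof -
  obtain P Q1 Q2 R0 R where ok: "gen_ok m n p q Q1 Q2 R0 R"
    and eq: "\<forall>v\<in>Z a b (p, q). Z_eq a b (B v) (gen_op m n p q P Q1 Q2 R0 R v)"
    by (rule PI_ops_gen_op[OF B])
  have "Z_eq a b (gen_op m n p q P Q1 Q2 R0 R v) (gen_op m n p q P Q1 Q2 R0 R w)"
    by (rule gen_op_cong[OF ok assms(2-4)])
  then show ?thesis using eq assms(2,3) Z_eq_trans Z_eq_sym by blast
qed

end

section \<open>The operators \<open>T\<close>, \<open>R\<close>, \<open>K\<close> and \<open>A\<close>\<close>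

lemma sum_lessThan_add: "(\<Sum>k<n + m. f k) = (\<Sum>k<n. f k) + (\<Sum>k<m. f (n + k))"
  for f :: "nat \<Rightarrow> 'a::comm_monoid_add"
  by (induction m) (simp_all add: add.assoc)

lemma index_append_rows:
  assumes "A \<in> carrier_mat k c" "B \<in> carrier_mat l c" "i < k + l" "j < c"
  shows "(A @\<^sub>r B) $$ (i, j) = (if i < k then A $$ (i, j) else B $$ (i - k, j))"
  using assms by (auto simp: append_rows_def)

lemma index_append_cols:
  assumes "A \<in> carrier_mat k c" "B \<in> carrier_mat k d" "i < k" "j < c + d"
  shows "(A ||| B) $$ (i, j) = (if j < c then A $$ (i, j) else B $$ (i, j - c))"
  using assms by (auto simp: append_cols_def)

lemma carrier_append_cols:
  "A \<in> carrier_mat k c \<Longrightarrow> B \<in> carrier_mat k d \<Longrightarrow> A ||| B \<in> carrier_mat k (c + d)"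
  by (auto simp: append_cols_def)

text \<open>Applied to the stacked vector (u(a), u_x(a)) with s = x - a, this block row yields the
  affine part of Taylor's formula.\<close>

abbreviation affine_mat :: "nat \<Rightarrow> real \<Rightarrow> real mat" where
  "affine_mat n s \<equiv> 1\<^sub>m n ||| s \<cdot>\<^sub>m 1\<^sub>m n"

lemma affine_mat_carrier [simp]: "affine_mat n s \<in> carrier_mat n (2 * n)"
  using carrier_append_cols[of "1\<^sub>m n" n n "s \<cdot>\<^sub>m 1\<^sub>m n" n] by (simp add: mult_2)

lemma affine_mat_index:
  assumes "i < n" "j < 2 * n"
  shows "affine_mat n s $$ (i, j) = (if j < n then (if i = j then 1 else 0) else (if n + i = j then s else 0))"
  using assms by (subst index_append_cols[where k = n and c = n and d = n]) auto

lemma affine_mat_mult_vec: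
  assumes c: "c \<in> carrier_vec (2 * n)" and i: "i < n"
  shows "(affine_mat n s *\<^sub>v c) $ i = c $ i + s * c $ (n + i)"
proof -
  have "(affine_mat n s *\<^sub>v c) $ i = (\<Sum>j<n + n. affine_mat n s $$ (i, j) * c $ j)"
    using mult_mat_vec_index[OF affine_mat_carrier c i] by (simp add: mult_2)
  also have "\<dots> = (\<Sum>j<n. (if i = j then c $ j else 0)) + (\<Sum>j<n. (if i = j then s * c $ (n + j) else 0))"
    unfolding sum_lessThan_add using i
    by (intro arg_cong2[where f = "(+)"] sum.cong refl) (simp_all add: affine_mat_index)
  finally show ?thesis using i by simp
qed

lemma affine_mat_mult:
  assumes C: "C \<in> carrier_mat (2 * n) k" and i: "i < n" and j: "j < k"
  shows "(affine_mat n s * C) $$ (i, j) = C $$ (i, j) + s * C $$ (n + i, j)"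
proof -
  have "(affine_mat n s * C) $$ (i, j) = (affine_mat n s *\<^sub>v col C j) $ i"
    using C i j carrier_matD[OF affine_mat_carrier[of n s]] by simp
  also have "\<dots> = C $$ (i, j) + s * C $$ (n + i, j)"
    using C i j by (subst affine_mat_mult_vec) auto
  finally show ?thesis .
qed

lemma mult_affine_mat:
  fixes F :: "real mat"
  assumes F: "F \<in> carrier_mat k n" and i: "i < k" and j: "j < n"
  shows "(F * affine_mat n s) $$ (i, j) = F $$ (i, j)"
    and "(F * affine_mat n s) $$ (i, n + j) = s * F $$ (i, j)"
proof -
  have ij: "(F * affine_mat n s) $$ (i, l) = (\<Sum>r<n. F $$ (i, r) * affine_mat n s $$ (r, l))" if "l < 2 * n" for l
    using F i that carrier_matD[OF affine_mat_carrier[of n s]]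
    by (simp add: scalar_prod_def atLeast0LessThan)
  show "(F * affine_mat n s) $$ (i, j) = F $$ (i, j)"
    using j by (simp add: ij affine_mat_index if_distrib[of "(*) _"] cong: if_cong)
  show "(F * affine_mat n s) $$ (i, n + j) = s * F $$ (i, j)"
    using j by (simp add: ij affine_mat_index if_distrib[of "(*) _"] mult.commute cong: if_cong)
qed

lemma mult_stack4_vec:
  fixes E :: "real mat"
  assumes E: "E \<in> carrier_mat k (4 * n)" and i: "i < k"
    and v: "v1 \<in> carrier_vec n" "v2 \<in> carrier_vec n" "v3 \<in> carrier_vec n" "v4 \<in> carrier_vec n"
  shows "(E *\<^sub>v (v1 @\<^sub>v v2 @\<^sub>v v3 @\<^sub>v v4)) $ i
    = (\<Sum>j<n. E $$ (i, j) * v1 $ j + E $$ (i, n + j) * v2 $ j + E $$ (i, 2 * n + j) * v3 $ j + E $$ (i, 3 * n + j) * v4 $ j)"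
proof -
  have v': "v1 @\<^sub>v v2 @\<^sub>v v3 @\<^sub>v v4 \<in> carrier_vec (4 * n)"
    using v by (intro carrier_vecI) simp
  have "4 * n = n + (n + (n + n))" by simp
  then have "(E *\<^sub>v (v1 @\<^sub>v v2 @\<^sub>v v3 @\<^sub>v v4)) $ i
      = (\<Sum>j<n + (n + (n + n)). E $$ (i, j) * (v1 @\<^sub>v v2 @\<^sub>v v3 @\<^sub>v v4) $ j)"
    using mult_mat_vec_index[OF E v' i] by (simp only:)
  also have "\<dots> = (\<Sum>j<n. E $$ (i, j) * v1 $ j) + ((\<Sum>j<n. E $$ (i, n + j) * v2 $ j)
      + ((\<Sum>j<n. E $$ (i, 2 * n + j) * v3 $ j) + (\<Sum>j<n. E $$ (i, 3 * n + j) * v4 $ j)))"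
    unfolding sum_lessThan_add using v
    by (intro arg_cong2[where f = "(+)"] sum.cong refl) (simp_all add: add.assoc[symmetric] mult_2[symmetric])
  finally show ?thesis by (simp add: sum.distrib)
qed

lemma mult_stack4:
  fixes E :: "real mat"
  assumes E: "E \<in> carrier_mat k (4 * n)" and i: "i < k" and j: "j < c"
    and A: "A1 \<in> carrier_mat n c" "A2 \<in> carrier_mat n c" "A3 \<in> carrier_mat n c" "A4 \<in> carrier_mat n c"
  shows "(E * (A1 @\<^sub>r A2 @\<^sub>r A3 @\<^sub>r A4)) $$ (i, j)
    = (\<Sum>l<n. E $$ (i, l) * A1 $$ (l, j) + E $$ (i, n + l) * A2 $$ (l, j)
        + E $$ (i, 2 * n + l) * A3 $$ (l, j) + E $$ (i, 3 * n + l) * A4 $$ (l, j))"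
proof -
  have c: "A3 @\<^sub>r A4 \<in> carrier_mat (n + n) c" "A2 @\<^sub>r A3 @\<^sub>r A4 \<in> carrier_mat (n + (n + n)) c"
    "A1 @\<^sub>r A2 @\<^sub>r A3 @\<^sub>r A4 \<in> carrier_mat (n + (n + (n + n))) c"
    using A by (intro carrier_append_rows; simp)+
  have "col (A1 @\<^sub>r A2 @\<^sub>r A3 @\<^sub>r A4) j = col A1 j @\<^sub>v col A2 j @\<^sub>v col A3 j @\<^sub>v col A4 j"
  proof (rule eq_vecI)
    fix r assume "r < dim_vec (col A1 j @\<^sub>v col A2 j @\<^sub>v col A3 j @\<^sub>v col A4 j)"
    then have r: "r < n + (n + (n + n))" using A by simp
    show "col (A1 @\<^sub>r A2 @\<^sub>r A3 @\<^sub>r A4) j $ r = (col A1 j @\<^sub>v col A2 j @\<^sub>v col A3 j @\<^sub>v col A4 j) $ r"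
      using r j A carrier_matD[OF c(3)] by (simp add: index_append_rows[OF A(1) c(2)] index_append_rows[OF A(2) c(1)]
          index_append_rows[OF A(3) A(4)])
  qed (use carrier_matD[OF c(3)] A in simp)
  moreover have "(E * (A1 @\<^sub>r A2 @\<^sub>r A3 @\<^sub>r A4)) $$ (i, j) = (E *\<^sub>v col (A1 @\<^sub>r A2 @\<^sub>r A3 @\<^sub>r A4) j) $ i"
    using E i j c by simp
  moreover have "(E *\<^sub>v (col A1 j @\<^sub>v col A2 j @\<^sub>v col A3 j @\<^sub>v col A4 j)) $ i
    = (\<Sum>l<n. E $$ (i, l) * col A1 j $ l + E $$ (i, n + l) * col A2 j $ l
        + E $$ (i, 2 * n + l) * col A3 j $ l + E $$ (i, 3 * n + l) * col A4 j $ l)"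
    using A by (intro mult_stack4_vec[OF E i]) auto
  ultimately show ?thesis using A j by simp
qed

section \<open>The entries of G and H and the inverse of G\<close>

lemma G_mat_carrier:
  "E \<in> carrier_mat k (4 * n) \<Longrightarrow> G_mat a b n E F \<in> carrier_mat k (2 * n)"
  by (auto simp: G_mat_def mat_integral_def)

lemma H_mat_carrier:
  "E \<in> carrier_mat k (4 * n) \<Longrightarrow> H_mat b n E F x \<in> carrier_mat k n"
  by (auto simp: H_mat_def mat_integral_def)

text \<open>The first n columns collect the coefficients of u(a), the last n those of u_x(a). The
  block of E that acts on u(b) contributes to both, to the second with the factor b - a.\<close>

lemma G_mat_index:
  assumes E: "E \<in> carrier_mat k (4 * n)" and F: "\<And>x. F x \<in> carrier_mat k n" and i: "i < k" and j: "j < n"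
  shows "G_mat a b n E F $$ (i, j) = E $$ (i, j) + E $$ (i, n + j) + (LINT x|lebesgue_on {a..b}. F x $$ (i, j))"
    and "G_mat a b n E F $$ (i, n + j) = (b - a) * E $$ (i, n + j) + E $$ (i, 2 * n + j) + E $$ (i, 3 * n + j)
      + (LINT x|lebesgue_on {a..b}. (x - a) * F x $$ (i, j))"
proof -
  let ?S = "affine_mat n 0"
  have z: "(0\<^sub>m n n ||| 1\<^sub>m n :: real mat) \<in> carrier_mat n (2 * n)" "(1\<^sub>m n ||| 0\<^sub>m n n :: real mat) \<in> carrier_mat n (2 * n)"
    using carrier_append_cols[of _ n n _ n] by (simp_all add: mult_2)
  note c4 = mult_stack4[OF E i _ z(2) affine_mat_carrier[of n "b - a"] z(1) z(1)]
  have idx0: "(0\<^sub>m n n ||| 1\<^sub>m n :: real mat) $$ (l, r) = (if n + l = r then 1 else 0)"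
    and idx1: "(1\<^sub>m n ||| 0\<^sub>m n n :: real mat) $$ (l, r) = (if l = r then 1 else 0)" if "l < n" "r < 2 * n" for l r
    using that by (subst index_append_cols[where k = n and c = n and d = n]; auto)+
  have dims: "dim_row E = k" using E by simp
  have ij: "G_mat a b n E F $$ (i, r) = (E * ((1\<^sub>m n ||| 0\<^sub>m n n) @\<^sub>r affine_mat n (b - a) @\<^sub>r (0\<^sub>m n n ||| 1\<^sub>m n) @\<^sub>r (0\<^sub>m n n ||| 1\<^sub>m n))) $$ (i, r)
      + (LINT x|lebesgue_on {a..b}. (F x * affine_mat n (x - a)) $$ (i, r))" if "r < 2 * n" for r
    unfolding G_mat_def using that i dims by (subst index_add_mat) (simp_all add: mat_integral_def)
  show "G_mat a b n E F $$ (i, j) = E $$ (i, j) + E $$ (i, n + j) + (LINT x|lebesgue_on {a..b}. F x $$ (i, j))"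
    using j by (simp add: ij c4 mult_affine_mat[OF F i j] idx0 idx1 affine_mat_index sum.distrib if_distrib[of "(*) _"] cong: if_cong)
  show "G_mat a b n E F $$ (i, n + j) = (b - a) * E $$ (i, n + j) + E $$ (i, 2 * n + j) + E $$ (i, 3 * n + j)
      + (LINT x|lebesgue_on {a..b}. (x - a) * F x $$ (i, j))"
    using j by (simp add: ij c4 mult_affine_mat[OF F i j] idx0 idx1 affine_mat_index sum.distrib if_distrib[of "(*) _"]
        mult.commute[of _ "b - a"] cong: if_cong)
qed

lemma H_mat_index:
  assumes E: "E \<in> carrier_mat k (4 * n)" and F: "\<And>x. F x \<in> carrier_mat k n" and i: "i < k" and j: "j < n"
  shows "H_mat b n E F x $$ (i, j) = - ((b - x) * E $$ (i, n + j) + E $$ (i, 3 * n + j))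
      - (LINT \<theta>|lebesgue_on {x..b}. (\<theta> - x) * F \<theta> $$ (i, j))"
proof -
  let ?B = "0\<^sub>m n n @\<^sub>r ((b - x) \<cdot>\<^sub>m 1\<^sub>m n) @\<^sub>r 0\<^sub>m n n @\<^sub>r 1\<^sub>m n :: real mat"
  have "?B \<in> carrier_mat (n + (n + (n + n))) n"
    by (intro carrier_append_rows) auto
  from carrier_matD(2)[OF this] have "(- (E * ?B)) $$ (i, j) = - ((E * ?B) $$ (i, j))"
    using E i j by (intro index_uminus_mat) simp_all
  also have "(E * ?B) $$ (i, j) = (b - x) * E $$ (i, n + j) + E $$ (i, 3 * n + j)"
    using j by (subst mult_stack4[OF E i j])
      (simp_all add: sum.distrib if_distrib[of "(*) _"] mult.commute[of _ "b - x"] cong: if_cong)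
  finally have 1: "(- (E * ?B)) $$ (i, j) = - ((b - x) * E $$ (i, n + j) + E $$ (i, 3 * n + j))" .
  have "(LINT \<theta>|lebesgue_on {x..b}. ((\<theta> - x) \<cdot>\<^sub>m F \<theta>) $$ (i, j)) = (LINT \<theta>|lebesgue_on {x..b}. (\<theta> - x) * F \<theta> $$ (i, j))"
    using carrier_matD[OF F] i j by simp
  then show ?thesis
    unfolding H_mat_def 1[symmetric] using E i j by (subst index_minus_mat) (simp_all add: mat_integral_def)
qed

text \<open>\<open>mat_inverse\<close> returns an option computed by Gauss-Jordan elimination; an
  invertible matrix is a unit of the matrix ring, which excludes \<open>None\<close>.\<close>

lemma mat_inverse_invertible:
  fixes G :: "real mat"
  assumes G: "G \<in> carrier_mat k k" and inv: "invertible_mat G"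
  shows "the (mat_inverse G) \<in> carrier_mat k k" "the (mat_inverse G) * G = 1\<^sub>m k"
proof -
  obtain B where B: "G * B = 1\<^sub>m (dim_row G)" "B * G = 1\<^sub>m (dim_row B)"
    using inv unfolding invertible_mat_def inverts_mat_def by blast
  have "dim_col B = k" using arg_cong[OF B(1), of dim_col] G by simp
  moreover have "dim_row B = k" using arg_cong[OF B(2), of dim_col] G by simp
  ultimately have "B \<in> carrier_mat k k" by blast
  then have "G \<in> Units (ring_mat TYPE(real) k ())"
    using B G unfolding Units_def by (auto simp: ring_mat_def)
  then have "mat_inverse G \<noteq> None" using mat_inverse(1)[OF G, where b = "()"] by blast
  then obtain C where "mat_inverse G = Some C" by blast
  then show "the (mat_inverse G) \<in> carrier_mat k k" "the (mat_inverse G) * G = 1\<^sub>m k"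
    using mat_inverse(2)[OF G] by simp_all
qed

section \<open>T, R, K and multiplications as kernel operators\<close>

context compact_interval
begin

text \<open>The common shape of T and R: a matrix on the finite component, a matrix kernel over
  [a, b] and a scalar Volterra kernel, which is x - \<theta> for T and 1 for R.\<close>

definition W_op where
  "W_op n Q K \<kappa> v = of_L2 (\<lambda>x. Q x *\<^sub>v fst v + vec_integral n {a..b} (\<lambda>\<theta>. K x \<theta> *\<^sub>v snd v \<theta>)
     + vec_integral n {a..x} (\<lambda>\<theta>. \<kappa> x \<theta> \<cdot>\<^sub>v snd v \<theta>))"

lemma integral_volterra:
  fixes v :: "real \<Rightarrow> real vec"
  assumes v: "v \<in> L2 a b n" and x: "x \<in> {a..b}" and i: "i < n"
  shows "(LINT \<theta>|lebesgue_on {a..x}. (k \<theta> \<cdot>\<^sub>v v \<theta>) $ i) = (LINT \<theta>|M. (if \<theta> \<le> x then 1 else 0) * k \<theta> * v \<theta> $ i)"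
  unfolding integral_initial_segment[OF x]
proof (intro Bochner_Integration.integral_cong refl)
  fix \<theta> assume "\<theta> \<in> space M"
  then show "(if \<theta> \<le> x then 1 else 0) * (k \<theta> \<cdot>\<^sub>v v \<theta>) $ i = (if \<theta> \<le> x then 1 else 0) * k \<theta> * v \<theta> $ i"
    using L2_dim[OF v, of \<theta>] i by simp
qed

lemma has_adj_W_op:
  assumes Q: "\<And>x. x \<in> {a..b} \<Longrightarrow> Q x \<in> carrier_mat n m"
    and Qb: "\<And>i j. i < n \<Longrightarrow> j < m \<Longrightarrow> bdd (\<lambda>x. Q x $$ (i, j))"
    and K: "\<And>x \<theta>. x \<in> {a..b} \<Longrightarrow> \<theta> \<in> {a..b} \<Longrightarrow> K x \<theta> \<in> carrier_mat n n"
    and Kb: "\<And>i j. i < n \<Longrightarrow> j < n \<Longrightarrow> bdd2 (\<lambda>x \<theta>. K x \<theta> $$ (i, j))"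
    and \<kappa>: "bdd2 \<kappa>"
  shows "has_adj (m, n) (0, n) (W_op n Q K \<kappa>)"
proof -
  \<comment> \<open>The scalar Volterra kernel as a multiple of the identity matrix, cut off to the
    triangle.\<close>
  define V where "V i j x \<theta> = (if \<theta> \<le> x then 1 else 0) * (if i = j then \<kappa> x \<theta> else 0)" for i j :: nat and x \<theta>
  have Vb: "bdd2 (V i j)" for i j
    unfolding V_def by (cases "i = j") (simp_all add: bdd2_mult bdd2_triangle \<kappa>)
  let ?g = "gen_op 0 n m n (\<lambda>i j. 0) (\<lambda>i j x. 0) (\<lambda>i j x. Q x $$ (i, j)) (\<lambda>i j x. 0)
      (\<lambda>i j x \<theta>. K x \<theta> $$ (i, j) + V i j x \<theta>)"
  have ok: "gen_ok 0 n m n (\<lambda>i j x. 0) (\<lambda>i j x. Q x $$ (i, j)) (\<lambda>i j x. 0)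
      (\<lambda>i j x \<theta>. K x \<theta> $$ (i, j) + V i j x \<theta>)"
    unfolding gen_ok_def using Qb bdd2_add[OF Kb Vb] by simp
  have eq: "fst (W_op n Q K \<kappa> v) = fst (?g v)" "\<And>x. x \<in> {a..b} \<Longrightarrow> snd (W_op n Q K \<kappa> v) x = snd (?g v) x"
    if v: "v \<in> Z a b (m, n)" for v
  proof -
    obtain v0 v1 where v_eq: "v = (v0, v1)" by fastforce
    have v0: "v0 \<in> carrier_vec m" and v1: "v1 \<in> L2 a b n"
      using v by (simp_all add: Z_iff v_eq)
    show "fst (W_op n Q K \<kappa> v) = fst (?g v)"
      by (auto simp: W_op_def of_L2_def gen_op_def intro!: eq_vecI)
    fix x assume x: "x \<in> {a..b}"
    show "snd (W_op n Q K \<kappa> v) x = snd (?g v) x"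
    proof (rule eq_vecI)
      fix i assume "i < dim_vec (snd (?g v) x)"
      then have i: "i < n" by (simp add: gen_op_def)
      have Kb': "bdd (\<lambda>\<theta>. K x \<theta> $$ (i, j))" if "j < n" for j
        by (rule bdd2_slice[OF Kb[OF i that] x])
      have Vb': "bdd (V i j x)" for j by (rule bdd2_slice[OF Vb x])
      have "(LINT \<theta>|lebesgue_on {a..x}. (\<kappa> x \<theta> \<cdot>\<^sub>v v1 \<theta>) $ i) = (LINT \<theta>|M. V i i x \<theta> * v1 \<theta> $ i)"
        unfolding integral_volterra[OF v1 x i] by (simp add: V_def)
      also have "\<dots> = (\<Sum>j<n. if i = j then LINT \<theta>|M. V i i x \<theta> * v1 \<theta> $ i else 0)"
        using i by simp
      also have "\<dots> = (\<Sum>j<n. LINT \<theta>|M. V i j x \<theta> * v1 \<theta> $ j)"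
        by (intro sum.cong refl) (simp add: V_def)
      finally have volt: "(LINT \<theta>|lebesgue_on {a..x}. (\<kappa> x \<theta> \<cdot>\<^sub>v v1 \<theta>) $ i) = (\<Sum>j<n. LINT \<theta>|M. V i j x \<theta> * v1 \<theta> $ j)" .
      have "snd (W_op n Q K \<kappa> v) x $ i = (Q x *\<^sub>v v0) $ i + (LINT \<theta>|M. (K x \<theta> *\<^sub>v v1 \<theta>) $ i)
          + (LINT \<theta>|lebesgue_on {a..x}. (\<kappa> x \<theta> \<cdot>\<^sub>v v1 \<theta>) $ i)"
        using i Q[OF x] by (simp add: W_op_def of_L2_def v_eq vec_integral_def)
      also have "\<dots> = (\<Sum>j<m. Q x $$ (i, j) * v0 $ j) + (\<Sum>j<n. LINT \<theta>|M. K x \<theta> $$ (i, j) * v1 \<theta> $ j)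
          + (\<Sum>j<n. LINT \<theta>|M. V i j x \<theta> * v1 \<theta> $ j)"
        unfolding volt mult_mat_vec_index[OF Q[OF x] v0 i]
        by (intro arg_cong2[where f = "(+)"] refl integral_mult_mat_vec_1[OF K[OF x] Kb' v1 i]) simp
      also have "\<dots> = (\<Sum>j<m. Q x $$ (i, j) * v0 $ j) + (\<Sum>j<n. LINT \<theta>|M. (K x \<theta> $$ (i, j) + V i j x \<theta>) * v1 \<theta> $ j)"
      proof -
        have "(LINT \<theta>|M. (K x \<theta> $$ (i, j) + V i j x \<theta>) * v1 \<theta> $ j)
            = (LINT \<theta>|M. K x \<theta> $$ (i, j) * v1 \<theta> $ j) + (LINT \<theta>|M. V i j x \<theta> * v1 \<theta> $ j)" if "j < n" for j
          unfolding distrib_right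
          by (intro Bochner_Integration.integral_add bdd_integrable_mult[OF Kb'[OF that] L2_sq_int[OF v1 that]]
              bdd_integrable_mult[OF Vb' L2_sq_int[OF v1 that]])
        then show ?thesis by (simp add: sum.distrib)
      qed
      also have "\<dots> = snd (?g v) x $ i"
        using i by (simp add: gen_op_def v_eq)
      finally show "snd (W_op n Q K \<kappa> v) x $ i = snd (?g v) x $ i" .
    qed (simp add: W_op_def of_L2_def gen_op_def vec_integral_def)
  qed
  show ?thesis
  proof (rule has_adj_cong[OF has_adj_gen_op[OF ok, where P = "\<lambda>i j. 0"]])
    fix v assume v: "v \<in> Z a b (m, n)"
    show "W_op n Q K \<kappa> v \<in> Z a b (0, n)"
      by (rule Z_cong[OF gen_op_Z[OF ok v, where P = "\<lambda>i j. 0"]]) (simp_all only: eq[OF v])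
    show "Z_eq a b (W_op n Q K \<kappa> v) (?g v)"
      by (rule Z_eqI) (simp_all only: eq[OF v])
  qed
qed

lemma has_adj_K_op:
  assumes H: "\<And>x. x \<in> {a..b} \<Longrightarrow> H_mat b n E F x \<in> carrier_mat m n"
    and Hb: "\<And>i j. i < m \<Longrightarrow> j < n \<Longrightarrow> bdd (\<lambda>x. H_mat b n E F x $$ (i, j))"
  shows "has_adj (m, n) (m, 0) (K_op a b n m E F)"
proof -
  let ?g = "gen_op m 0 m n (\<lambda>i j. 0) (\<lambda>i j x. H_mat b n E F x $$ (i, j)) (\<lambda>i j x. 0) (\<lambda>i j x. 0) (\<lambda>i j x \<theta>. 0)"
  have ok: "gen_ok m 0 m n (\<lambda>i j x. H_mat b n E F x $$ (i, j)) (\<lambda>i j x. 0) (\<lambda>i j x. 0) (\<lambda>i j x \<theta>. 0)"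
    using Hb by (simp add: gen_ok_def)
  have eq: "fst (K_op a b n m E F v) = fst (?g v)" "\<And>x. snd (K_op a b n m E F v) x = snd (?g v) x"
    if v: "v \<in> Z a b (m, n)" for v
  proof -
    have v1: "snd v \<in> L2 a b n" using v by (simp add: Z_iff)
    have "(LINT x|M. (H_mat b n E F x *\<^sub>v snd v x) $ i) = (\<Sum>j<n. LINT x|M. H_mat b n E F x $$ (i, j) * snd v x $ j)"
      if "i < m" for i
      by (rule integral_mult_mat_vec_1[OF H Hb v1]) (use that in simp_all)
    then show "fst (K_op a b n m E F v) = fst (?g v)"
      by (intro eq_vecI) (simp_all add: K_op_def of_vec_def gen_op_def vec_integral_def del: index_mult_mat_vec)
    show "\<And>x. snd (K_op a b n m E F v) x = snd (?g v) x"
      by (rule eq_vecI) (simp_all add: K_op_def of_vec_def gen_op_def)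
  qed
  show ?thesis
  proof (rule has_adj_cong[OF has_adj_gen_op[OF ok, where P = "\<lambda>i j. 0"]])
    fix v assume v: "v \<in> Z a b (m, n)"
    show "K_op a b n m E F v \<in> Z a b (m, 0)"
      by (rule Z_cong[OF gen_op_Z[OF ok v, where P = "\<lambda>i j. 0"]]) (simp_all only: eq[OF v])
    show "Z_eq a b (K_op a b n m E F v) (?g v)"
      by (rule Z_eqI) (simp_all only: eq[OF v])
  qed
qed

text \<open>The finite component is ignored, so that the same operator can be applied to T v and R
  v, which have none, and to v itself in the term with A2.\<close>

definition mult_op where
  "mult_op A v = of_L2 (\<lambda>x. pmat_at A x *\<^sub>v snd v x)"

lemma mult_op_eq_gen_op:
  assumes A: "A \<in> carrier_mat n n" and v: "v \<in> Z a b (m, n)" 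
  shows "fst (mult_op A v) = fst (gen_op 0 n m n (\<lambda>i j. 0) (\<lambda>i j x. 0) (\<lambda>i j x. 0) (\<lambda>i j. poly (A $$ (i, j))) (\<lambda>i j x \<theta>. 0) v)"
    and "x \<in> {a..b} \<Longrightarrow> snd (mult_op A v) x
      = snd (gen_op 0 n m n (\<lambda>i j. 0) (\<lambda>i j x. 0) (\<lambda>i j x. 0) (\<lambda>i j. poly (A $$ (i, j))) (\<lambda>i j x \<theta>. 0) v) x"
proof -
  show "fst (mult_op A v) = fst (gen_op 0 n m n (\<lambda>i j. 0) (\<lambda>i j x. 0) (\<lambda>i j x. 0) (\<lambda>i j. poly (A $$ (i, j))) (\<lambda>i j x \<theta>. 0) v)"
    by (rule eq_vecI) (simp_all add: mult_op_def of_L2_def gen_op_def)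
  assume x: "x \<in> {a..b}"
  have Ax: "pmat_at A x \<in> carrier_mat n n" using A by (simp add: pmat_at_def)
  have "snd v x \<in> carrier_vec n" using v x by (simp add: Z_iff L2_iff)
  from mult_mat_vec_index[OF Ax this]
  have idx: "(pmat_at A x *\<^sub>v snd v x) $ i = (\<Sum>j<n. poly (A $$ (i, j)) x * snd v x $ j)" if "i < n" for i
    using A that by (simp add: pmat_at_def del: index_mult_mat_vec)
  show "snd (mult_op A v) x
      = snd (gen_op 0 n m n (\<lambda>i j. 0) (\<lambda>i j x. 0) (\<lambda>i j x. 0) (\<lambda>i j. poly (A $$ (i, j))) (\<lambda>i j x \<theta>. 0) v) x"
    by (rule eq_vecI) (use Ax idx in \<open>simp_all add: mult_op_def of_L2_def gen_op_def del: index_mult_mat_vec\<close>)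
qed

lemma has_adj_mult_op:
  assumes A: "A \<in> carrier_mat n n"
  shows "has_adj (m, n) (0, n) (mult_op A)"
proof -
  have ok: "gen_ok 0 n m n (\<lambda>i j x. 0) (\<lambda>i j x. 0) (\<lambda>i j. poly (A $$ (i, j))) (\<lambda>i j x \<theta>. 0)"
    by (simp add: gen_ok_def bdd_poly)
  note eq = mult_op_eq_gen_op[OF A]
  show ?thesis
  proof (rule has_adj_cong[OF has_adj_gen_op[OF ok, where P = "\<lambda>i j. 0"]])
    fix v assume v: "v \<in> Z a b (m, n)"
    show "mult_op A v \<in> Z a b (0, n)"
      by (rule Z_cong[OF gen_op_Z[OF ok v, where P = "\<lambda>i j. 0"]]) (simp_all only: eq[OF v])
    show "Z_eq a b (mult_op A v) (gen_op 0 n m n (\<lambda>i j. 0) (\<lambda>i j x. 0) (\<lambda>i j x. 0) (\<lambda>i j. poly (A $$ (i, j))) (\<lambda>i j x \<theta>. 0) v)"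
      by (rule Z_eqI) (simp_all only: eq[OF v])
  qed
qed

end

text \<open>These properties of G and H suffice for the mapping properties and adjoints of T, R and
  A; the boundary conditions from which G and H arise enter in \<open>pde_setting\<close>.\<close>

locale evolution_operators = compact_interval +
  fixes n m :: nat and G :: "real mat" and H :: "real \<Rightarrow> real mat"
  assumes m_le: "m \<le> 2 * n"
    and G: "G \<in> carrier_mat (2 * n) (2 * n)" and inv_G: "invertible_mat G"
    and H: "\<And>x. H x \<in> carrier_mat (2 * n) n"
    and Hb: "\<And>i j. i < 2 * n \<Longrightarrow> j < n \<Longrightarrow> bdd (\<lambda>x. H x $$ (i, j))"
begin

definition Gi where "Gi = the (mat_inverse G)"

lemma Gi [simp]: "Gi \<in> carrier_mat (2 * n) (2 * n)" and Gi_G: "Gi * G = 1\<^sub>m (2 * n)"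
  unfolding Gi_def by (rule mat_inverse_invertible[OF G inv_G])+

text \<open>The last m columns of the inverse of G: the response of (u(a), u_x(a)) to the finite
  component v0.\<close>

definition C0 where "C0 = Gi * (0\<^sub>m (2 * n - m) m @\<^sub>r 1\<^sub>m m)"

lemma bot_carrier: "0\<^sub>m (2 * n - m) m @\<^sub>r 1\<^sub>m m \<in> carrier_mat (2 * n) m"
  using carrier_append_rows[of "0\<^sub>m (2 * n - m) m" "2 * n - m" m "1\<^sub>m m" m] m_le by simp

lemma C0 [simp]: "C0 \<in> carrier_mat (2 * n) m"
  unfolding C0_def by (rule mult_carrier_mat[OF Gi bot_carrier])

lemma T0_mat_eq: "T0_mat a n m G x = affine_mat n (x - a) * C0"
  unfolding T0_mat_def C0_def Gi_def[symmetric] by (rule assoc_mult_mat[OF affine_mat_carrier Gi bot_carrier])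

lemma T1_mat_eq: "T1_mat a n G H x \<theta> = affine_mat n (x - a) * (Gi * H \<theta>)"
  unfolding T1_mat_def Gi_def[symmetric] by (rule assoc_mult_mat[OF affine_mat_carrier Gi H])

lemma GiH [simp]: "Gi * H \<theta> \<in> carrier_mat (2 * n) n"
  by (rule mult_carrier_mat[OF Gi H])

lemma bdd_GiH: "i < 2 * n \<Longrightarrow> j < n \<Longrightarrow> bdd (\<lambda>\<theta>. (Gi * H \<theta>) $$ (i, j))"
proof -
  assume ij: "i < 2 * n" "j < n"
  have "(Gi * H \<theta>) $$ (i, j) = (\<Sum>k<2 * n. Gi $$ (i, k) * H \<theta> $$ (k, j))" for \<theta>
    using ij carrier_matD[OF Gi] carrier_matD[OF H[of \<theta>]] by (simp add: scalar_prod_def atLeast0LessThan)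
  moreover have "bdd (\<lambda>\<theta>. \<Sum>k<2 * n. Gi $$ (i, k) * H \<theta> $$ (k, j))"
    using ij by (intro bdd_sum bdd_mult[OF bdd_const] Hb) simp_all
  ultimately show ?thesis by (simp only:)
qed

lemma T0_index: "i < n \<Longrightarrow> j < m \<Longrightarrow> T0_mat a n m G x $$ (i, j) = C0 $$ (i, j) + (x - a) * C0 $$ (n + i, j)"
  unfolding T0_mat_eq by (rule affine_mat_mult[OF C0])

lemma T1_index: "i < n \<Longrightarrow> j < n \<Longrightarrow>
    T1_mat a n G H x \<theta> $$ (i, j) = (Gi * H \<theta>) $$ (i, j) + (x - a) * (Gi * H \<theta>) $$ (n + i, j)"
  unfolding T1_mat_eq by (rule affine_mat_mult[OF GiH])

lemma T0_carrier: "T0_mat a n m G x \<in> carrier_mat n m"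
  unfolding T0_mat_eq by (rule mult_carrier_mat[OF affine_mat_carrier C0])

lemma T1_carrier: "T1_mat a n G H x \<theta> \<in> carrier_mat n n"
  unfolding T1_mat_eq by (rule mult_carrier_mat[OF affine_mat_carrier GiH])

text \<open>T0 is affine in x, and its slope is given by the lower n rows of
  \<open>C0\<close>.\<close>

lemma deriv_T0: "mat_deriv (T0_mat a n m G) x = mat n m (\<lambda>(i, j). C0 $$ (n + i, j))"
proof (rule eq_matI)
  fix i j assume "i < dim_row (mat n m (\<lambda>(i, j). C0 $$ (n + i, j)))" "j < dim_col (mat n m (\<lambda>(i, j). C0 $$ (n + i, j)))"
  then have ij: "i < n" "j < m" by simp_all
  have "deriv (\<lambda>y. T0_mat a n m G y $$ (i, j)) x = C0 $$ (n + i, j)"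
    unfolding T0_index[OF ij] by (rule DERIV_imp_deriv) (auto intro!: derivative_eq_intros)
  then show "mat_deriv (T0_mat a n m G) x $$ (i, j) = mat n m (\<lambda>(i, j). C0 $$ (n + i, j)) $$ (i, j)"
    using ij carrier_matD[OF T0_carrier[of x]] by (simp add: mat_deriv_def)
qed (use carrier_matD[OF T0_carrier[of x]] in \<open>simp_all add: mat_deriv_def\<close>)

lemma deriv_T1: "mat_deriv (\<lambda>y. T1_mat a n G H y \<theta>) x = mat n n (\<lambda>(i, j). (Gi * H \<theta>) $$ (n + i, j))"
proof (rule eq_matI)
  fix i j assume "i < dim_row (mat n n (\<lambda>(i, j). (Gi * H \<theta>) $$ (n + i, j)))"
    "j < dim_col (mat n n (\<lambda>(i, j). (Gi * H \<theta>) $$ (n + i, j)))"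
  then have ij: "i < n" "j < n" by simp_all
  have "deriv (\<lambda>y. T1_mat a n G H y \<theta> $$ (i, j)) x = (Gi * H \<theta>) $$ (n + i, j)"
    unfolding T1_index[OF ij] by (rule DERIV_imp_deriv) (auto intro!: derivative_eq_intros)
  then show "mat_deriv (\<lambda>y. T1_mat a n G H y \<theta>) x $$ (i, j) = mat n n (\<lambda>(i, j). (Gi * H \<theta>) $$ (n + i, j)) $$ (i, j)"
    using ij carrier_matD[OF T1_carrier[of x \<theta>]] by (simp add: mat_deriv_def del: index_mult_mat)
qed (use carrier_matD[OF T1_carrier[of x \<theta>]] in \<open>simp_all add: mat_deriv_def\<close>)

lemma bdd_affine: "bdd (\<lambda>x. x - a)"
  by (intro bdd_continuous continuous_intros)

lemma T_op_eq_W_op: "T_op a b n m G H = W_op n (T0_mat a n m G) (T1_mat a n G H) (\<lambda>x \<theta>. x - \<theta>)"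
  by (rule ext) (simp add: T_op_def W_op_def)

lemma has_adj_T_op: "has_adj (m, n) (0, n) (T_op a b n m G H)"
  unfolding T_op_eq_W_op
proof (rule has_adj_W_op)
  show "bdd2 (\<lambda>x \<theta>. x - \<theta>)" by (rule bdd2_diff_var)
  show "bdd (\<lambda>x. T0_mat a n m G x $$ (i, j))" if "i < n" "j < m" for i j
    unfolding T0_index[OF that] by (rule bdd_add[OF bdd_const bdd_mult[OF bdd_affine bdd_const]])
  show "bdd2 (\<lambda>x \<theta>. T1_mat a n G H x \<theta> $$ (i, j))" if "i < n" "j < n" for i j
    unfolding T1_index[OF that] using that
    by (intro bdd2_add[OF bdd2_snd bdd2_mult[OF bdd2_fst[OF bdd_affine] bdd2_snd]] bdd_GiH) simp_all
qed (rule T0_carrier T1_carrier)+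

text \<open>Multiplying by the scalar kernel 1 changes nothing on vectors of the right dimension,
  that is for arguments in the space and x in [a, b]; hence a transfer of the adjoint rather than an
  equation between operators.\<close>

lemma has_adj_R_op: "has_adj (m, n) (0, n) (R_op a b n m G H)"
proof -
  let ?W = "W_op n (mat_deriv (T0_mat a n m G)) (\<lambda>x \<theta>. mat_deriv (\<lambda>y. T1_mat a n G H y \<theta>) x) (\<lambda>x \<theta>. 1)"
  have W: "has_adj (m, n) (0, n) ?W"
    unfolding deriv_T0 deriv_T1
    by (rule has_adj_W_op) (simp_all add: bdd2_snd[OF bdd_GiH] del: index_mult_mat)
  have eq: "snd (R_op a b n m G H v) x = snd (?W v) x" if "v \<in> Z a b (m, n)" "x \<in> {a..b}" for v x
  proof -
    have "snd v \<in> L2 a b n" using that by (simp add: Z_iff)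
    from integral_volterra[OF this that(2), where k = "\<lambda>_. 1"]
    have "vec_integral n {a..x} (snd v) = vec_integral n {a..x} (\<lambda>\<theta>. 1 \<cdot>\<^sub>v snd v \<theta>)"
      by (intro eq_vecI) (simp_all add: vec_integral_def integral_initial_segment[OF that(2)])
    then show ?thesis by (simp add: R_op_def W_op_def of_L2_def)
  qed
  show ?thesis
  proof (rule has_adj_cong[OF W])
    fix v assume v: "v \<in> Z a b (m, n)"
    show "R_op a b n m G H v \<in> Z a b (0, n)"
      by (rule Z_cong[OF has_adj_Z[OF W v]]) (simp add: R_op_def W_op_def of_L2_def, rule eq[OF v])
    show "Z_eq a b (R_op a b n m G H v) (?W v)"
      by (rule Z_eqI) (simp add: R_op_def W_op_def of_L2_def, rule eq[OF v])
  qed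
qed

lemma has_adj_A_op:
  assumes A0: "A0 \<in> carrier_mat n n" and A1: "A1 \<in> carrier_mat n n" and A2: "A2 \<in> carrier_mat n n"
  shows "has_adj (m, n) (0, n) (A_op a b n m A0 A1 A2 G H)"
proof -
  let ?B = "(mult_op A0 \<circ> T_op a b n m G H) \<oplus>\<^sub>o (mult_op A1 \<circ> R_op a b n m G H) \<oplus>\<^sub>o mult_op A2"
  have "A_op a b n m A0 A1 A2 G H v = ?B v" for v
    by (rule prod_eqI, rule eq_vecI) (simp_all add: A_op_def op_add_def mult_op_def of_L2_def)
  then have "A_op a b n m A0 A1 A2 G H = ?B" by (rule ext)
  moreover have "has_adj (m, n) (0, n) ?B"
    by (intro has_adj_add has_adj_comp[OF has_adj_T_op] has_adj_comp[OF has_adj_R_op] has_adj_mult_op A0 A1 A2)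
  ultimately show ?thesis by simp
qed

end

section \<open>Reconstruction of a Sobolev function from its second derivative\<close>

context compact_interval
begin

text \<open>The twofold primitive as a single integral (Cauchy's formula for repeated integration);
  it is the remainder term of the first-order Taylor formula.\<close>

definition prim2 :: "(real \<Rightarrow> real) \<Rightarrow> real \<Rightarrow> real" where
  "prim2 h x = (LINT \<theta>|M. (if \<theta> \<le> x then 1 else 0) * (x - \<theta>) * h \<theta>)"

lemma bdd2_volterra: "bdd2 (\<lambda>x \<theta>. (if \<theta> \<le> x then 1 else 0) * (x - \<theta>))"
  by (rule bdd2_mult[OF bdd2_triangle bdd2_diff_var])

lemma bdd_prim2: "sq_int h \<Longrightarrow> bdd (prim2 h)"
  unfolding prim2_def by (rule bdd_kernel[OF bdd2_volterra])

text \<open>After the exchange of integrals the inner one is the length of [\<theta>, x].\<close>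

lemma prim_prim:
  assumes h: "sq_int h" and x: "x \<in> {a..b}"
  shows "prim (prim h) x = prim2 h x"
proof -
  have t: "sq_int (\<lambda>s. if s \<le> x then 1 else 0)"
    by (rule bdd_sq_int[OF bdd2_slice[OF bdd2_triangle x]])
  have "prim (prim h) x = (LINT s|M. (if s \<le> x then 1 else 0) * (LINT \<theta>|M. (if \<theta> \<le> s then 1 else 0) * h \<theta>))"
    unfolding prim_eq[OF x] by (intro Bochner_Integration.integral_cong refl) (simp add: prim_eq)
  also have "\<dots> = (LINT \<theta>|M. (LINT s|M. (if \<theta> \<le> s then 1 else 0) * (if s \<le> x then 1 else 0)) * h \<theta>)"
    by (rule kernel_Fubini[OF bdd2_triangle h t])
  also have "\<dots> = prim2 h x"
    unfolding prim2_def
  proof (intro Bochner_Integration.integral_cong refl arg_cong2[where f = "(*)"])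
    fix \<theta> assume "\<theta> \<in> space M"
    then have \<theta>: "\<theta> \<in> {a..b}" by simp
    show "(LINT s|M. (if \<theta> \<le> s then 1 else 0) * (if s \<le> x then 1 else 0)) = (if \<theta> \<le> x then 1 else 0) * (x - \<theta>)"
    proof (cases "\<theta> \<le> x")
      case True
      have "(LINT s|M. (if \<theta> \<le> s then 1 else 0) * (if s \<le> x then 1 else 0)) = (LINT s|M. indicator {\<theta>..x} s * (1::real))"
        by (intro Bochner_Integration.integral_cong refl) (simp add: indicator_def)
      also have "\<dots> = x - \<theta>"
        using x \<theta> True by (intro integral_M_deriv[where F = "\<lambda>x. x"]) auto
      finally show ?thesis using True by simp
    next
      case False
      then have "(LINT s|M. (if \<theta> \<le> s then 1 else 0) * (if s \<le> x then 1 else 0)) = (LINT s|M. (0::real))"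
        by (intro Bochner_Integration.integral_cong refl) simp
      with False show ?thesis by simp
    qed
  qed
  finally show ?thesis .
qed

lemma continuous_on_prim2: "sq_int h \<Longrightarrow> continuous_on {a..b} (prim2 h)"
  by (rule continuous_on_eq[OF continuous_on_prim[OF bdd_sq_int[OF bdd_prim]] prim_prim])

lemma prim_cong_AE:
  assumes "AE x in M. f x = g x" "sq_int f" "sq_int g" "x \<in> {a..b}"
  shows "prim f x = prim g x"
  unfolding prim_eq[OF assms(4)]
proof (rule integral_cong_AE)
  note t = bdd2_slice[OF bdd2_triangle assms(4)]
  show "(\<lambda>\<theta>. (if \<theta> \<le> x then 1 else 0) * f \<theta>) \<in> borel_measurable M"
    "(\<lambda>\<theta>. (if \<theta> \<le> x then 1 else 0) * g \<theta>) \<in> borel_measurable M"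
    by (intro sq_int_measurable sq_int_bdd_mult t assms)+
  show "AE \<theta> in M. (if \<theta> \<le> x then 1 else 0) * f \<theta> = (if \<theta> \<le> x then 1 else 0) * g \<theta>"
    using assms(1) by eventually_elim simp
qed

lemma prim_const_add:
  assumes "sq_int h" "x \<in> {a..b}"
  shows "prim (\<lambda>y. c + h y) x = c * (x - a) + prim h x"
proof -
  note t = bdd2_slice[OF bdd2_triangle assms(2)]
  have "(LINT \<theta>|M. (if \<theta> \<le> x then 1 else 0) * c) = (LINT \<theta>|M. indicator {a..x} \<theta> * c)"
    by (intro Bochner_Integration.integral_cong refl) (auto simp: indicator_def)
  also have "\<dots> = c * x - c * a"
    using assms(2) by (intro integral_M_deriv[where F = "\<lambda>x. c * x"]) (auto intro!: derivative_eq_intros)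
  finally have "(LINT \<theta>|M. (if \<theta> \<le> x then 1 else 0) * c) = c * (x - a)" by (simp add: algebra_simps)
  moreover have "(LINT \<theta>|M. (if \<theta> \<le> x then 1 else 0) * (c + h \<theta>))
      = (LINT \<theta>|M. (if \<theta> \<le> x then 1 else 0) * c) + (LINT \<theta>|M. (if \<theta> \<le> x then 1 else 0) * h \<theta>)"
    unfolding distrib_left by (intro Bochner_Integration.integral_add bdd_integrable_mult[OF t] sq_int_const assms)
  ultimately show ?thesis using assms(2) by (simp only: prim_eq)
qed

text \<open>Taylor's formula with integral remainder, by passing to primitives twice. Both
  primitives vanish at a, so \<open>c0\<close> and \<open>c1\<close> are the values there of the
  continuous representatives of f and g.\<close>

lemma weak_deriv2_representation:
  assumes f: "sq_int f" and g: "sq_int g" and h: "sq_int h" and fg: "weak_deriv f g" and gh: "weak_deriv g h"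
  shows "\<exists>c0 c1. (AE x in M. f x = c0 + (x - a) * c1 + prim2 h x) \<and> (AE x in M. g x = c1 + prim h x)"
proof -
  obtain c1 where c1: "AE x in M. g x = c1 + prim h x"
    using weak_deriv_imp_prim[OF g h gh] by blast
  obtain c0 where c0: "AE x in M. f x = c0 + prim g x"
    using weak_deriv_imp_prim[OF f g fg] by blast
  have ph: "sq_int (prim h)" by (rule bdd_sq_int[OF bdd_prim[OF h]])
  have pg: "prim g x = (x - a) * c1 + prim2 h x" if x: "x \<in> {a..b}" for x
    using prim_cong_AE[OF c1 g sq_int_add[OF sq_int_const ph] x] prim_const_add[OF ph x, of c1] prim_prim[OF h x]
    by simp
  have "AE x in M. f x = c0 + (x - a) * c1 + prim2 h x"
    using c0 AE_space[of M] by eventually_elim (simp add: pg)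
  with c1 show ?thesis by blast
qed

section \<open>The chosen weak derivatives and continuous representatives\<close>

lemma wderiv_works:
  assumes "g \<in> L2 a b n" "is_weak_deriv a b n u g"
  shows "wderiv a b n u \<in> L2 a b n \<and> is_weak_deriv a b n u (wderiv a b n u)"
  unfolding wderiv_def by (rule someI[of "\<lambda>g. g \<in> L2 a b n \<and> is_weak_deriv a b n u g"]) (use assms in simp)

lemma W22_wderiv:
  assumes "u \<in> W22 a b n"
  shows "u \<in> L2 a b n" "wderiv a b n u \<in> L2 a b n" "wderiv a b n (wderiv a b n u) \<in> L2 a b n"
    "is_weak_deriv a b n u (wderiv a b n u)"
    "is_weak_deriv a b n (wderiv a b n u) (wderiv a b n (wderiv a b n u))"
proof -
  from assms obtain g h where u: "u \<in> L2 a b n" and g: "g \<in> L2 a b n" and h: "h \<in> L2 a b n"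
    and ug: "is_weak_deriv a b n u g" and gh: "is_weak_deriv a b n g h"
    unfolding W22_def by blast
  let ?p = "wderiv a b n u"
  show "u \<in> L2 a b n" by (rule u)
  note p = wderiv_works[OF g ug]
  show "?p \<in> L2 a b n" "is_weak_deriv a b n u ?p" using p by simp_all
  have "weak_deriv (\<lambda>x. ?p x $ i) (\<lambda>x. h x $ i)" if i: "i < n" for i
  proof (rule weak_deriv_cong_AE[where f = "\<lambda>x. g x $ i"])
    have "weak_deriv (\<lambda>x. u x $ i) (\<lambda>x. g x $ i)" "weak_deriv (\<lambda>x. u x $ i) (\<lambda>x. ?p x $ i)"
      using ug p i by (simp_all add: is_weak_deriv_iff)
    from weak_deriv_unique[OF this L2_sq_int[OF u i] L2_sq_int[OF g i] L2_sq_int[OF conjunct1[OF p] i]]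
    show "AE x in M. g x $ i = ?p x $ i" .
    show "weak_deriv (\<lambda>x. g x $ i) (\<lambda>x. h x $ i)" using gh i by (simp add: is_weak_deriv_iff)
  qed (rule L2_sq_int[OF g i] L2_sq_int[OF conjunct1[OF p] i])+
  then have "is_weak_deriv a b n ?p h" by (simp add: is_weak_deriv_iff)
  from wderiv_works[OF h this]
  show "wderiv a b n ?p \<in> L2 a b n" "is_weak_deriv a b n ?p (wderiv a b n ?p)" by simp_all
qed

text \<open>Two continuous representatives agree at every point of [a, b], so the chosen one may be
  replaced by an explicit one.\<close>

lemma cont_rep_eq:
  assumes c: "\<And>x. x \<in> {a..b} \<Longrightarrow> c x \<in> carrier_vec n" "\<And>i. i < n \<Longrightarrow> continuous_on {a..b} (\<lambda>x. c x $ i)"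
    and eq: "L2_eq a b u c" and x: "x \<in> {a..b}"
  shows "cont_rep a b n u x = c x"
proof -
  let ?P = "\<lambda>c. (\<forall>x\<in>{a..b}. c x \<in> carrier_vec n) \<and>
     (\<forall>i<n. continuous_on {a..b} (\<lambda>x. c x $ i)) \<and> L2_eq a b u c"
  have "?P (cont_rep a b n u)"
    unfolding cont_rep_def by (rule someI[of ?P c]) (use c eq in simp)
  then have d: "\<forall>x\<in>{a..b}. cont_rep a b n u x \<in> carrier_vec n"
    "\<forall>i<n. continuous_on {a..b} (\<lambda>x. cont_rep a b n u x $ i)" "AE x in M. u x = cont_rep a b n u x"
    unfolding L2_eq_def by blast+
  have AE: "AE x in M. cont_rep a b n u x = c x"
    using d(3) eq[unfolded L2_eq_def] by eventually_elim simp
  show ?thesis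
  proof (rule eq_vecI)
    fix i assume "i < dim_vec (c x)"
    then have i: "i < n" using c(1)[OF x] by simp
    show "cont_rep a b n u x $ i = c x $ i"
      by (rule continuous_AE_eq[OF _ c(2)[OF i] _ x]) (use d(2) i AE in \<open>auto elim!: eventually_mono\<close>)
  qed (use c(1)[OF x] d(1) x in simp)
qed

lemma W22_representation:
  assumes u: "u \<in> W22 a b n"
  defines "p \<equiv> wderiv a b n u" and "h \<equiv> wderiv a b n (wderiv a b n u)"
  obtains c0 c1 where
    "L2_eq a b u (\<lambda>x. vec n (\<lambda>i. c0 i + (x - a) * c1 i + prim2 (\<lambda>x. h x $ i) x))"
    "L2_eq a b p (\<lambda>x. vec n (\<lambda>i. c1 i + prim (\<lambda>x. h x $ i) x))"
    "\<forall>x\<in>{a..b}. cont_rep a b n u x = vec n (\<lambda>i. c0 i + (x - a) * c1 i + prim2 (\<lambda>x. h x $ i) x)"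
    "\<forall>x\<in>{a..b}. cont_rep a b n p x = vec n (\<lambda>i. c1 i + prim (\<lambda>x. h x $ i) x)"
proof -
  note W = W22_wderiv[OF u, folded h_def, folded p_def]
  have "\<forall>i<n. \<exists>c0 c1. (AE x in M. u x $ i = c0 + (x - a) * c1 + prim2 (\<lambda>x. h x $ i) x) \<and>
      (AE x in M. p x $ i = c1 + prim (\<lambda>x. h x $ i) x)"
  proof (intro allI impI)
    fix i assume i: "i < n"
    show "\<exists>c0 c1. (AE x in M. u x $ i = c0 + (x - a) * c1 + prim2 (\<lambda>x. h x $ i) x) \<and>
      (AE x in M. p x $ i = c1 + prim (\<lambda>x. h x $ i) x)"
      by (rule weak_deriv2_representation[OF W(1-3)[THEN L2_sq_int, OF i]])
        (use W(4,5) i in \<open>simp_all add: is_weak_deriv_iff\<close>)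
  qed
  then obtain c0 c1 where c: "\<forall>i<n. (AE x in M. u x $ i = c0 i + (x - a) * c1 i + prim2 (\<lambda>x. h x $ i) x) \<and>
      (AE x in M. p x $ i = c1 i + prim (\<lambda>x. h x $ i) x)"
    unfolding choice_iff' by blast
  have c0: "\<And>i. i < n \<Longrightarrow> AE x in M. u x $ i = c0 i + (x - a) * c1 i + prim2 (\<lambda>x. h x $ i) x"
    and c1: "\<And>i. i < n \<Longrightarrow> AE x in M. p x $ i = c1 i + prim (\<lambda>x. h x $ i) x"
    using c by simp_all
  have vecI: "L2_eq a b f (\<lambda>x. vec n (g x))" if "f \<in> L2 a b n" "\<And>i. i < n \<Longrightarrow> AE x in M. f x $ i = g x i" for f g
  proof -
    have "AE x in M. \<forall>i\<in>{..<n}. f x $ i = g x i"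
      using that(2) by (subst AE_finite_all) simp_all
    then show ?thesis
      unfolding L2_eq_def using AE_space[of M]
      by eventually_elim (use L2_dim[OF that(1)] in \<open>auto intro!: eq_vecI\<close>)
  qed
  have hi: "sq_int (\<lambda>x. h x $ i)" if "i < n" for i by (rule L2_sq_int[OF W(3) that])
  note eqs = vecI[OF W(1) c0] vecI[OF W(2) c1]
  show ?thesis
  proof (rule that[OF eqs])
    show "\<forall>x\<in>{a..b}. cont_rep a b n u x = vec n (\<lambda>i. c0 i + (x - a) * c1 i + prim2 (\<lambda>x. h x $ i) x)"
      by (intro ballI cont_rep_eq[OF _ _ eqs(1)])
        (simp_all, intro continuous_intros continuous_on_prim2 hi)
    show "\<forall>x\<in>{a..b}. cont_rep a b n p x = vec n (\<lambda>i. c1 i + prim (\<lambda>x. h x $ i) x)"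
      by (intro ballI cont_rep_eq[OF _ _ eqs(2)]) (simp_all, intro continuous_intros continuous_on_prim hi)
  qed simp_all
qed

section \<open>The boundary form of a single component\<close>

lemma integral_terminal_segment:
  fixes g :: "real \<Rightarrow> real"
  assumes "x \<in> {a..b}"
  shows "(LINT \<theta>|lebesgue_on {x..b}. g \<theta>) = (LINT \<theta>|M. (if x \<le> \<theta> then 1 else 0) * g \<theta>)"
  unfolding integral_M using assms
  by (subst integral_restrict_space) (auto intro!: Bochner_Integration.integral_cong simp: indicator_def)

text \<open>This is the kernel of the twofold primitive with x and \<theta> exchanged. Such
  integrals make up the part of H that comes from F.\<close>

lemma bdd_terminal_moment:
  assumes \<phi>: "sq_int \<phi>"
  shows "bdd (\<lambda>x. LINT \<theta>|lebesgue_on {x..b}. (\<theta> - x) * \<phi> \<theta>)"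
proof (rule bdd_cong[OF bdd_kernel[OF bdd2_swap[OF bdd2_volterra] \<phi>]])
  fix x assume x: "x \<in> {a..b}"
  show "(LINT \<theta>|M. (if x \<le> \<theta> then 1 else 0) * (\<theta> - x) * \<phi> \<theta>) = (LINT \<theta>|lebesgue_on {x..b}. (\<theta> - x) * \<phi> \<theta>)"
    unfolding integral_terminal_segment[OF x] by (simp only: mult.assoc)
qed

text \<open>One row of the boundary condition for one component: \<open>e1\<close> to
  \<open>e4\<close> multiply u(a), u(b), u_x(a), u_x(b), and \<phi> is the entry of F. With Taylor's
  formula inserted, the terms in \<open>c0\<close> and \<open>c1\<close> form the entries of G and
  the terms in h form the entry of H with a minus sign.\<close>

lemma boundary_form_scalar:
  assumes \<phi>: "bdd \<phi>" and h: "sq_int h"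
  shows "e1 * c0 + e2 * (c0 + (b - a) * c1 + prim2 h b) + e3 * c1 + e4 * (c1 + prim h b)
      + (LINT x|M. \<phi> x * (c0 + (x - a) * c1 + prim2 h x))
    = (e1 + e2 + (LINT x|M. \<phi> x)) * c0 + ((b - a) * e2 + e3 + e4 + (LINT x|M. (x - a) * \<phi> x)) * c1
      - (LINT x|M. (- ((b - x) * e2 + e4) - (LINT \<theta>|lebesgue_on {x..b}. (\<theta> - x) * \<phi> \<theta>)) * h x)"
proof -
  define \<mu> where "\<mu> x = (LINT \<theta>|lebesgue_on {x..b}. (\<theta> - x) * \<phi> \<theta>)" for x
  have \<phi>s: "sq_int \<phi>" by (rule bdd_sq_int[OF \<phi>])
  have xa: "bdd (\<lambda>x. x - a)" and bx: "bdd (\<lambda>x. b - x)" by (intro bdd_continuous continuous_intros)+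
  have \<mu>: "bdd \<mu>" unfolding \<mu>_def by (rule bdd_terminal_moment[OF \<phi>s])
  have bin: "b \<in> {a..b}" using ab by simp
  have p2b: "prim2 h b = (LINT x|M. (b - x) * h x)"
    unfolding prim2_def by (intro Bochner_Integration.integral_cong refl) simp
  have pb: "prim h b = (LINT x|M. h x)"
    unfolding prim_eq[OF bin] by (intro Bochner_Integration.integral_cong refl) simp
  \<comment> \<open>Exchanging the integrals replaces the remainder by h and \<phi> by its first
    moment over [x, b].\<close>
  have Fub: "(LINT x|M. \<phi> x * prim2 h x) = (LINT x|M. \<mu> x * h x)"
  proof -
    have "(LINT x|M. \<phi> x * prim2 h x) = (LINT \<theta>|M. (LINT x|M. (if \<theta> \<le> x then 1 else 0) * (x - \<theta>) * \<phi> x) * h \<theta>)"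
      unfolding prim2_def by (rule kernel_Fubini[OF bdd2_volterra h \<phi>s])
    also have "\<dots> = (LINT x|M. \<mu> x * h x)"
    proof (intro Bochner_Integration.integral_cong refl)
      fix \<theta> assume "\<theta> \<in> space M"
      then have "\<theta> \<in> {a..b}" by simp
      from integral_terminal_segment[OF this, of "\<lambda>x. (x - \<theta>) * \<phi> x"]
      show "(LINT x|M. (if \<theta> \<le> x then 1 else 0) * (x - \<theta>) * \<phi> x) * h \<theta> = \<mu> \<theta> * h \<theta>"
        unfolding \<mu>_def by (simp only: mult.assoc)
    qed
    finally show ?thesis .
  qed
  have i1: "integrable M \<phi>" by (rule sq_int_integrable[OF \<phi>s])
  have i2: "integrable M (\<lambda>x. (x - a) * \<phi> x)" by (rule bdd_integrable_mult[OF xa \<phi>s])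
  have i3: "integrable M (\<lambda>x. \<phi> x * prim2 h x)" by (rule bdd_integrable_mult[OF \<phi> bdd_sq_int[OF bdd_prim2[OF h]]])
  have i4: "integrable M (\<lambda>x. (b - x) * h x)" by (rule bdd_integrable_mult[OF bx h])
  have i5: "integrable M h" by (rule sq_int_integrable[OF h])
  have i6: "integrable M (\<lambda>x. \<mu> x * h x)" by (rule bdd_integrable_mult[OF \<mu> h])
  have "(LINT x|M. \<phi> x * (c0 + (x - a) * c1 + prim2 h x))
      = (LINT x|M. c0 * \<phi> x + c1 * ((x - a) * \<phi> x) + \<phi> x * prim2 h x)"
    by (intro Bochner_Integration.integral_cong refl) (simp add: algebra_simps)
  also have "\<dots> = (LINT x|M. c0 * \<phi> x + c1 * ((x - a) * \<phi> x)) + (LINT x|M. \<phi> x * prim2 h x)"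
    by (rule Bochner_Integration.integral_add[OF Bochner_Integration.integrable_add[OF
            integrable_mult_right[OF i1] integrable_mult_right[OF i2]] i3])
  also have "(LINT x|M. c0 * \<phi> x + c1 * ((x - a) * \<phi> x)) = (LINT x|M. c0 * \<phi> x) + (LINT x|M. c1 * ((x - a) * \<phi> x))"
    by (rule Bochner_Integration.integral_add[OF integrable_mult_right[OF i1] integrable_mult_right[OF i2]])
  finally have 1: "(LINT x|M. \<phi> x * (c0 + (x - a) * c1 + prim2 h x))
      = c0 * (LINT x|M. \<phi> x) + c1 * (LINT x|M. (x - a) * \<phi> x) + (LINT x|M. \<mu> x * h x)"
    unfolding Fub integral_mult_right_zero .
  have "(LINT x|M. (- ((b - x) * e2 + e4) - \<mu> x) * h x)
      = (LINT x|M. (- e2) * ((b - x) * h x) + (- e4) * h x - \<mu> x * h x)"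
    by (intro Bochner_Integration.integral_cong refl) (simp add: algebra_simps)
  also have "\<dots> = (LINT x|M. (- e2) * ((b - x) * h x) + (- e4) * h x) - (LINT x|M. \<mu> x * h x)"
    by (rule Bochner_Integration.integral_diff[OF Bochner_Integration.integrable_add[OF
            integrable_mult_right[OF i4] integrable_mult_right[OF i5]] i6])
  also have "(LINT x|M. (- e2) * ((b - x) * h x) + (- e4) * h x) = (LINT x|M. (- e2) * ((b - x) * h x)) + (LINT x|M. (- e4) * h x)"
    by (rule Bochner_Integration.integral_add[OF integrable_mult_right[OF i4] integrable_mult_right[OF i5]])
  finally have 2: "(LINT x|M. (- ((b - x) * e2 + e4) - \<mu> x) * h x)
      = (- e2) * (LINT x|M. (b - x) * h x) + (- e4) * (LINT x|M. h x) - (LINT x|M. \<mu> x * h x)"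
    unfolding integral_mult_right_zero .
  \<comment> \<open>With the integrals named, what remains is a polynomial identity.\<close>
  define I1 I2 I3 I4 I5 where "I1 = (LINT x|M. \<phi> x)" and "I2 = (LINT x|M. (x - a) * \<phi> x)"
    and "I3 = (LINT x|M. \<mu> x * h x)" and "I4 = (LINT x|M. (b - x) * h x)" and "I5 = (LINT x|M. h x)"
  note defs = I1_def[symmetric] I2_def[symmetric] I3_def[symmetric] I4_def[symmetric] I5_def[symmetric]
  show ?thesis
    unfolding \<mu>_def[symmetric] 1 2 p2b pb unfolding defs by (simp add: algebra_simps)
qed

end

section \<open>T and R evaluated on a state\<close>

context evolution_operators
begin

text \<open>The integral of H h, the inhomogeneity through which the second derivative enters the
  linear system for (u(a), u_x(a)).\<close>

definition H_moment where
  "H_moment h = vec (2 * n) (\<lambda>i. \<Sum>j<n. LINT \<theta>|M. H \<theta> $$ (i, j) * h \<theta> $ j)"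

lemma H_moment_carrier [simp]: "H_moment h \<in> carrier_vec (2 * n)"
  by (simp add: H_moment_def)

lemma Gi_H_moment:
  assumes h: "h \<in> L2 a b n" and r: "r < 2 * n"
  shows "(\<Sum>j<n. LINT \<theta>|M. (Gi * H \<theta>) $$ (r, j) * h \<theta> $ j) = (Gi *\<^sub>v H_moment h) $ r"
proof -
  have "(LINT \<theta>|M. (Gi * H \<theta>) $$ (r, j) * h \<theta> $ j) = (\<Sum>k<2 * n. Gi $$ (r, k) * (LINT \<theta>|M. H \<theta> $$ (k, j) * h \<theta> $ j))"
    if j: "j < n" for j
  proof -
    have "(Gi * H \<theta>) $$ (r, j) * h \<theta> $ j = (\<Sum>k<2 * n. Gi $$ (r, k) * (H \<theta> $$ (k, j) * h \<theta> $ j))" for \<theta>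
      using r j carrier_matD[OF Gi] carrier_matD[OF H[of \<theta>]]
      by (simp add: scalar_prod_def atLeast0LessThan sum_distrib_right mult.assoc)
    then have "(LINT \<theta>|M. (Gi * H \<theta>) $$ (r, j) * h \<theta> $ j)
        = (LINT \<theta>|M. (\<Sum>k<2 * n. Gi $$ (r, k) * (H \<theta> $$ (k, j) * h \<theta> $ j)))"
      by (simp only:)
    also have "\<dots> = (\<Sum>k<2 * n. LINT \<theta>|M. Gi $$ (r, k) * (H \<theta> $$ (k, j) * h \<theta> $ j))"
    proof (rule Bochner_Integration.integral_sum)
      fix k assume "k \<in> {..<2 * n}"
      then have "bdd (\<lambda>\<theta>. H \<theta> $$ (k, j))" using Hb j by simp
      then show "integrable M (\<lambda>\<theta>. Gi $$ (r, k) * (H \<theta> $$ (k, j) * h \<theta> $ j))"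
        by (rule sq_int_integrable[OF sq_int_cmult[OF sq_int_bdd_mult[OF _ L2_sq_int[OF h j]]]])
    qed
    finally show ?thesis by (simp only: integral_mult_right_zero)
  qed
  then have "(\<Sum>j<n. LINT \<theta>|M. (Gi * H \<theta>) $$ (r, j) * h \<theta> $ j)
      = (\<Sum>j<n. \<Sum>k<2 * n. Gi $$ (r, k) * (LINT \<theta>|M. H \<theta> $$ (k, j) * h \<theta> $ j))"
    by simp
  also have "\<dots> = (\<Sum>k<2 * n. \<Sum>j<n. Gi $$ (r, k) * (LINT \<theta>|M. H \<theta> $$ (k, j) * h \<theta> $ j))"
    by (rule sum.swap)
  also have "\<dots> = (\<Sum>k<2 * n. Gi $$ (r, k) * H_moment h $ k)"
    by (simp add: H_moment_def sum_distrib_left)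
  also have "\<dots> = (Gi *\<^sub>v H_moment h) $ r"
    by (rule mult_mat_vec_index[OF Gi H_moment_carrier r, symmetric])
  finally show ?thesis .
qed

text \<open>Here c is the value of (u(a), u_x(a)) obtained by solving the completed boundary
  conditions; T and R return the Taylor expansions of u and u_x with these data.\<close>

lemma T_R_state:
  assumes h: "h \<in> L2 a b n" and v0: "v0 \<in> carrier_vec m"
    and c: "c = C0 *\<^sub>v v0 + Gi *\<^sub>v H_moment h" and x: "x \<in> {a..b}"
  shows "snd (T_op a b n m G H (v0, h)) x = vec n (\<lambda>i. c $ i + (x - a) * c $ (n + i) + prim2 (\<lambda>x. h x $ i) x)"
    and "snd (R_op a b n m G H (v0, h)) x = vec n (\<lambda>i. c $ (n + i) + prim (\<lambda>x. h x $ i) x)"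
proof -
  have C0v: "C0 *\<^sub>v v0 \<in> carrier_vec (2 * n)" by (rule mult_mat_vec_carrier[OF C0 v0])
  have Gw: "Gi *\<^sub>v H_moment h \<in> carrier_vec (2 * n)" by (rule mult_mat_vec_carrier[OF Gi H_moment_carrier])
  have ci: "c $ r = (C0 *\<^sub>v v0) $ r + (Gi *\<^sub>v H_moment h) $ r" if "r < 2 * n" for r
    unfolding c using that carrier_vecD[OF C0v] carrier_vecD[OF Gw] by (simp del: index_mult_mat_vec)
  have bi: "bdd (\<lambda>\<theta>. (Gi * H \<theta>) $$ (r, j))" if "r < 2 * n" "j < n" for r j
    by (rule bdd_GiH[OF that])
  have int: "integrable M (\<lambda>\<theta>. (Gi * H \<theta>) $$ (r, j) * h \<theta> $ j)" if "r < 2 * n" "j < n" for r j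
    by (rule bdd_integrable_mult[OF bi[OF that] L2_sq_int[OF h that(2)]])
  show "snd (T_op a b n m G H (v0, h)) x = vec n (\<lambda>i. c $ i + (x - a) * c $ (n + i) + prim2 (\<lambda>x. h x $ i) x)"
  proof (rule eq_vecI)
    fix i assume "i < dim_vec (vec n (\<lambda>i. c $ i + (x - a) * c $ (n + i) + prim2 (\<lambda>x. h x $ i) x))"
    then have i: "i < n" by simp
    then have i2: "i < 2 * n" "n + i < 2 * n" by simp_all
    have 1: "(T0_mat a n m G x *\<^sub>v v0) $ i = (C0 *\<^sub>v v0) $ i + (x - a) * (C0 *\<^sub>v v0) $ (n + i)"
      unfolding T0_mat_eq assoc_mult_mat_vec[OF affine_mat_carrier C0 v0] by (rule affine_mat_mult_vec[OF C0v i])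
    have "(LINT \<theta>|M. (T1_mat a n G H x \<theta> *\<^sub>v h \<theta>) $ i) = (\<Sum>j<n. LINT \<theta>|M. T1_mat a n G H x \<theta> $$ (i, j) * h \<theta> $ j)"
    proof (rule integral_mult_mat_vec_1[OF T1_carrier _ h i])
      fix j assume j: "j < n"
      show "bdd (\<lambda>\<theta>. T1_mat a n G H x \<theta> $$ (i, j))"
        unfolding T1_index[OF i j] by (rule bdd_add[OF bi[OF i2(1) j] bdd_mult[OF bdd_const bi[OF i2(2) j]]])
    qed
    also have "\<dots> = (\<Sum>j<n. (LINT \<theta>|M. (Gi * H \<theta>) $$ (i, j) * h \<theta> $ j) + (x - a) * (LINT \<theta>|M. (Gi * H \<theta>) $$ (n + i, j) * h \<theta> $ j))"
    proof (rule sum.cong[OF refl])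
      fix j assume "j \<in> {..<n}"
      then have j: "j < n" by simp
      have "(LINT \<theta>|M. T1_mat a n G H x \<theta> $$ (i, j) * h \<theta> $ j)
          = (LINT \<theta>|M. (Gi * H \<theta>) $$ (i, j) * h \<theta> $ j + (x - a) * ((Gi * H \<theta>) $$ (n + i, j) * h \<theta> $ j))"
        unfolding T1_index[OF i j] by (simp only: distrib_right mult.assoc)
      also have "\<dots> = (LINT \<theta>|M. (Gi * H \<theta>) $$ (i, j) * h \<theta> $ j) + (LINT \<theta>|M. (x - a) * ((Gi * H \<theta>) $$ (n + i, j) * h \<theta> $ j))"
        by (rule Bochner_Integration.integral_add[OF int[OF i2(1) j] integrable_mult_right[OF int[OF i2(2) j]]])
      finally show "(LINT \<theta>|M. T1_mat a n G H x \<theta> $$ (i, j) * h \<theta> $ j)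
          = (LINT \<theta>|M. (Gi * H \<theta>) $$ (i, j) * h \<theta> $ j) + (x - a) * (LINT \<theta>|M. (Gi * H \<theta>) $$ (n + i, j) * h \<theta> $ j)"
        by (simp only: integral_mult_right_zero)
    qed
    also have "\<dots> = (Gi *\<^sub>v H_moment h) $ i + (x - a) * (Gi *\<^sub>v H_moment h) $ (n + i)"
      unfolding sum.distrib sum_distrib_left[symmetric] by (simp only: Gi_H_moment[OF h i2(1)] Gi_H_moment[OF h i2(2)])
    finally have 2: "(LINT \<theta>|M. (T1_mat a n G H x \<theta> *\<^sub>v h \<theta>) $ i)
        = (Gi *\<^sub>v H_moment h) $ i + (x - a) * (Gi *\<^sub>v H_moment h) $ (n + i)" .
    have "snd (T_op a b n m G H (v0, h)) x $ i = (T0_mat a n m G x *\<^sub>v v0) $ i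
        + (LINT \<theta>|M. (T1_mat a n G H x \<theta> *\<^sub>v h \<theta>) $ i) + (LINT \<theta>|lebesgue_on {a..x}. ((x - \<theta>) \<cdot>\<^sub>v h \<theta>) $ i)"
      using i carrier_matD[OF T0_carrier[of x]]
      by (simp add: T_op_def of_L2_def vec_integral_def del: index_mult_mat_vec index_smult_vec)
    also have "\<dots> = c $ i + (x - a) * c $ (n + i) + prim2 (\<lambda>x. h x $ i) x"
      unfolding 1 2 integral_volterra[OF h x i] prim2_def ci[OF i2(1)] ci[OF i2(2)] by (simp add: distrib_left)
    finally show "snd (T_op a b n m G H (v0, h)) x $ i
        = vec n (\<lambda>i. c $ i + (x - a) * c $ (n + i) + prim2 (\<lambda>x. h x $ i) x) $ i" using i by simp
  qed (use carrier_matD[OF T0_carrier[of x]] in \<open>simp add: T_op_def of_L2_def vec_integral_def\<close>)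
  show "snd (R_op a b n m G H (v0, h)) x = vec n (\<lambda>i. c $ (n + i) + prim (\<lambda>x. h x $ i) x)"
  proof (rule eq_vecI)
    fix i assume "i < dim_vec (vec n (\<lambda>i. c $ (n + i) + prim (\<lambda>x. h x $ i) x))"
    then have i: "i < n" by simp
    then have i2: "n + i < 2 * n" by simp
    have 1: "(mat n m (\<lambda>(i, j). C0 $$ (n + i, j)) *\<^sub>v v0) $ i = (C0 *\<^sub>v v0) $ (n + i)"
      by (subst mult_mat_vec_index[OF mat_carrier v0 i], subst mult_mat_vec_index[OF C0 v0 i2]) (use i in simp)
    have 2: "(LINT \<theta>|M. (mat n n (\<lambda>(i, j). (Gi * H \<theta>) $$ (n + i, j)) *\<^sub>v h \<theta>) $ i) = (Gi *\<^sub>v H_moment h) $ (n + i)"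
    proof (subst integral_mult_mat_vec_1[OF mat_carrier _ h i])
      have e: "mat n n (\<lambda>(i, j). (Gi * H \<theta>) $$ (n + i, j)) $$ (i, j) = (Gi * H \<theta>) $$ (n + i, j)" if "j < n" for j \<theta>
        using i that by (simp del: index_mult_mat)
      show "bdd (\<lambda>\<theta>. mat n n (\<lambda>(i, j). (Gi * H \<theta>) $$ (n + i, j)) $$ (i, j))" if "j < n" for j
        unfolding e[OF that] by (rule bi[OF i2 that])
      show "(\<Sum>j<n. LINT \<theta>|M. mat n n (\<lambda>(i, j). (Gi * H \<theta>) $$ (n + i, j)) $$ (i, j) * h \<theta> $ j)
          = (Gi *\<^sub>v H_moment h) $ (n + i)"
        unfolding Gi_H_moment[OF h i2, symmetric] by (rule sum.cong[OF refl]) (simp only: e lessThan_iff)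
    qed
    have "snd (R_op a b n m G H (v0, h)) x $ i = (mat n m (\<lambda>(i, j). C0 $$ (n + i, j)) *\<^sub>v v0) $ i
        + (LINT \<theta>|M. (mat n n (\<lambda>(i, j). (Gi * H \<theta>) $$ (n + i, j)) *\<^sub>v h \<theta>) $ i) + (LINT \<theta>|lebesgue_on {a..x}. h \<theta> $ i)"
      using i unfolding R_op_def deriv_T0 deriv_T1
      by (simp add: of_L2_def vec_integral_def del: index_mult_mat_vec index_mult_mat)
    also have "\<dots> = c $ (n + i) + prim (\<lambda>x. h x $ i) x"
      unfolding 1 2 ci[OF i2] prim_def ..
    finally show "snd (R_op a b n m G H (v0, h)) x $ i = vec n (\<lambda>i. c $ (n + i) + prim (\<lambda>x. h x $ i) x) $ i"
      using i by simp
  qed (simp add: R_op_def deriv_T0 of_L2_def vec_integral_def)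
qed

end

section \<open>The boundary conditions in terms of u(a), u_x(a) and u_xx\<close>

context compact_interval
begin

lemma integrable_mult_mat_vec:
  assumes K: "\<And>\<theta>. \<theta> \<in> {a..b} \<Longrightarrow> K \<theta> \<in> carrier_mat k q"
    and bd: "\<And>j. j < q \<Longrightarrow> bdd (\<lambda>\<theta>. K \<theta> $$ (i, j))"
    and v: "v \<in> L2 a b q" and i: "i < k"
  shows "integrable M (\<lambda>\<theta>. (K \<theta> *\<^sub>v v \<theta>) $ i)"
proof -
  have "sq_int (\<lambda>\<theta>. \<Sum>j<q. K \<theta> $$ (i, j) * v \<theta> $ j)"
    by (intro sq_int_sum sq_int_bdd_mult bd L2_sq_int[OF v]) simp_all
  then have "sq_int (\<lambda>\<theta>. (K \<theta> *\<^sub>v v \<theta>) $ i)"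
    by (rule sq_int_cong) (simp only: mult_mat_vec_index[OF K L2_carrier[OF v] i])
  then show ?thesis by (rule sq_int_integrable)
qed

lemma integral_mult_mat_vec_cong_AE:
  assumes K: "\<And>\<theta>. \<theta> \<in> {a..b} \<Longrightarrow> K \<theta> \<in> carrier_mat k q"
    and bd: "\<And>j. j < q \<Longrightarrow> bdd (\<lambda>\<theta>. K \<theta> $$ (i, j))"
    and v: "v \<in> L2 a b q" and w: "w \<in> L2 a b q" and eq: "L2_eq a b v w" and i: "i < k"
  shows "(LINT \<theta>|M. (K \<theta> *\<^sub>v v \<theta>) $ i) = (LINT \<theta>|M. (K \<theta> *\<^sub>v w \<theta>) $ i)"
proof (rule integral_cong_AE)
  show "(\<lambda>\<theta>. (K \<theta> *\<^sub>v v \<theta>) $ i) \<in> borel_measurable M"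
    by (rule borel_measurable_integrable[OF integrable_mult_mat_vec[OF K bd v i]])
  show "(\<lambda>\<theta>. (K \<theta> *\<^sub>v w \<theta>) $ i) \<in> borel_measurable M"
    by (rule borel_measurable_integrable[OF integrable_mult_mat_vec[OF K bd w i]])
  show "AE \<theta> in M. (K \<theta> *\<^sub>v v \<theta>) $ i = (K \<theta> *\<^sub>v w \<theta>) $ i"
    using eq[unfolded L2_eq_def] by eventually_elim simp
qed

text \<open>Stated for an arbitrary number of rows because it is applied twice: to the last m rows,
  where G = 0, and to the completed system, where G is invertible.\<close>

lemma boundary_form:
  assumes E: "E \<in> carrier_mat k (4 * n)" and F: "\<And>x. F x \<in> carrier_mat k n"
    and Fb: "\<And>i j. i < k \<Longrightarrow> j < n \<Longrightarrow> bdd (\<lambda>x. F x $$ (i, j))"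
    and h: "h \<in> L2 a b n" and i: "i < k"
    and u_def: "u = (\<lambda>x. vec n (\<lambda>i. c0 i + (x - a) * c1 i + prim2 (\<lambda>x. h x $ i) x))"
    and p_def: "p = (\<lambda>x. vec n (\<lambda>i. c1 i + prim (\<lambda>x. h x $ i) x))"
  shows "(E *\<^sub>v (u a @\<^sub>v u b @\<^sub>v p a @\<^sub>v p b)) $ i + (LINT x|M. (F x *\<^sub>v u x) $ i)
    = (G_mat a b n E F *\<^sub>v (vec n c0 @\<^sub>v vec n c1)) $ i - (\<Sum>j<n. LINT x|M. H_mat b n E F x $$ (i, j) * h x $ j)"
proof -
  have hs: "sq_int (\<lambda>x. h x $ j)" if "j < n" for j by (rule L2_sq_int[OF h that])
  have xa: "bdd (\<lambda>x. x - a)" by (intro bdd_continuous continuous_intros)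
  have u: "u \<in> L2 a b n"
  proof (rule L2I)
    show "u x $ i = c0 i + (x - a) * c1 i + prim2 (\<lambda>x. h x $ i) x" if "i < n" for i x
      using that by (simp add: u_def)
    show "sq_int (\<lambda>x. c0 i + (x - a) * c1 i + prim2 (\<lambda>x. h x $ i) x)" if "i < n" for i
      by (intro bdd_sq_int bdd_add bdd_mult bdd_const xa bdd_prim2 hs that)
  qed (simp add: u_def)
  \<comment> \<open>On [a, b] the condition \<theta> \<le> a leaves only \<theta> = a, where the
    factor a - \<theta> vanishes.\<close>
  have p2a: "prim2 g a = 0" for g
  proof -
    have "prim2 g a = (LINT x|M. 0)"
      unfolding prim2_def by (intro Bochner_Integration.integral_cong refl) auto
    then show ?thesis by simp
  qed
  have 1: "(E *\<^sub>v (u a @\<^sub>v u b @\<^sub>v p a @\<^sub>v p b)) $ i = (\<Sum>j<n. E $$ (i, j) * c0 j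
      + E $$ (i, n + j) * (c0 j + (b - a) * c1 j + prim2 (\<lambda>x. h x $ j) b) + E $$ (i, 2 * n + j) * c1 j
      + E $$ (i, 3 * n + j) * (c1 j + prim (\<lambda>x. h x $ j) b))"
    by (subst mult_stack4_vec[OF E i]) (simp_all add: u_def p_def p2a)
  have 2: "(LINT x|M. (F x *\<^sub>v u x) $ i) = (\<Sum>j<n. LINT x|M. F x $$ (i, j) * (c0 j + (x - a) * c1 j + prim2 (\<lambda>x. h x $ j) x))"
    by (subst integral_mult_mat_vec_1[OF F Fb[OF i] u i]) (simp_all add: u_def)
  have G: "(G_mat a b n E F *\<^sub>v (vec n c0 @\<^sub>v vec n c1)) $ i
      = (\<Sum>j<n. G_mat a b n E F $$ (i, j) * c0 j) + (\<Sum>j<n. G_mat a b n E F $$ (i, n + j) * c1 j)"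
  proof -
    have c: "vec n c0 @\<^sub>v vec n c1 \<in> carrier_vec (2 * n)" by (intro carrier_vecI) simp
    have "(G_mat a b n E F *\<^sub>v (vec n c0 @\<^sub>v vec n c1)) $ i = (\<Sum>j<n + n. G_mat a b n E F $$ (i, j) * (vec n c0 @\<^sub>v vec n c1) $ j)"
      using mult_mat_vec_index[OF G_mat_carrier[OF E] c i] by (simp only: mult_2)
    then show ?thesis unfolding sum_lessThan_add by simp
  qed
  have "E $$ (i, j) * c0 j
      + E $$ (i, n + j) * (c0 j + (b - a) * c1 j + prim2 (\<lambda>x. h x $ j) b) + E $$ (i, 2 * n + j) * c1 j
      + E $$ (i, 3 * n + j) * (c1 j + prim (\<lambda>x. h x $ j) b)
      + (LINT x|M. F x $$ (i, j) * (c0 j + (x - a) * c1 j + prim2 (\<lambda>x. h x $ j) x))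
      = G_mat a b n E F $$ (i, j) * c0 j + G_mat a b n E F $$ (i, n + j) * c1 j
      - (LINT x|M. H_mat b n E F x $$ (i, j) * h x $ j)" if j: "j < n" for j
    unfolding G_mat_index[OF E F i j] H_mat_index[OF E F i j]
    by (rule boundary_form_scalar[OF Fb[OF i j] hs[OF j]])
  then show ?thesis
    unfolding 1 2 G sum.distrib[symmetric] sum_subtractf[symmetric] by (intro sum.cong refl) simp
qed

end

locale pde_setting = compact_interval +
  fixes n m :: nat and E J E1 E2 G :: "real mat" and F F3 :: "real poly mat" and F1 F2 H :: "real \<Rightarrow> real mat"
  assumes E: "E \<in> carrier_mat (2 * n) (4 * n)" and F: "F \<in> carrier_mat (2 * n) n"
    and m_le: "m \<le> 2 * n" and J: "J \<in> carrier_mat (2 * n) (2 * n)"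
    and E1: "E1 = first_rows (2 * n - m) (J * E)"
    and F1: "F1 = (\<lambda>x. first_rows (2 * n - m) (J * pmat_at F x))"
    and E2: "E2 = last_rows m (J * E)"
    and F2: "F2 = (\<lambda>x. last_rows m (J * pmat_at F x))"
    and G2: "G_mat a b n E2 F2 = 0\<^sub>m m (2 * n)"
    and F3: "F3 \<in> carrier_mat m n"
    and G_eq: "G = G_mat a b n (E1 @\<^sub>r 0\<^sub>m m (4 * n)) (\<lambda>x. F1 x @\<^sub>r pmat_at F3 x)"
    and H_eq: "H = H_mat b n (E1 @\<^sub>r 0\<^sub>m m (4 * n)) (\<lambda>x. F1 x @\<^sub>r pmat_at F3 x)"
    and inv_G: "invertible_mat G"
begin

section \<open>The completed boundary data\<close>

definition "Eh = E1 @\<^sub>r 0\<^sub>m m (4 * n)"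
definition "Fh = (\<lambda>x. F1 x @\<^sub>r pmat_at F3 x)"

lemma JE [simp]: "J * E \<in> carrier_mat (2 * n) (4 * n)"
  by (rule mult_carrier_mat[OF J E])

lemma pmat_at_carrier: "Q \<in> carrier_mat k l \<Longrightarrow> pmat_at Q x \<in> carrier_mat k l"
  by (simp add: pmat_at_def)

lemma JF [simp]: "J * pmat_at F x \<in> carrier_mat (2 * n) n"
  by (rule mult_carrier_mat[OF J pmat_at_carrier[OF F]])

lemma first_rows_carrier: "A \<in> carrier_mat k l \<Longrightarrow> first_rows r A \<in> carrier_mat r l"
  by (simp add: first_rows_def)

lemma last_rows_carrier: "A \<in> carrier_mat k l \<Longrightarrow> last_rows r A \<in> carrier_mat r l"
  by (simp add: last_rows_def)

lemma E1_carrier: "E1 \<in> carrier_mat (2 * n - m) (4 * n)"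
  unfolding E1 by (rule first_rows_carrier[OF JE])

lemma F1_carrier: "F1 x \<in> carrier_mat (2 * n - m) n"
  unfolding F1 by (rule first_rows_carrier[OF JF])

lemma E2_carrier: "E2 \<in> carrier_mat m (4 * n)"
  unfolding E2 by (rule last_rows_carrier[OF JE])

lemma F2_carrier: "F2 x \<in> carrier_mat m n"
  unfolding F2 by (rule last_rows_carrier[OF JF])

lemma Eh_carrier: "Eh \<in> carrier_mat (2 * n) (4 * n)"
  using carrier_append_rows[OF E1_carrier zero_carrier_mat[of m "4 * n"]] m_le by (simp add: Eh_def)

lemma Fh_carrier: "Fh x \<in> carrier_mat (2 * n) n"
  using carrier_append_rows[OF F1_carrier pmat_at_carrier[OF F3, of x]] m_le by (simp add: Fh_def)

lemma Eh_index: "i < 2 * n \<Longrightarrow> j < 4 * n \<Longrightarrow> Eh $$ (i, j) = (if i < 2 * n - m then (J * E) $$ (i, j) else 0)"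
  unfolding Eh_def using m_le carrier_matD[OF JE]
  by (subst index_append_rows[OF E1_carrier zero_carrier_mat]) (auto simp: E1 first_rows_def simp del: index_mult_mat)

lemma Fh_index: "i < 2 * n \<Longrightarrow> j < n \<Longrightarrow> Fh x $$ (i, j)
    = (if i < 2 * n - m then (J * pmat_at F x) $$ (i, j) else pmat_at F3 x $$ (i - (2 * n - m), j))"
  unfolding Fh_def using m_le carrier_matD[OF JF[of x]]
  by (subst index_append_rows[OF F1_carrier pmat_at_carrier[OF F3]]) (auto simp: F1 first_rows_def simp del: index_mult_mat)

lemma E2_index: "i < m \<Longrightarrow> j < 4 * n \<Longrightarrow> E2 $$ (i, j) = (J * E) $$ (2 * n - m + i, j)"
  using carrier_matD[OF JE] by (simp add: E2 last_rows_def del: index_mult_mat)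

lemma F2_index: "i < m \<Longrightarrow> j < n \<Longrightarrow> F2 x $$ (i, j) = (J * pmat_at F x) $$ (2 * n - m + i, j)"
  using carrier_matD[OF JF[of x]] by (simp add: F2 last_rows_def del: index_mult_mat)

lemma bdd_pmat_at: "Q \<in> carrier_mat k l \<Longrightarrow> i < k \<Longrightarrow> j < l \<Longrightarrow> bdd (\<lambda>x. pmat_at Q x $$ (i, j))"
  by (simp add: pmat_at_def bdd_poly)

lemma bdd_JF:
  assumes "i < 2 * n" "j < n"
  shows "bdd (\<lambda>x. (J * pmat_at F x) $$ (i, j))"
proof -
  have "(J * pmat_at F x) $$ (i, j) = (\<Sum>k<2 * n. J $$ (i, k) * pmat_at F x $$ (k, j))" for x
    using assms carrier_matD[OF J] carrier_matD[OF pmat_at_carrier[OF F, of x]]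
    by (simp add: scalar_prod_def atLeast0LessThan)
  moreover have "bdd (\<lambda>x. \<Sum>k<2 * n. J $$ (i, k) * pmat_at F x $$ (k, j))"
    using assms by (intro bdd_sum bdd_mult[OF bdd_const] bdd_pmat_at[OF F]) simp_all
  ultimately show ?thesis by (simp only:)
qed

lemma bdd_Fh: "i < 2 * n \<Longrightarrow> j < n \<Longrightarrow> bdd (\<lambda>x. Fh x $$ (i, j))"
  using m_le by (cases "i < 2 * n - m") (simp_all add: Fh_index bdd_JF bdd_pmat_at[OF F3])

lemma bdd_F2: "i < m \<Longrightarrow> j < n \<Longrightarrow> bdd (\<lambda>x. F2 x $$ (i, j))"
  using m_le by (simp add: F2_index bdd_JF)

lemma bdd_H_mat:
  assumes E': "E' \<in> carrier_mat k (4 * n)" and F': "\<And>x. F' x \<in> carrier_mat k n"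
    and Fb: "\<And>i j. i < k \<Longrightarrow> j < n \<Longrightarrow> bdd (\<lambda>x. F' x $$ (i, j))" and ij: "i < k" "j < n"
  shows "bdd (\<lambda>x. H_mat b n E' F' x $$ (i, j))"
proof -
  have bx: "bdd (\<lambda>x. b - x)" by (intro bdd_continuous continuous_intros)
  show ?thesis
    unfolding H_mat_index[OF E' F' ij]
    by (intro bdd_diff bdd_minus bdd_add bdd_mult bdd_const bx bdd_terminal_moment bdd_sq_int Fb ij)
qed

lemma G_Eh: "G = G_mat a b n Eh Fh"
  by (simp add: G_eq Eh_def Fh_def)

lemma H_Eh: "H = H_mat b n Eh Fh"
  by (simp add: H_eq Eh_def Fh_def)

sublocale evolution_operators a b n m G H
proof
  show "G \<in> carrier_mat (2 * n) (2 * n)" unfolding G_Eh by (rule G_mat_carrier[OF Eh_carrier])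
  show "H x \<in> carrier_mat (2 * n) n" for x unfolding H_Eh by (rule H_mat_carrier[OF Eh_carrier])
  show "bdd (\<lambda>x. H x $$ (i, j))" if "i < 2 * n" "j < n" for i j
    unfolding H_Eh by (rule bdd_H_mat[OF Eh_carrier Fh_carrier bdd_Fh that])
qed (rule m_le inv_G)+

lemma has_adj_K: "has_adj (m, n) (m, 0) (K_op a b n m E2 F2)"
  by (rule has_adj_K_op[OF H_mat_carrier[OF E2_carrier] bdd_H_mat[OF E2_carrier F2_carrier bdd_F2]])

definition boundary_value where
  "boundary_value u = vec_integral m {a..b} (\<lambda>x. pmat_at F3 x *\<^sub>v u x)"

text \<open>Multiplication by J separates the rows that restrict u_xx alone from those that
  determine boundary data. The definition of v0 supplies the missing m equations, and solving the
  resulting square system gives exactly the vector c of \<open>T_R_state\<close>.\<close>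

lemma state_representation:
  assumes u: "u \<in> X_space a b n E F"
  defines "v \<equiv> (boundary_value u, wderiv a b n (wderiv a b n u))"
  shows "v \<in> Z a b (m, n)" "fst (K_op a b n m E2 F2 v) = 0\<^sub>v m"
    "L2_eq a b (snd (T_op a b n m G H v)) u" "L2_eq a b (snd (R_op a b n m G H v)) (wderiv a b n u)"
proof -
  have uW: "u \<in> W22 a b n" using u by (simp add: X_space_def)
  define h where "h = wderiv a b n (wderiv a b n u)"
  define v0 where "v0 = boundary_value u"
  have v: "v = (v0, h)" by (simp add: v_def v0_def h_def)
  have v0: "v0 \<in> carrier_vec m" by (simp add: v0_def boundary_value_def vec_integral_def)
  have uL: "u \<in> L2 a b n" and hL: "h \<in> L2 a b n" unfolding h_def by (rule W22_wderiv[OF uW])+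
  show "v \<in> Z a b (m, n)" by (simp add: v Z_iff v0 hL)
  obtain c0 c1 where
    eq_u: "L2_eq a b u (\<lambda>x. vec n (\<lambda>i. c0 i + (x - a) * c1 i + prim2 (\<lambda>x. h x $ i) x))" and
    eq_p: "L2_eq a b (wderiv a b n u) (\<lambda>x. vec n (\<lambda>i. c1 i + prim (\<lambda>x. h x $ i) x))" and
    rep_u: "\<forall>x\<in>{a..b}. cont_rep a b n u x = vec n (\<lambda>i. c0 i + (x - a) * c1 i + prim2 (\<lambda>x. h x $ i) x)" and
    rep_p: "\<forall>x\<in>{a..b}. cont_rep a b n (wderiv a b n u) x = vec n (\<lambda>i. c1 i + prim (\<lambda>x. h x $ i) x)"
    unfolding h_def by (rule W22_representation[OF uW])
  define ur where "ur = (\<lambda>x. vec n (\<lambda>i. c0 i + (x - a) * c1 i + prim2 (\<lambda>x. h x $ i) x))"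
  define pr where "pr = (\<lambda>x. vec n (\<lambda>i. c1 i + prim (\<lambda>x. h x $ i) x))"
  define c where "c = vec n c0 @\<^sub>v vec n c1"
  have c: "c \<in> carrier_vec (2 * n)" unfolding c_def by (intro carrier_vecI) simp
  have c_idx: "c $ i = c0 i" "c $ (n + i) = c1 i" if "i < n" for i
    using that by (simp_all add: c_def)
  have urL: "ur \<in> L2 a b n"
  proof (rule L2I)
    have xa: "bdd (\<lambda>x. x - a)" by (rule bdd_affine)
    show "ur x $ i = c0 i + (x - a) * c1 i + prim2 (\<lambda>x. h x $ i) x" if "i < n" for i x
      using that by (simp add: ur_def)
    show "sq_int (\<lambda>x. c0 i + (x - a) * c1 i + prim2 (\<lambda>x. h x $ i) x)" if "i < n" for i
      by (intro bdd_sq_int bdd_add bdd_mult bdd_const xa bdd_prim2 L2_sq_int[OF hL that])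
  qed (simp add: ur_def)
  define s where "s = ur a @\<^sub>v ur b @\<^sub>v pr a @\<^sub>v pr b"
  have s: "s \<in> carrier_vec (4 * n)" unfolding s_def by (intro carrier_vecI) (simp add: ur_def pr_def)
  note bform = boundary_form[OF _ _ _ hL _ ur_def pr_def, folded s_def c_def]
  have Fx: "pmat_at F x \<in> carrier_mat (2 * n) n" for x by (rule pmat_at_carrier[OF F])
  have F3x: "pmat_at F3 x \<in> carrier_mat m n" for x by (rule pmat_at_carrier[OF F3])
  \<comment> \<open>\<open>X_space\<close> evaluates \<open>cont_rep\<close> at the end points but
    integrates u itself; both are replaced by the explicit representatives \<open>ur\<close> and
    \<open>pr\<close>.\<close>
  have BC: "(E *\<^sub>v s) $ r + (LINT x|M. (pmat_at F x *\<^sub>v ur x) $ r) = 0" if r: "r < 2 * n" for r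
  proof -
    have "a \<in> {a..b}" "b \<in> {a..b}" using ab by auto
    then have cr: "cont_rep a b n u a = ur a" "cont_rep a b n u b = ur b"
      "cont_rep a b n (wderiv a b n u) a = pr a" "cont_rep a b n (wderiv a b n u) b = pr b"
      using rep_u rep_p by (simp_all add: ur_def pr_def)
    have "E *\<^sub>v s + vec_integral (2 * n) {a..b} (\<lambda>x. pmat_at F x *\<^sub>v u x) = 0\<^sub>v (2 * n)"
      using u carrier_matD(1)[OF E] by (simp add: X_space_def Let_def cr s_def)
    from arg_cong[OF this, of "\<lambda>w. w $ r"]
    have "(E *\<^sub>v s) $ r + (LINT x|M. (pmat_at F x *\<^sub>v u x) $ r) = 0"
      using r E by (simp add: vec_integral_def del: index_mult_mat_vec)
    moreover have "(LINT x|M. (pmat_at F x *\<^sub>v u x) $ r) = (LINT x|M. (pmat_at F x *\<^sub>v ur x) $ r)"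
      by (rule integral_mult_mat_vec_cong_AE[OF Fx bdd_pmat_at[OF F r] uL urL eq_u[folded ur_def] r])
    ultimately show ?thesis by simp
  qed
  \<comment> \<open>Row operations commute with the integral.\<close>
  have JBC: "((J * E) *\<^sub>v s) $ i + (LINT x|M. ((J * pmat_at F x) *\<^sub>v ur x) $ i) = 0" if i: "i < 2 * n" for i
  proof -
    have 1: "((J * E) *\<^sub>v s) $ i = (\<Sum>r<2 * n. J $$ (i, r) * (E *\<^sub>v s) $ r)"
      unfolding assoc_mult_mat_vec[OF J E s] by (rule mult_mat_vec_index[OF J mult_mat_vec_carrier[OF E s] i])
    have "(LINT x|M. ((J * pmat_at F x) *\<^sub>v ur x) $ i) = (LINT x|M. (\<Sum>r<2 * n. J $$ (i, r) * (pmat_at F x *\<^sub>v ur x) $ r))"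
    proof (intro Bochner_Integration.integral_cong refl)
      fix x assume "x \<in> space M"
      then have "ur x \<in> carrier_vec n" by (simp add: ur_def)
      then show "((J * pmat_at F x) *\<^sub>v ur x) $ i = (\<Sum>r<2 * n. J $$ (i, r) * (pmat_at F x *\<^sub>v ur x) $ r)"
        unfolding assoc_mult_mat_vec[OF J Fx \<open>ur x \<in> carrier_vec n\<close>]
        by (intro mult_mat_vec_index[OF J mult_mat_vec_carrier[OF Fx] i])
    qed
    also have "\<dots> = (\<Sum>r<2 * n. LINT x|M. J $$ (i, r) * (pmat_at F x *\<^sub>v ur x) $ r)"
    proof (rule Bochner_Integration.integral_sum)
      fix r assume "r \<in> {..<2 * n}"
      then have r: "r < 2 * n" by simp
      show "integrable M (\<lambda>x. J $$ (i, r) * (pmat_at F x *\<^sub>v ur x) $ r)"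
        by (rule integrable_mult_right[OF integrable_mult_mat_vec[OF Fx bdd_pmat_at[OF F r] urL r]])
    qed
    also have "\<dots> = (\<Sum>r<2 * n. J $$ (i, r) * (LINT x|M. (pmat_at F x *\<^sub>v ur x) $ r))"
      by (simp only: integral_mult_right_zero)
    finally have "((J * E) *\<^sub>v s) $ i + (LINT x|M. ((J * pmat_at F x) *\<^sub>v ur x) $ i)
        = (\<Sum>r<2 * n. J $$ (i, r) * ((E *\<^sub>v s) $ r + (LINT x|M. (pmat_at F x *\<^sub>v ur x) $ r)))"
      unfolding 1 by (simp only: sum.distrib distrib_left)
    also have "\<dots> = (\<Sum>r<2 * n. 0)"
      by (intro sum.cong refl) (simp only: BC lessThan_iff mult_zero_right)
    finally show ?thesis by simp
  qed
  have ur_c: "ur x \<in> carrier_vec n" for x by (simp add: ur_def)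
  have rows: "(A *\<^sub>v w) $ i = (B *\<^sub>v w) $ i'"
    if "A \<in> carrier_mat k q" "B \<in> carrier_mat l q" "w \<in> carrier_vec q" "i < k" "i' < l"
      "\<And>j. j < q \<Longrightarrow> A $$ (i, j) = B $$ (i', j)" for A B :: "real mat" and w k l q i i'
    using that(6) by (simp add: mult_mat_vec_index[OF that(1,3,4)] mult_mat_vec_index[OF that(2,3,5)] del: index_mult_mat_vec)
  \<comment> \<open>With G = 0 for these rows, the boundary form reduces to the integral of H
    against h.\<close>
  have K0: "(\<Sum>j<n. LINT x|M. H_mat b n E2 F2 x $$ (i, j) * h x $ j) = 0" if i: "i < m" for i
  proof -
    have i': "2 * n - m + i < 2 * n" using i m_le by simp
    have e: "(E2 *\<^sub>v s) $ i = ((J * E) *\<^sub>v s) $ (2 * n - m + i)"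
      by (rule rows[OF E2_carrier JE s i i' E2_index[OF i]])
    have f: "(F2 x *\<^sub>v ur x) $ i = ((J * pmat_at F x) *\<^sub>v ur x) $ (2 * n - m + i)" for x
      by (rule rows[OF F2_carrier JF ur_c i i' F2_index[OF i]])
    have "(E2 *\<^sub>v s) $ i + (LINT x|M. (F2 x *\<^sub>v ur x) $ i) = 0"
      unfolding e f by (rule JBC[OF i'])
    moreover have "(G_mat a b n E2 F2 *\<^sub>v c) $ i = 0"
      unfolding G2 using c i by simp
    ultimately show ?thesis using bform[OF E2_carrier F2_carrier bdd_F2 i] by simp
  qed
  show "fst (K_op a b n m E2 F2 v) = 0\<^sub>v m"
  proof (rule eq_vecI)
    fix i assume "i < dim_vec (0\<^sub>v m)"
    then have i: "i < m" by simp
    have "fst (K_op a b n m E2 F2 v) $ i = (LINT x|M. (H_mat b n E2 F2 x *\<^sub>v h x) $ i)"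
      using i by (simp add: K_op_def of_vec_def vec_integral_def v)
    also have "\<dots> = (\<Sum>j<n. LINT x|M. H_mat b n E2 F2 x $$ (i, j) * h x $ j)"
      by (rule integral_mult_mat_vec_1[OF H_mat_carrier[OF E2_carrier] bdd_H_mat[OF E2_carrier F2_carrier bdd_F2 i] hL i])
    finally show "fst (K_op a b n m E2 F2 v) $ i = 0\<^sub>v m $ i" using K0[OF i] i by simp
  qed (simp add: K_op_def of_vec_def vec_integral_def)
  have v0_idx: "v0 $ i = (LINT x|M. (pmat_at F3 x *\<^sub>v ur x) $ i)" if i: "i < m" for i
    using i integral_mult_mat_vec_cong_AE[OF F3x bdd_pmat_at[OF F3 i] uL urL eq_u[folded ur_def] i]
    by (simp add: v0_def boundary_value_def vec_integral_def)
  let ?D = "0\<^sub>m (2 * n - m) m @\<^sub>r 1\<^sub>m m :: real mat"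
  have D_idx: "(?D *\<^sub>v v0) $ i = (if i < 2 * n - m then 0 else v0 $ (i - (2 * n - m)))" if i: "i < 2 * n" for i
  proof -
    have "?D $$ (i, j) = (if i < 2 * n - m then 0 else if i - (2 * n - m) = j then 1 else 0)" if "j < m" for j
      using i that m_le by (subst index_append_rows[OF zero_carrier_mat one_carrier_mat]) auto
    then have "(?D *\<^sub>v v0) $ i = (\<Sum>j<m. (if i < 2 * n - m then 0 else if i - (2 * n - m) = j then 1 else 0) * v0 $ j)"
      unfolding mult_mat_vec_index[OF bot_carrier v0 i] by simp
    also have "\<dots> = (if i < 2 * n - m then 0 else v0 $ (i - (2 * n - m)))"
    proof (cases "i < 2 * n - m")
      case False
      then have "i - (2 * n - m) < m" using i m_le by simp
      with False show ?thesis by (simp add: if_distrib[of "\<lambda>t. t * _"] cong: if_cong)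
    qed simp
    finally show ?thesis .
  qed
  \<comment> \<open>The first \<open>2 n - m\<close> rows are the boundary conditions that involve the boundary data \<open>c\<close>, the last
    \<open>m\<close> rows define \<open>v0\<close>; together they determine \<open>c\<close>, since \<open>G\<close> is invertible.\<close>
  have Gc: "G *\<^sub>v c = ?D *\<^sub>v v0 + H_moment h"
  proof (rule eq_vecI)
    fix i assume "i < dim_vec (?D *\<^sub>v v0 + H_moment h)"
    then have i: "i < 2 * n" using carrier_vecD[OF H_moment_carrier[of h]] by simp
    have "(Eh *\<^sub>v s) $ i + (LINT x|M. (Fh x *\<^sub>v ur x) $ i) = (?D *\<^sub>v v0) $ i"
    proof (cases "i < 2 * n - m")
      case True
      have e: "(Eh *\<^sub>v s) $ i = ((J * E) *\<^sub>v s) $ i"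
        by (rule rows[OF Eh_carrier JE s i i]) (simp only: Eh_index[OF i] True if_True)
      have f: "(Fh x *\<^sub>v ur x) $ i = ((J * pmat_at F x) *\<^sub>v ur x) $ i" for x
        by (rule rows[OF Fh_carrier JF ur_c i i]) (simp only: Fh_index[OF i] True if_True)
      show ?thesis unfolding e f JBC[OF i] D_idx[OF i] using True by simp
    next
      case False
      then have i': "i - (2 * n - m) < m" using i m_le by simp
      have e: "(Eh *\<^sub>v s) $ i = 0"
        unfolding mult_mat_vec_index[OF Eh_carrier s i] by (rule sum.neutral) (simp add: Eh_index[OF i] False)
      have f: "(Fh x *\<^sub>v ur x) $ i = (pmat_at F3 x *\<^sub>v ur x) $ (i - (2 * n - m))" for x
        by (rule rows[OF Fh_carrier F3x ur_c i i']) (simp only: Fh_index[OF i] False if_False)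
      show ?thesis unfolding e f D_idx[OF i] v0_idx[OF i'] using False by simp
    qed
    moreover note bform[OF Eh_carrier Fh_carrier bdd_Fh i, folded G_Eh H_Eh]
    ultimately have "(G *\<^sub>v c) $ i = (?D *\<^sub>v v0) $ i + (\<Sum>j<n. LINT x|M. H x $$ (i, j) * h x $ j)" by linarith
    then show "(G *\<^sub>v c) $ i = (?D *\<^sub>v v0 + H_moment h) $ i"
      using i by (simp add: H_moment_def del: index_mult_mat_vec)
  qed (use carrier_matD[OF G] in \<open>simp add: H_moment_def\<close>)
  have Dv: "?D *\<^sub>v v0 \<in> carrier_vec (2 * n)" by (rule mult_mat_vec_carrier[OF bot_carrier v0])
  have "c = Gi *\<^sub>v (G *\<^sub>v c)"
    using c by (simp add: assoc_mult_mat_vec[OF Gi G c, symmetric] Gi_G)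
  also have "\<dots> = Gi *\<^sub>v (?D *\<^sub>v v0) + Gi *\<^sub>v H_moment h"
    unfolding Gc by (rule mult_add_distrib_mat_vec[OF Gi Dv H_moment_carrier])
  also have "Gi *\<^sub>v (?D *\<^sub>v v0) = C0 *\<^sub>v v0"
    unfolding C0_def by (rule assoc_mult_mat_vec[OF Gi bot_carrier v0, symmetric])
  finally have c_eq: "c = C0 *\<^sub>v v0 + Gi *\<^sub>v H_moment h" .
  note TR = T_R_state[OF hL v0 c_eq]
  have T: "snd (T_op a b n m G H v) x = ur x" if "x \<in> {a..b}" for x
    unfolding v TR(1)[OF that] ur_def by (rule eq_vecI) (simp_all add: c_idx)
  have R: "snd (R_op a b n m G H v) x = pr x" if "x \<in> {a..b}" for x
    unfolding v TR(2)[OF that] pr_def by (rule eq_vecI) (simp_all add: c_idx)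
  show "L2_eq a b (snd (T_op a b n m G H v)) u"
    using eq_u[folded ur_def] AE_space[of M] unfolding L2_eq_def by eventually_elim (simp add: T)
  show "L2_eq a b (snd (R_op a b n m G H v)) (wderiv a b n u)"
    using eq_p[folded pr_def] AE_space[of M] unfolding L2_eq_def by eventually_elim (simp add: R)
qed

end

section \<open>Boundedness and the Lyapunov functional\<close>

text \<open>The case C = 0 has to be included, since C will be a squared norm that may
  vanish.\<close>

lemma quadratic_nonneg_discriminant:
  fixes A B C :: real
  assumes "\<And>t. 0 \<le> A + 2 * t * B + t\<^sup>2 * C"
  shows "B\<^sup>2 \<le> A * C"
proof (cases "C = 0")
  case True
  have "B = 0"
  proof (rule ccontr)
    assume "B \<noteq> 0"
    \<comment> \<open>At this t the expression, affine in t because C = 0, takes the value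
      -1.\<close>
    with assms[of "- (A + 1) / (2 * B)"] True show False by (simp add: field_simps)
  qed
  then show ?thesis using True by simp
next
  case False
  have "0 \<le> C"
  proof (rule ccontr)
    assume C: "\<not> 0 \<le> C"
    \<comment> \<open>Large enough for - t C to outweigh |A| + 2 |B| + 1, and at least 1 so that A
      and 2 t B are bounded by multiples of t; the quadratic is then at most -t.\<close>
    define t where "t = max 1 ((\<bar>A\<bar> + 2 * \<bar>B\<bar> + 1) / - C)"
    have t: "1 \<le> t" "(\<bar>A\<bar> + 2 * \<bar>B\<bar> + 1) / - C \<le> t" by (simp_all add: t_def)
    then have "\<bar>A\<bar> + 2 * \<bar>B\<bar> + 1 \<le> t * - C" using C by (simp only: pos_divide_le_eq)
    then have "t * (\<bar>A\<bar> + 2 * \<bar>B\<bar> + 1) \<le> t * (t * - C)" using t(1) by (intro mult_left_mono) auto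
    moreover have "A \<le> t * \<bar>A\<bar>" using t(1) mult_right_mono[of 1 t "\<bar>A\<bar>"] by simp
    moreover have "2 * t * B \<le> t * (2 * \<bar>B\<bar>)" using t(1) mult_left_mono[of B "\<bar>B\<bar>" "2 * t"] by simp
    ultimately have "A + 2 * t * B + t\<^sup>2 * C \<le> - t" by (simp add: algebra_simps power2_eq_square)
    with assms[of t] t(1) show False by linarith
  qed
  with False have C: "0 < C" by simp
  \<comment> \<open>The quadratic is evaluated at its minimiser.\<close>
  have "0 \<le> A + 2 * (- B / C) * B + (- B / C)\<^sup>2 * C" by (rule assms)
  also have "\<dots> = A - B\<^sup>2 / C" using C by (simp add: field_simps power2_eq_square)
  finally show ?thesis using C by (simp add: pos_divide_le_eq)
qed

context compact_interval
begin

lemma L2_inner_self_nonneg: "f \<in> L2 a b n \<Longrightarrow> 0 \<le> L2_inner a b f f"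
  by (simp add: L2_inner_eq sum_nonneg)

lemma L2_norm_sq: "f \<in> L2 a b n \<Longrightarrow> (L2_norm a b f)\<^sup>2 = L2_inner a b f f"
  unfolding L2_norm_def by (rule real_sqrt_pow2[OF L2_inner_self_nonneg])

lemma L2_norm_nonneg: "f \<in> L2 a b n \<Longrightarrow> 0 \<le> L2_norm a b f"
  unfolding L2_norm_def by (rule real_sqrt_ge_zero[OF L2_inner_self_nonneg])

text \<open>\<open>L2\<close> is a set of representatives, not an inner product type, so the
  inequality is derived from the nonnegative quadratic t -> ||f + t g||^2.\<close>

lemma L2_Cauchy_Schwarz:
  assumes f: "f \<in> L2 a b n" and g: "g \<in> L2 a b n"
  shows "\<bar>L2_inner a b f g\<bar> \<le> L2_norm a b f * L2_norm a b g"
proof -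
  have "0 \<le> L2_inner a b f f + 2 * t * L2_inner a b f g + t\<^sup>2 * L2_inner a b g g" for t
  proof -
    have tg: "(\<lambda>x. t \<cdot>\<^sub>v g x) \<in> L2 a b n" by (rule L2_smult[OF g])
    have h: "(\<lambda>x. f x + t \<cdot>\<^sub>v g x) \<in> L2 a b n" by (rule L2_add[OF f tg])
    have fh: "L2_inner a b f (\<lambda>x. f x + t \<cdot>\<^sub>v g x) = L2_inner a b f f + t * L2_inner a b f g"
      by (simp add: L2_inner_add_right[OF f f tg] L2_inner_smult_right[OF f g])
    have gh: "L2_inner a b g (\<lambda>x. f x + t \<cdot>\<^sub>v g x) = L2_inner a b f g + t * L2_inner a b g g"
      by (simp add: L2_inner_add_right[OF g f tg] L2_inner_smult_right[OF g g] L2_inner_commute[OF g f])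
    have "L2_inner a b (\<lambda>x. f x + t \<cdot>\<^sub>v g x) (\<lambda>x. f x + t \<cdot>\<^sub>v g x)
        = L2_inner a b f (\<lambda>x. f x + t \<cdot>\<^sub>v g x) + t * L2_inner a b g (\<lambda>x. f x + t \<cdot>\<^sub>v g x)"
      by (simp add: L2_inner_add_right[OF h f tg] L2_inner_smult_right[OF h g] L2_inner_commute[OF h f] L2_inner_commute[OF h g])
    also have "\<dots> = L2_inner a b f f + 2 * t * L2_inner a b f g + t\<^sup>2 * L2_inner a b g g"
      unfolding fh gh by (simp add: algebra_simps power2_eq_square)
    finally show ?thesis using L2_inner_self_nonneg[OF h] by simp
  qed
  from quadratic_nonneg_discriminant[OF this]
  have "(L2_inner a b f g)\<^sup>2 \<le> (L2_norm a b f * L2_norm a b g)\<^sup>2"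
    by (simp add: power_mult_distrib L2_norm_sq[OF f] L2_norm_sq[OF g])
  then show ?thesis
    using abs_le_square_iff[of "L2_inner a b f g" "L2_norm a b f * L2_norm a b g"]
      L2_norm_nonneg[OF f] L2_norm_nonneg[OF g] by simp
qed

section \<open>L2 bounds for multiplication and kernel operators\<close>

lemma mult_sq_bound:
  assumes r: "bdd r"
  shows "\<exists>c\<ge>0. \<forall>f. sq_int f \<longrightarrow> (LINT x|M. (r x * f x)\<^sup>2) \<le> c * (LINT x|M. (f x)\<^sup>2)"
proof -
  obtain B where B: "B \<ge> 0" "\<forall>x\<in>{a..b}. \<bar>r x\<bar> \<le> B" by (rule bddE[OF r])
  have "(LINT x|M. (r x * f x)\<^sup>2) \<le> B\<^sup>2 * (LINT x|M. (f x)\<^sup>2)" if f: "sq_int f" for f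
  proof -
    have "(LINT x|M. (r x * f x)\<^sup>2) \<le> (LINT x|M. B\<^sup>2 * (f x)\<^sup>2)"
    proof (rule integral_mono)
      show "integrable M (\<lambda>x. (r x * f x)\<^sup>2)" using sq_int_bdd_mult[OF r f] by (simp add: sq_int_def)
      show "integrable M (\<lambda>x. B\<^sup>2 * (f x)\<^sup>2)" using f by (simp add: sq_int_def)
      fix x assume "x \<in> space M"
      then have "\<bar>r x\<bar> \<le> B" using B(2) by simp
      then have "(r x)\<^sup>2 \<le> B\<^sup>2" by (metis abs_ge_zero power2_abs power_mono)
      then show "(r x * f x)\<^sup>2 \<le> B\<^sup>2 * (f x)\<^sup>2" by (simp add: power_mult_distrib mult_right_mono)
    qed
    then show ?thesis by simp
  qed
  then show ?thesis by (intro exI[of _ "B\<^sup>2"]) simp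
qed

text \<open>Cauchy-Schwarz against the constant 1, again through the discriminant.\<close>

lemma integral_abs_sq_le:
  assumes f: "sq_int f"
  shows "(LINT x|M. \<bar>f x\<bar>)\<^sup>2 \<le> (b - a) * (LINT x|M. (f x)\<^sup>2)"
proof -
  define I where "I = (LINT x|M. \<bar>f x\<bar>)"
  have i1: "integrable M (\<lambda>x. \<bar>f x\<bar>)" by (rule integrable_abs[OF sq_int_integrable[OF f]])
  have i2: "integrable M (\<lambda>x. (f x)\<^sup>2)" using f by (simp add: sq_int_def)
  have "0 \<le> (b - a) + 2 * t * I + t\<^sup>2 * (LINT x|M. (f x)\<^sup>2)" for t
  proof -
    have "0 \<le> (LINT x|M. (1 + t * \<bar>f x\<bar>)\<^sup>2)" by (rule Bochner_Integration.integral_nonneg) simp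
    also have "\<dots> = (LINT x|M. 1 + ((2 * t) * \<bar>f x\<bar> + t\<^sup>2 * (f x)\<^sup>2))"
      by (intro Bochner_Integration.integral_cong refl) (simp add: power2_sum power_mult_distrib)
    also have "\<dots> = (LINT x|M. 1) + (LINT x|M. (2 * t) * \<bar>f x\<bar> + t\<^sup>2 * (f x)\<^sup>2)"
      by (intro Bochner_Integration.integral_add Bochner_Integration.integrable_add integrable_mult_right i1 i2) simp
    also have "(LINT x|M. (2 * t) * \<bar>f x\<bar> + t\<^sup>2 * (f x)\<^sup>2) = (LINT x|M. (2 * t) * \<bar>f x\<bar>) + (LINT x|M. t\<^sup>2 * (f x)\<^sup>2)"
      by (intro Bochner_Integration.integral_add integrable_mult_right i1 i2)
    finally show ?thesis unfolding integral_1_M integral_mult_right_zero I_def by simp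
  qed
  from quadratic_nonneg_discriminant[OF this] show ?thesis unfolding I_def .
qed

text \<open>Pointwise the integral is at most B times the L1 norm of f, whose square is at most b -
  a times the squared L2 norm; integrating over [a, b] adds a second factor b - a.\<close>

lemma kernel_sq_bound:
  assumes k: "bdd2 k"
  shows "\<exists>c\<ge>0. \<forall>f. sq_int f \<longrightarrow> (LINT x|M. (LINT \<theta>|M. k x \<theta> * f \<theta>)\<^sup>2) \<le> c * (LINT x|M. (f x)\<^sup>2)"
proof -
  obtain B where B: "B \<ge> 0" "\<forall>x\<in>{a..b}. \<forall>\<theta>\<in>{a..b}. \<bar>k x \<theta>\<bar> \<le> B" by (rule bdd2E[OF k])
  have "(LINT x|M. (LINT \<theta>|M. k x \<theta> * f \<theta>)\<^sup>2) \<le> (B\<^sup>2 * (b - a)\<^sup>2) * (LINT x|M. (f x)\<^sup>2)" if f: "sq_int f" for f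
  proof -
    have "(LINT x|M. (LINT \<theta>|M. k x \<theta> * f \<theta>)\<^sup>2) \<le> (LINT x|M. B\<^sup>2 * ((b - a) * (LINT x|M. (f x)\<^sup>2)))"
    proof (rule integral_mono)
      show "integrable M (\<lambda>x. (LINT \<theta>|M. k x \<theta> * f \<theta>)\<^sup>2)"
        using bdd_sq_int[OF bdd_kernel[OF k f]] by (simp add: sq_int_def)
      fix x assume "x \<in> space M"
      then have x: "x \<in> {a..b}" by simp
      have "\<bar>LINT \<theta>|M. k x \<theta> * f \<theta>\<bar> \<le> B * (LINT \<theta>|M. \<bar>f \<theta>\<bar>)"
        by (rule kernel_abs_le[OF k f x B(2)[rule_format]])
      then have "(LINT \<theta>|M. k x \<theta> * f \<theta>)\<^sup>2 \<le> (B * (LINT \<theta>|M. \<bar>f \<theta>\<bar>))\<^sup>2"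
        by (metis abs_ge_zero power2_abs power_mono)
      also have "\<dots> \<le> B\<^sup>2 * ((b - a) * (LINT x|M. (f x)\<^sup>2))"
        unfolding power_mult_distrib by (intro mult_left_mono integral_abs_sq_le f) simp
      finally show "(LINT \<theta>|M. k x \<theta> * f \<theta>)\<^sup>2 \<le> B\<^sup>2 * ((b - a) * (LINT x|M. (f x)\<^sup>2))" .
    qed simp
    also have "\<dots> = (LINT x|M. (B\<^sup>2 * ((b - a) * (LINT x|M. (f x)\<^sup>2))) * 1)" by (simp only: mult_1_right)
    also have "\<dots> = (B\<^sup>2 * ((b - a) * (LINT x|M. (f x)\<^sup>2))) * (b - a)"
      unfolding integral_mult_right_zero integral_1_M ..
    finally show ?thesis by (simp add: power2_eq_square mult_ac)
  qed
  then show ?thesis by (intro exI[of _ "B\<^sup>2 * (b - a)\<^sup>2"]) simp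
qed

lemma gen_op_bounded:
  assumes ok: "gen_ok 0 n 0 n Q1 Q2 R0 R"
  shows "\<exists>C\<ge>0. \<forall>v\<in>Z a b (0, n). L2_inner a b (snd (gen_op 0 n 0 n P Q1 Q2 R0 R v)) (snd (gen_op 0 n 0 n P Q1 Q2 R0 R v))
    \<le> C * L2_inner a b (snd v) (snd v)"
proof -
  \<comment> \<open>The index conditions stand below the existential quantifier so that choice
    yields a nonnegative constant for all i and j.\<close>
  have "\<forall>i j. \<exists>c\<ge>0. i < n \<longrightarrow> j < n \<longrightarrow> (\<forall>f. sq_int f \<longrightarrow> (LINT x|M. (R0 i j x * f x)\<^sup>2) \<le> c * (LINT x|M. (f x)\<^sup>2))"
  proof (intro allI)
    fix i j
    show "\<exists>c\<ge>0. i < n \<longrightarrow> j < n \<longrightarrow> (\<forall>f. sq_int f \<longrightarrow> (LINT x|M. (R0 i j x * f x)\<^sup>2) \<le> c * (LINT x|M. (f x)\<^sup>2))"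
      using mult_sq_bound[of "R0 i j"] ok by (cases "i < n \<and> j < n") (auto simp: gen_ok_def)
  qed
  then obtain c where c: "\<And>i j. 0 \<le> c i j" "\<And>i j f. i < n \<Longrightarrow> j < n \<Longrightarrow> sq_int f \<Longrightarrow>
      (LINT x|M. (R0 i j x * f x)\<^sup>2) \<le> c i j * (LINT x|M. (f x)\<^sup>2)"
    unfolding choice_iff by blast
  have "\<forall>i j. \<exists>c\<ge>0. i < n \<longrightarrow> j < n \<longrightarrow> (\<forall>f. sq_int f \<longrightarrow> (LINT x|M. (LINT \<theta>|M. R i j x \<theta> * f \<theta>)\<^sup>2) \<le> c * (LINT x|M. (f x)\<^sup>2))"
  proof (intro allI)
    fix i j
    show "\<exists>c\<ge>0. i < n \<longrightarrow> j < n \<longrightarrow> (\<forall>f. sq_int f \<longrightarrow> (LINT x|M. (LINT \<theta>|M. R i j x \<theta> * f \<theta>)\<^sup>2) \<le> c * (LINT x|M. (f x)\<^sup>2))"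
      using kernel_sq_bound[of "R i j"] ok by (cases "i < n \<and> j < n") (auto simp: gen_ok_def)
  qed
  then obtain d where d: "\<And>i j. 0 \<le> d i j" "\<And>i j f. i < n \<Longrightarrow> j < n \<Longrightarrow> sq_int f \<Longrightarrow>
      (LINT x|M. (LINT \<theta>|M. R i j x \<theta> * f \<theta>)\<^sup>2) \<le> d i j * (LINT x|M. (f x)\<^sup>2)"
    unfolding choice_iff by blast
  \<comment> \<open>The factor n comes from squaring a sum of n terms, the factor 2 from (A + K)^2
    \<le> 2 (A^2 + K^2).\<close>
  define e where "e i j = 2 * real n * (c i j + d i j)" for i j
  have e: "0 \<le> e i j" for i j using c(1) d(1) by (simp add: e_def)
  let ?g = "gen_op 0 n 0 n P Q1 Q2 R0 R"
  have "L2_inner a b (snd (?g v)) (snd (?g v)) \<le> (\<Sum>i<n. \<Sum>j<n. e i j) * L2_inner a b (snd v) (snd v)"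
    if v: "v \<in> Z a b (0, n)" for v
  proof -
    have vL: "snd v \<in> L2 a b n" using v by (simp add: Z_iff)
    have gL: "snd (?g v) \<in> L2 a b n" using gen_op_Z[OF ok v] by (simp add: Z_iff)
    define q where "q j = (LINT x|M. (snd v x $ j)\<^sup>2)" for j
    have q: "0 \<le> q j" for j unfolding q_def by simp
    have vj: "sq_int (\<lambda>x. snd v x $ j)" if "j < n" for j by (rule L2_sq_int[OF vL that])
    have row: "(LINT x|M. snd (?g v) x $ i * snd (?g v) x $ i) \<le> (\<Sum>j<n. e i j * q j)" if i: "i < n" for i
    proof -
      define A where "A j x = R0 i j x * snd v x $ j" for j x
      define K where "K j x = (LINT \<theta>|M. R i j x \<theta> * snd v \<theta> $ j)" for j x
      have A: "integrable M (\<lambda>x. (A j x)\<^sup>2)" and K: "integrable M (\<lambda>x. (K j x)\<^sup>2)" if j: "j < n" for j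
      proof -
        have bd: "bdd (R0 i j)" "bdd2 (R i j)" using ok i j by (simp_all add: gen_ok_def)
        have "sq_int (A j)" unfolding A_def by (rule sq_int_bdd_mult[OF bd(1) vj[OF j]])
        moreover have "sq_int (K j)" unfolding K_def by (rule bdd_sq_int[OF bdd_kernel[OF bd(2) vj[OF j]]])
        ultimately show "integrable M (\<lambda>x. (A j x)\<^sup>2)" "integrable M (\<lambda>x. (K j x)\<^sup>2)" by (simp_all add: sq_int_def)
      qed
      have "(LINT x|M. snd (?g v) x $ i * snd (?g v) x $ i) \<le> (LINT x|M. (\<Sum>j<n. 2 * real n * ((A j x)\<^sup>2 + (K j x)\<^sup>2)))"
      proof (rule integral_mono)
        show "integrable M (\<lambda>x. snd (?g v) x $ i * snd (?g v) x $ i)" by (rule L2_integrable_mult[OF gL gL i])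
        show "integrable M (\<lambda>x. \<Sum>j<n. 2 * real n * ((A j x)\<^sup>2 + (K j x)\<^sup>2))"
          by (intro Bochner_Integration.integrable_sum integrable_mult_right Bochner_Integration.integrable_add A K) simp_all
        fix x
        have "snd (?g v) x $ i = (\<Sum>j<n. A j x + K j x)"
          using i by (simp add: gen_op_def A_def K_def)
        then have "snd (?g v) x $ i * snd (?g v) x $ i = (\<Sum>j<n. A j x + K j x)\<^sup>2"
          by (simp only: power2_eq_square)
        also have "\<dots> \<le> (\<Sum>j<n. (A j x + K j x)\<^sup>2) * real (card {..<n})"
          by (rule sum_squared_le_sum_of_squares)
        also have "\<dots> = (\<Sum>j<n. real n * (A j x + K j x)\<^sup>2)"
          by (simp add: sum_distrib_left mult.commute)
        also have "\<dots> \<le> (\<Sum>j<n. 2 * real n * ((A j x)\<^sup>2 + (K j x)\<^sup>2))"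
        proof (rule sum_mono)
          fix j
          have "(A j x + K j x)\<^sup>2 \<le> 2 * ((A j x)\<^sup>2 + (K j x)\<^sup>2)"
            using sum_squares_bound[of "A j x" "K j x"] by (simp add: power2_sum)
          from mult_left_mono[OF this, of "real n"]
          show "real n * (A j x + K j x)\<^sup>2 \<le> 2 * real n * ((A j x)\<^sup>2 + (K j x)\<^sup>2)" by (simp add: mult_ac)
        qed
        finally show "snd (?g v) x $ i * snd (?g v) x $ i \<le> (\<Sum>j<n. 2 * real n * ((A j x)\<^sup>2 + (K j x)\<^sup>2))" .
      qed
      also have "\<dots> = (\<Sum>j<n. LINT x|M. 2 * real n * ((A j x)\<^sup>2 + (K j x)\<^sup>2))"
        by (rule Bochner_Integration.integral_sum)
          (intro integrable_mult_right Bochner_Integration.integrable_add A K, simp_all)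
      also have "\<dots> \<le> (\<Sum>j<n. e i j * q j)"
      proof (rule sum_mono)
        fix j assume "j \<in> {..<n}"
        then have j: "j < n" by simp
        have "(LINT x|M. 2 * real n * ((A j x)\<^sup>2 + (K j x)\<^sup>2)) = 2 * real n * ((LINT x|M. (A j x)\<^sup>2) + (LINT x|M. (K j x)\<^sup>2))"
          unfolding integral_mult_right_zero Bochner_Integration.integral_add[OF A[OF j] K[OF j]] ..
        also have "\<dots> \<le> 2 * real n * (c i j * q j + d i j * q j)"
          unfolding A_def K_def q_def using c(2)[OF i j vj[OF j]] d(2)[OF i j vj[OF j]]
          by (intro mult_left_mono add_mono) simp_all
        also have "\<dots> = e i j * q j" by (simp add: e_def algebra_simps)
        finally show "(LINT x|M. 2 * real n * ((A j x)\<^sup>2 + (K j x)\<^sup>2)) \<le> e i j * q j" .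
      qed
      finally show ?thesis .
    qed
    have vv: "L2_inner a b (snd v) (snd v) = (\<Sum>j<n. q j)"
      unfolding L2_inner_eq[OF vL vL] q_def power2_eq_square ..
    \<comment> \<open>The norm of one component is at most that of the whole function, so the
      weighted sums collapse to a single constant.\<close>
    have qle: "q j \<le> (\<Sum>j<n. q j)" if "j < n" for j
      using that q by (intro member_le_sum) simp_all
    have "L2_inner a b (snd (?g v)) (snd (?g v)) \<le> (\<Sum>i<n. \<Sum>j<n. e i j * q j)"
      unfolding L2_inner_eq[OF gL gL] by (rule sum_mono) (simp add: row)
    also have "\<dots> \<le> (\<Sum>i<n. \<Sum>j<n. e i j * (\<Sum>j<n. q j))"
      by (intro sum_mono mult_left_mono qle e) simp
    also have "\<dots> = (\<Sum>i<n. \<Sum>j<n. e i j) * L2_inner a b (snd v) (snd v)"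
      unfolding vv by (simp only: sum_distrib_right)
    finally show ?thesis .
  qed
  then show ?thesis by (intro exI[of _ "\<Sum>i<n. \<Sum>j<n. e i j"]) (simp add: sum_nonneg e)
qed

lemma Z0_inner: "v \<in> Z a b (0, n) \<Longrightarrow> w \<in> Z a b (0, n) \<Longrightarrow> Z_inner a b v w = L2_inner a b (snd v) (snd w)"
  using carrier_vecD[of "fst w" 0] by (simp add: Z_inner_def Z_iff scalar_prod_def)

lemma PI_ops_bounded:
  assumes B: "B \<in> PI_ops a b (0, n) (0, n)"
  shows "\<exists>C\<ge>0. \<forall>v\<in>Z a b (0, n). Z_inner a b (B v) (B v) \<le> C * Z_inner a b v v"
proof -
  obtain P Q1 Q2 R0 R where ok: "gen_ok 0 n 0 n Q1 Q2 R0 R" and BZ: "\<forall>v\<in>Z a b (0, n). B v \<in> Z a b (0, n)"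
    and eq: "\<forall>v\<in>Z a b (0, n). Z_eq a b (B v) (gen_op 0 n 0 n P Q1 Q2 R0 R v)"
    by (rule PI_ops_gen_op[OF B])
  let ?g = "gen_op 0 n 0 n P Q1 Q2 R0 R"
  from gen_op_bounded[OF ok, of P] obtain C where C: "0 \<le> C"
    "\<forall>v\<in>Z a b (0, n). L2_inner a b (snd (?g v)) (snd (?g v)) \<le> C * L2_inner a b (snd v) (snd v)"
    by blast
  have "Z_inner a b (B v) (B v) \<le> C * Z_inner a b v v" if v: "v \<in> Z a b (0, n)" for v
  proof -
    note gZ = gen_op_Z[OF ok v, where P = P]
    have "Z_inner a b (B v) (B v) = Z_inner a b (?g v) (?g v)"
      using BZ eq v gZ by (intro Z_inner_cong[where d = "(0, n)"]) simp_all
    then show ?thesis using C(2) v by (simp add: Z0_inner[OF gZ gZ] Z0_inner[OF v v])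
  qed
  then show ?thesis using C(1) by blast
qed

section \<open>Bounded operators on the L2 component and their quadratic forms\<close>

lemma of_L2_Z: "f \<in> L2 a b n \<Longrightarrow> of_L2 f \<in> Z a b (0, n)"
  by (simp add: of_L2_def Z_iff)

lemma snd_of_L2 [simp]: "snd (of_L2 f) = f"
  by (simp add: of_L2_def)

lemma Z_inner_of_L2: "f \<in> L2 a b n \<Longrightarrow> g \<in> L2 a b n \<Longrightarrow> Z_inner a b (of_L2 f) (of_L2 g) = L2_inner a b f g"
  by (simp add: Z0_inner[OF of_L2_Z of_L2_Z])

definition bounded_op where
  "bounded_op n B \<longleftrightarrow> (\<exists>C\<ge>0. \<forall>v\<in>Z a b (0, n). Z_inner a b (B v) (B v) \<le> C * Z_inner a b v v)"

lemma Z_Cauchy_Schwarz: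
  assumes "v \<in> Z a b (0, n)" "w \<in> Z a b (0, n)"
  shows "\<bar>Z_inner a b v w\<bar> \<le> sqrt (Z_inner a b v v) * sqrt (Z_inner a b w w)"
  using assms L2_Cauchy_Schwarz[of "snd v" n "snd w"]
  by (simp add: Z0_inner[OF assms] Z0_inner[OF assms(1) assms(1)] Z0_inner[OF assms(2) assms(2)] Z_iff L2_norm_def)

lemma Z_inner_self_nonneg: "v \<in> Z a b (0, n) \<Longrightarrow> 0 \<le> Z_inner a b v v"
  using L2_inner_self_nonneg[of "snd v" n] Z0_inner[of v n v] by (simp add: Z_iff)

lemma bounded_form:
  assumes B: "has_adj (0, n) (0, n) B" "bounded_op n B"
  shows "\<exists>C\<ge>0. \<forall>v\<in>Z a b (0, n). \<bar>Z_inner a b v (B v)\<bar> \<le> C * Z_inner a b v v"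
proof -
  obtain C where C: "0 \<le> C" "\<forall>v\<in>Z a b (0, n). Z_inner a b (B v) (B v) \<le> C * Z_inner a b v v"
    using B(2) unfolding bounded_op_def by blast
  have "\<bar>Z_inner a b v (B v)\<bar> \<le> sqrt C * Z_inner a b v v" if v: "v \<in> Z a b (0, n)" for v
  proof -
    have "\<bar>Z_inner a b v (B v)\<bar> \<le> sqrt (Z_inner a b v v) * sqrt (Z_inner a b (B v) (B v))"
      by (rule Z_Cauchy_Schwarz[OF v has_adj_Z[OF B(1) v]])
    also have "\<dots> \<le> sqrt (Z_inner a b v v) * sqrt (C * Z_inner a b v v)"
      using C(2) v Z_inner_self_nonneg[OF v] by (intro mult_left_mono real_sqrt_le_mono) simp_all
    also have "\<dots> = sqrt C * Z_inner a b v v"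
      using Z_inner_self_nonneg[OF v] by (simp add: real_sqrt_mult)
    finally show ?thesis .
  qed
  then show ?thesis using C(1) by (intro exI[of _ "sqrt C"]) simp
qed

text \<open>The square is expanded, and the mixed term is controlled by
  \<open>bounded_form\<close>.\<close>

lemma bounded_op_id_sub:
  assumes S: "has_adj (0, n) (0, n) S" "bounded_op n S"
  shows "bounded_op n (id \<ominus>\<^sub>o S)"
proof -
  obtain C where C: "0 \<le> C" "\<forall>v\<in>Z a b (0, n). Z_inner a b (S v) (S v) \<le> C * Z_inner a b v v"
    using S(2) unfolding bounded_op_def by blast
  obtain D where D: "0 \<le> D" "\<forall>v\<in>Z a b (0, n). \<bar>Z_inner a b v (S v)\<bar> \<le> D * Z_inner a b v v"
    using bounded_form[OF S] by blast
  have "Z_inner a b ((id \<ominus>\<^sub>o S) v) ((id \<ominus>\<^sub>o S) v) \<le> (1 + 2 * D + C) * Z_inner a b v v" if v: "v \<in> Z a b (0, n)" for v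
  proof -
    have Sv: "S v \<in> Z a b (0, n)" by (rule has_adj_Z[OF S(1) v])
    have idv: "id v \<in> Z a b (0, n)" using v by simp
    note sub = Z_op_sub[of id v "(0, n)" S, OF idv Sv]
    have "Z_inner a b ((id \<ominus>\<^sub>o S) v) ((id \<ominus>\<^sub>o S) v)
        = Z_inner a b ((id \<ominus>\<^sub>o S) v) v - Z_inner a b ((id \<ominus>\<^sub>o S) v) (S v)"
      using Z_inner_op_sub[of "(id \<ominus>\<^sub>o S) v" "(0, n)" id v S, OF sub idv Sv] by simp
    also have "\<dots> = (Z_inner a b v v - Z_inner a b (S v) v) - (Z_inner a b v (S v) - Z_inner a b (S v) (S v))"
      using Z_inner_op_sub_left[of v "(0, n)" id v S, OF v idv Sv] Z_inner_op_sub_left[of "S v" "(0, n)" id v S, OF Sv idv Sv]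
      by simp
    also have "\<dots> = Z_inner a b v v - 2 * Z_inner a b v (S v) + Z_inner a b (S v) (S v)"
      using Z_inner_commute[OF Sv v] by simp
    also have "\<dots> \<le> Z_inner a b v v + 2 * (D * Z_inner a b v v) + C * Z_inner a b v v"
    proof -
      have "- (D * Z_inner a b v v) \<le> Z_inner a b v (S v)" using D(2) v by (simp add: abs_le_iff minus_le_iff)
      moreover have "Z_inner a b (S v) (S v) \<le> C * Z_inner a b v v" using C(2) v by simp
      ultimately show ?thesis by linarith
    qed
    finally show ?thesis by (simp add: algebra_simps)
  qed
  then show ?thesis unfolding bounded_op_def using C(1) D(1) by (intro exI[of _ "1 + 2 * D + C"]) simp
qed

text \<open>The form is linear in each argument because \<open>N\<close> has an adjoint; \<open>N\<close> itself is linear only up to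
  almost everywhere equality.\<close>

lemma quadratic_form_deriv:
  assumes N: "has_adj (0, n) (0, n) N"
    and bd: "0 \<le> C" "\<And>r. r \<in> L2 a b n \<Longrightarrow> \<bar>Z_inner a b (of_L2 r) (N (of_L2 r))\<bar> \<le> C * (L2_norm a b r)\<^sup>2"
    and u: "\<And>s. 0 \<le> s \<Longrightarrow> u s \<in> L2 a b n" and g: "g \<in> L2 a b n" and t: "0 \<le> t"
    and lim: "((\<lambda>s. L2_norm a b (\<lambda>x. u s x - u t x - (s - t) \<cdot>\<^sub>v g x) / \<bar>s - t\<bar>) \<longlongrightarrow> 0) (at t within {0..})"
  shows "((\<lambda>s. Z_inner a b (of_L2 (u s)) (N (of_L2 (u s)))) has_real_derivative
    Z_inner a b (of_L2 g) (N (of_L2 (u t))) + Z_inner a b (of_L2 (u t)) (N (of_L2 g))) (at t within {0..})"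
proof -
  define \<beta> where "\<beta> f k = Z_inner a b (of_L2 f) (N (of_L2 k))" for f k
  obtain N' where N': "\<forall>v\<in>Z a b (0, n). N v \<in> Z a b (0, n)" "\<forall>w\<in>Z a b (0, n). N' w \<in> Z a b (0, n)"
    "\<forall>v\<in>Z a b (0, n). \<forall>w\<in>Z a b (0, n). Z_inner a b (N v) w = Z_inner a b v (N' w)"
    by (rule has_adjE[OF N])
  have NL: "snd (N (of_L2 k)) \<in> L2 a b n" "snd (N' (of_L2 k)) \<in> L2 a b n" if "k \<in> L2 a b n" for k
    using N'(1,2) of_L2_Z[OF that] by (auto simp: Z_iff)
  have \<beta>1: "\<beta> f k = L2_inner a b (snd (N (of_L2 k))) f" if "f \<in> L2 a b n" "k \<in> L2 a b n" for f k
  proof -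
    have "\<beta> f k = L2_inner a b f (snd (N (of_L2 k)))"
      unfolding \<beta>_def using N'(1) of_L2_Z[OF that(2)] by (simp add: Z0_inner[OF of_L2_Z[OF that(1)]])
    then show ?thesis using L2_inner_commute[OF that(1) NL(1)[OF that(2)]] by simp
  qed
  have \<beta>2: "\<beta> f k = L2_inner a b (snd (N' (of_L2 f))) k" if "f \<in> L2 a b n" "k \<in> L2 a b n" for f k
  proof -
    note fZ = of_L2_Z[OF that(1)] and kZ = of_L2_Z[OF that(2)]
    have "\<beta> f k = Z_inner a b (N (of_L2 k)) (of_L2 f)"
      unfolding \<beta>_def using N'(1) fZ kZ by (intro Z_inner_commute[where d = "(0, n)"]) simp_all
    also have "\<dots> = Z_inner a b (of_L2 k) (N' (of_L2 f))" using N'(3) fZ kZ by simp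
    also have "\<dots> = Z_inner a b (N' (of_L2 f)) (of_L2 k)"
      using N'(2) fZ kZ by (intro Z_inner_commute[where d = "(0, n)"]) simp_all
    also have "\<dots> = L2_inner a b (snd (N' (of_L2 f))) k"
      using N'(2) fZ by (simp add: Z0_inner[OF _ kZ])
    finally show ?thesis .
  qed
  have add1: "\<beta> (\<lambda>x. f x + f' x) k = \<beta> f k + \<beta> f' k" if "f \<in> L2 a b n" "f' \<in> L2 a b n" "k \<in> L2 a b n" for f f' k
    using that NL(1)[OF that(3)] by (simp add: \<beta>1 L2_add L2_inner_add_right[where n = n])
  have add2: "\<beta> k (\<lambda>x. f x + f' x) = \<beta> k f + \<beta> k f'" if "f \<in> L2 a b n" "f' \<in> L2 a b n" "k \<in> L2 a b n" for f f' k
    using that NL(2)[OF that(3)] by (simp add: \<beta>2 L2_add L2_inner_add_right[where n = n])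
  have sm1: "\<beta> (\<lambda>x. c \<cdot>\<^sub>v f x) k = c * \<beta> f k" if "f \<in> L2 a b n" "k \<in> L2 a b n" for f k c
    using that NL(1)[OF that(2)] by (simp add: \<beta>1 L2_smult L2_inner_smult_right[where n = n])
  have sm2: "\<beta> k (\<lambda>x. c \<cdot>\<^sub>v f x) = c * \<beta> k f" if "f \<in> L2 a b n" "k \<in> L2 a b n" for f k c
    using that NL(2)[OF that(2)] by (simp add: \<beta>2 L2_smult L2_inner_smult_right[where n = n])
  have cong: "\<beta> f f = \<beta> f' f'" if "f \<in> L2 a b n" "f' \<in> L2 a b n" "\<And>x. x \<in> {a..b} \<Longrightarrow> f x = f' x" for f f'
  proof -
    have "\<beta> f f = \<beta> f' f"
      unfolding \<beta>1[OF that(1,1)] \<beta>1[OF that(2,1)] by (rule L2_inner_cong) (use that(3) in simp_all)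
    also have "\<dots> = \<beta> f' f'"
      unfolding \<beta>2[OF that(2,1)] \<beta>2[OF that(2,2)] by (rule L2_inner_cong) (use that(3) in simp_all)
    finally show ?thesis .
  qed
  let ?f = "u t"
  have f: "?f \<in> L2 a b n" by (rule u[OF t])
  \<comment> \<open>For fixed k, Cauchy-Schwarz with N k in one pairing and \<open>N'\<close> k in
    the other bounds the mixed terms by a multiple of the norm of r.\<close>
  define K where "K k = L2_norm a b (snd (N (of_L2 k))) + L2_norm a b (snd (N' (of_L2 k)))" for k
  have K: "\<bar>\<beta> r k + \<beta> k r\<bar> \<le> K k * L2_norm a b r" if "r \<in> L2 a b n" "k \<in> L2 a b n" for r k
    using L2_Cauchy_Schwarz[OF NL(1)[OF that(2)] that(1)] L2_Cauchy_Schwarz[OF NL(2)[OF that(2)] that(1)]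
    unfolding \<beta>1[OF that] \<beta>2[OF that(2,1)] K_def distrib_right by linarith
  define D where "D = \<beta> g ?f + \<beta> ?f g"
  define \<rho> where "\<rho> s = L2_norm a b (\<lambda>x. u s x - u t x - (s - t) \<cdot>\<^sub>v g x) / \<bar>s - t\<bar>" for s
  have est: "\<bar>(\<beta> (u s) (u s) - \<beta> ?f ?f) / (s - t) - D\<bar>
      \<le> \<bar>s - t\<bar> * \<bar>\<beta> g g\<bar> + K ?f * \<rho> s + \<bar>s - t\<bar> * (K g * \<rho> s) + C * (\<rho> s)\<^sup>2 * \<bar>s - t\<bar>"
    if s: "0 \<le> s" "s \<noteq> t" for s
  proof -
    define d where "d = s - t"
    have d: "d \<noteq> 0" using s(2) by (simp add: d_def)
    \<comment> \<open>u(s) = q + r, where q is the linear extrapolation from t and r the Frechet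
      remainder, of norm \<rho>(s) |d|. The four error terms come from the square of g, the pairings
      of r with u(t) and with g, and the square of r.\<close>
    define r where "r = (\<lambda>x. u s x - u t x - d \<cdot>\<^sub>v g x)"
    define q where "q = (\<lambda>x. ?f x + d \<cdot>\<^sub>v g x)"
    have dg: "(\<lambda>x. d \<cdot>\<^sub>v g x) \<in> L2 a b n" by (rule L2_smult[OF g])
    have r: "r \<in> L2 a b n" unfolding r_def by (rule L2_diff[OF L2_diff[OF u[OF s(1)] f] dg])
    have q: "q \<in> L2 a b n" unfolding q_def by (rule L2_add[OF f dg])
    have nr: "L2_norm a b r = \<rho> s * \<bar>d\<bar>" using d by (simp add: r_def \<rho>_def d_def)
    have "\<beta> (u s) (u s) = \<beta> (\<lambda>x. q x + r x) (\<lambda>x. q x + r x)"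
    proof (rule cong[OF u[OF s(1)] L2_add[OF q r]])
      fix x assume "x \<in> {a..b}"
      then have "u s x \<in> carrier_vec n" "u t x \<in> carrier_vec n" "g x \<in> carrier_vec n"
        by (auto intro: L2_carrier[OF u[OF s(1)]] L2_carrier[OF f] L2_carrier[OF g])
      then show "u s x = q x + r x" unfolding q_def r_def by (intro eq_vecI) auto
    qed
    also have "\<dots> = \<beta> q q + (\<beta> r q + \<beta> q r) + \<beta> r r"
      by (simp add: add1[OF q r L2_add[OF q r]] add2[OF q r q] add2[OF q r r])
    also have "\<beta> q q = \<beta> ?f ?f + d * D + d\<^sup>2 * \<beta> g g"
    proof -
      have "\<beta> q q = \<beta> ?f q + d * \<beta> g q"
        unfolding q_def by (simp add: add1[OF f dg q[unfolded q_def]] sm1[OF g q[unfolded q_def]])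
      also have "\<beta> ?f q = \<beta> ?f ?f + d * \<beta> ?f g" unfolding q_def by (simp add: add2[OF f dg f] sm2[OF g f])
      also have "\<beta> g q = \<beta> g ?f + d * \<beta> g g" unfolding q_def by (simp add: add2[OF f dg g] sm2[OF g g])
      finally show ?thesis by (simp add: D_def algebra_simps power2_eq_square)
    qed
    also have "\<beta> r q + \<beta> q r = (\<beta> r ?f + \<beta> ?f r) + d * (\<beta> r g + \<beta> g r)"
      unfolding q_def by (simp add: add1[OF f dg r] add2[OF f dg r] sm1[OF g r] sm2[OF g r] algebra_simps)
    finally have "(\<beta> (u s) (u s) - \<beta> ?f ?f) / d - D
        = d * \<beta> g g + (\<beta> r ?f + \<beta> ?f r) / d + (\<beta> r g + \<beta> g r) + \<beta> r r / d"
      using d by (simp add: field_simps power2_eq_square)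
    then have "\<bar>(\<beta> (u s) (u s) - \<beta> ?f ?f) / d - D\<bar>
        \<le> \<bar>d\<bar> * \<bar>\<beta> g g\<bar> + \<bar>\<beta> r ?f + \<beta> ?f r\<bar> / \<bar>d\<bar> + \<bar>\<beta> r g + \<beta> g r\<bar> + \<bar>\<beta> r r\<bar> / \<bar>d\<bar>"
      by (simp only: abs_mult[symmetric] abs_divide[symmetric])
    also have "\<dots> \<le> \<bar>d\<bar> * \<bar>\<beta> g g\<bar> + (K ?f * L2_norm a b r) / \<bar>d\<bar> + K g * L2_norm a b r + (C * (L2_norm a b r)\<^sup>2) / \<bar>d\<bar>"
      using bd(2)[OF r] unfolding \<beta>_def[symmetric]
      by (intro add_mono order_refl divide_right_mono K r f g) simp_all
    also have "\<dots> = \<bar>d\<bar> * \<bar>\<beta> g g\<bar> + K ?f * \<rho> s + \<bar>d\<bar> * (K g * \<rho> s) + C * (\<rho> s)\<^sup>2 * \<bar>d\<bar>"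
      unfolding nr using d by (simp add: field_simps power2_eq_square)
    finally show ?thesis unfolding d_def .
  qed
  have t0: "((\<lambda>s. \<bar>s - t\<bar>) \<longlongrightarrow> 0) (at t within {0..})"
  proof -
    have "((\<lambda>s. \<bar>s - t\<bar>) \<longlongrightarrow> \<bar>t - t\<bar>) (at t within {0..})"
      by (intro tendsto_rabs tendsto_diff tendsto_ident_at tendsto_const)
    then show ?thesis by simp
  qed
  have \<rho>0: "(\<rho> \<longlongrightarrow> 0) (at t within {0..})" using lim unfolding \<rho>_def .
  have bnd: "((\<lambda>s. \<bar>s - t\<bar> * \<bar>\<beta> g g\<bar> + K ?f * \<rho> s + \<bar>s - t\<bar> * (K g * \<rho> s) + C * (\<rho> s)\<^sup>2 * \<bar>s - t\<bar>) \<longlongrightarrow> 0) (at t within {0..})"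
  proof -
    have "((\<lambda>s. \<bar>s - t\<bar> * \<bar>\<beta> g g\<bar> + K ?f * \<rho> s + \<bar>s - t\<bar> * (K g * \<rho> s) + C * (\<rho> s)\<^sup>2 * \<bar>s - t\<bar>)
        \<longlongrightarrow> 0 * \<bar>\<beta> g g\<bar> + K ?f * 0 + 0 * (K g * 0) + C * 0\<^sup>2 * 0) (at t within {0..})"
      by (intro tendsto_add tendsto_mult tendsto_power tendsto_const t0 \<rho>0)
    then show ?thesis by simp
  qed
  have "eventually (\<lambda>s. norm ((\<beta> (u s) (u s) - \<beta> ?f ?f) / (s - t) - D)
      \<le> \<bar>s - t\<bar> * \<bar>\<beta> g g\<bar> + K ?f * \<rho> s + \<bar>s - t\<bar> * (K g * \<rho> s) + C * (\<rho> s)\<^sup>2 * \<bar>s - t\<bar>) (at t within {0..})"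
    unfolding eventually_at_filter using est by (intro always_eventually) simp
  then have "((\<lambda>s. (\<beta> (u s) (u s) - \<beta> ?f ?f) / (s - t) - D) \<longlongrightarrow> 0) (at t within {0..})"
    by (rule Lim_null_comparison[OF _ bnd])
  then have "((\<lambda>s. (\<beta> (u s) (u s) - \<beta> ?f ?f) / (s - t)) \<longlongrightarrow> D) (at t within {0..})"
    by (simp only: LIM_zero_iff)
  then show ?thesis unfolding has_field_derivative_iff D_def \<beta>_def .
qed

text \<open>With the integrating factor exp (2 \<alpha> s) the differential inequality says that W
  is nonincreasing.\<close>

lemma exponential_decay:
  fixes V D :: "real \<Rightarrow> real"
  assumes deriv: "\<And>s. 0 \<le> s \<Longrightarrow> (V has_real_derivative D s) (at s within {0..})"
    and le: "\<And>s. 0 \<le> s \<Longrightarrow> D s \<le> - 2 * \<alpha> * V s" and t: "0 \<le> t"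
  shows "V t \<le> exp (- 2 * \<alpha> * t) * V 0"
proof -
  define W where "W s = exp (2 * \<alpha> * s) * V s" for s
  have W: "(W has_real_derivative (2 * \<alpha> * exp (2 * \<alpha> * s) * V s + exp (2 * \<alpha> * s) * D s)) (at s within {0..})" if "0 \<le> s" for s
  proof -
    have "((\<lambda>s. exp (2 * \<alpha> * s)) has_real_derivative exp (2 * \<alpha> * s) * (2 * \<alpha>)) (at s within {0..})"
      by (auto intro!: derivative_eq_intros)
    from DERIV_mult[OF this deriv[OF that]] show ?thesis
      unfolding W_def by (rule DERIV_cong) (simp add: algebra_simps)
  qed
  \<comment> \<open>At 0 only a one-sided derivative is available, so monotonicity is taken from the
    open interval together with continuity on [0, t].\<close>
  have "W t \<le> W 0"
  proof (rule DERIV_nonpos_imp_decreasing_open[OF t])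
    fix s assume s: "0 < s" "s < t"
    have "(W has_real_derivative (2 * \<alpha> * exp (2 * \<alpha> * s) * V s + exp (2 * \<alpha> * s) * D s)) (at s)"
    proof -
      have "s \<in> interior {0..}" using s(1) by (intro interiorI[of "{0<..}"]) auto
      then show ?thesis using W[of s] s(1) by (simp only: at_within_interior less_imp_le)
    qed
    moreover have "2 * \<alpha> * exp (2 * \<alpha> * s) * V s + exp (2 * \<alpha> * s) * D s \<le> 0"
      using mult_left_mono[OF le[of s], of "exp (2 * \<alpha> * s)"] s by (simp add: algebra_simps)
    ultimately show "\<exists>y. (W has_real_derivative y) (at s) \<and> y \<le> 0" by blast
  next
    have "continuous_on {0..} W" using W by (intro DERIV_continuous_on) auto
    then show "continuous_on {0..t} W" by (rule continuous_on_subset) auto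
  qed
  then have "exp (- 2 * \<alpha> * t) * (exp (2 * \<alpha> * t) * V t) \<le> exp (- 2 * \<alpha> * t) * V 0"
    unfolding W_def by (intro mult_left_mono) simp_all
  moreover have "exp (- 2 * \<alpha> * t) * exp (2 * \<alpha> * t) = 1" by (subst exp_add[symmetric]) simp
  then have "exp (- 2 * \<alpha> * t) * (exp (2 * \<alpha> * t) * V t) = V t" by (simp only: mult.assoc[symmetric] mult_1_left)
  ultimately show ?thesis by (simp only:)
qed

text \<open>By symmetry of the inner products, B is an adjoint of its own adjoint.\<close>

lemma has_adj_adj:
  assumes B: "has_adj d e B"
  shows "has_adj e d (adj a b d e B)"
proof (rule has_adjI[where B' = B])
  show "\<forall>w\<in>Z a b e. adj a b d e B w \<in> Z a b d" using adj_Z[OF B] by simp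
  show "\<forall>v\<in>Z a b d. B v \<in> Z a b e" using has_adj_Z[OF B] by simp
  show "\<forall>w\<in>Z a b e. \<forall>v\<in>Z a b d. Z_inner a b (adj a b d e B w) v = Z_inner a b w (B v)"
  proof (intro ballI)
    fix w v assume w: "w \<in> Z a b e" and v: "v \<in> Z a b d"
    show "Z_inner a b (adj a b d e B w) v = Z_inner a b w (B v)"
      using Z_inner_commute[OF adj_Z[OF B w] v] Z_inner_adj[OF B v w] Z_inner_commute[OF has_adj_Z[OF B v] w] by simp
  qed
qed

lemma id_sub_cong:
  assumes S: "S \<in> PI_ops a b (m, n) (m, n)" and v: "v \<in> Z a b (m, n)" and w: "w \<in> Z a b (m, n)" and eq: "Z_eq a b v w"
  shows "Z_eq a b ((id \<ominus>\<^sub>o S) v) ((id \<ominus>\<^sub>o S) w)"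
proof -
  have "AE x in M. snd v x = snd w x" "AE x in M. snd (S v) x = snd (S w) x"
    using eq PI_ops_cong[OF S v w eq] by (simp_all add: Z_eq_def L2_eq_def)
  then have "AE x in M. snd v x - snd (S v) x = snd w x - snd (S w) x" by eventually_elim simp
  then show ?thesis using eq PI_ops_cong[OF S v w eq] by (simp add: Z_eq_def L2_eq_def op_sub_def)
qed

text \<open>The function component has dimension 0 and contributes an empty sum. Applied with k = K
  v, this annihilates both terms with X.\<close>

lemma Z_inner_fst_zero:
  assumes "k \<in> Z a b (m, 0)" "w \<in> Z a b (m, 0)" "fst k = 0\<^sub>v m"
  shows "Z_inner a b k w = 0"
proof -
  have "L2_inner a b (snd k) (snd w) = 0"
    using assms(1,2) by (subst L2_inner_eq[where n = 0]) (simp_all add: Z_iff)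
  moreover have "fst w \<in> carrier_vec m" using assms(2) by (simp add: Z_iff)
  ultimately show ?thesis using assms(3) by (simp add: Z_inner_def)
qed

text \<open>Transfers the Frechet limit from the Sobolev norm to the L2 norm, in which the Lyapunov
  functional is bounded.\<close>

lemma L2_norm_le_W22_norm:
  assumes "e \<in> L2 a b n"
  shows "L2_norm a b e \<le> W22_norm a b n e"
  unfolding W22_norm_def using L2_norm_nonneg[OF assms] by (intro real_le_rsqrt) simp

end

section \<open>The Lyapunov estimate along solutions\<close>

context pde_setting
begin

lemma exponential_stability:
  assumes A0: "A0 \<in> carrier_mat n n" and A1: "A1 \<in> carrier_mat n n" and A2: "A2 \<in> carrier_mat n n"
    and S: "S \<in> PI_ops a b (0, n) (0, n)" and P: "P \<in> PI_ops a b (0, n) (0, n)"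
    and X: "X \<in> PI_ops a b (m, n) (m, 0)"
    and T_def: "T = T_op a b n m G H" and A_def: "A = A_op a b n m A0 A1 A2 G H" and K_def: "K = K_op a b n m E2 F2"
    and Tt_def: "Tt = (id \<ominus>\<^sub>o S) \<circ> T" and At_def: "At = (id \<ominus>\<^sub>o S) \<circ> A"
    and \<epsilon>: "0 < \<epsilon>" and coercive: "op_le a b (0, n) (\<epsilon>\<^sup>2 \<odot>\<^sub>o id) P"
    and ineq: "op_le a b (m, n)
      ((adj a b (m, n) (0, n) At \<circ> P \<circ> Tt) \<oplus>\<^sub>o (adj a b (m, n) (0, n) Tt \<circ> P \<circ> At))
      ((- 2 * \<alpha>) \<odot>\<^sub>o (adj a b (m, n) (0, n) Tt \<circ> P \<circ> Tt)
        \<ominus>\<^sub>o (X \<circ> K)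
        \<ominus>\<^sub>o (adj a b (m, n) (m, 0) K \<circ> adj a b (m, 0) (m, n) X))"
  shows "\<exists>M::real. \<forall>u0\<in>X_space a b n E F. \<forall>u. pde_solution a b n A0 A1 A2 E F u0 u \<longrightarrow>
    (\<forall>t\<ge>0. L2_norm a b (\<lambda>x. u t x - snd (S (of_L2 (u t))) x)
      \<le> M * exp (- \<alpha> * t) * L2_norm a b (\<lambda>x. u 0 x - snd (S (of_L2 (u 0))) x))"
proof -
  let ?W = "id \<ominus>\<^sub>o S"
  have adS: "has_adj (0, n) (0, n) S" and adP: "has_adj (0, n) (0, n) P" and adX: "has_adj (m, 0) (m, n) X"
    by (rule has_adj_PI[OF S] has_adj_PI[OF P] has_adj_PI[OF X])+
  have adW: "has_adj (0, n) (0, n) ?W" by (rule has_adj_sub[OF has_adj_id adS])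
  have adT: "has_adj (m, n) (0, n) T" unfolding T_def by (rule has_adj_T_op)
  have adA: "has_adj (m, n) (0, n) A" unfolding A_def by (rule has_adj_A_op[OF A0 A1 A2])
  have adK: "has_adj (m, n) (m, 0) K" unfolding K_def by (rule has_adj_K)
  have adTt: "has_adj (m, n) (0, n) Tt" unfolding Tt_def by (rule has_adj_comp[OF adT adW])
  have adAt: "has_adj (m, n) (0, n) At" unfolding At_def by (rule has_adj_comp[OF adA adW])
  note WZ = has_adj_Z[OF adW] and PZ = has_adj_Z[OF adP]
  \<comment> \<open>With the weight pulled back by I - S, \<open>V s\<close> is a form in
    \<open>u s\<close> and its derivative involves \<open>ut s\<close> directly.\<close>
  define N where "N = adj a b (0, n) (0, n) ?W \<circ> (P \<circ> ?W)"
  have adN: "has_adj (0, n) (0, n) N"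
    unfolding N_def by (rule has_adj_comp[OF has_adj_comp[OF adW adP] has_adj_adj[OF adW]])
  have N: "Z_inner a b f (N k) = Z_inner a b (?W f) (P (?W k))" if "f \<in> Z a b (0, n)" "k \<in> Z a b (0, n)" for f k
    unfolding N_def o_apply by (rule Z_inner_adj[OF adW that(1) PZ[OF WZ[OF that(2)]]])
  have bS: "bounded_op n S" and bP: "bounded_op n P"
    unfolding bounded_op_def by (rule PI_ops_bounded[OF S] PI_ops_bounded[OF P])+
  obtain CP where CP: "0 \<le> CP" "\<forall>v\<in>Z a b (0, n). \<bar>Z_inner a b v (P v)\<bar> \<le> CP * Z_inner a b v v"
    using bounded_form[OF adP bP] by blast
  obtain CW where CW: "0 \<le> CW" "\<forall>v\<in>Z a b (0, n). Z_inner a b (?W v) (?W v) \<le> CW * Z_inner a b v v"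
    using bounded_op_id_sub[OF adS bS] unfolding bounded_op_def by blast
  \<comment> \<open>This controls the square of the Frechet remainder in
    \<open>quadratic_form_deriv\<close>.\<close>
  have bN: "\<bar>Z_inner a b (of_L2 r) (N (of_L2 r))\<bar> \<le> CP * CW * (L2_norm a b r)\<^sup>2" if r: "r \<in> L2 a b n" for r
  proof -
    note rZ = of_L2_Z[OF r]
    have "\<bar>Z_inner a b (?W (of_L2 r)) (P (?W (of_L2 r)))\<bar> \<le> CP * Z_inner a b (?W (of_L2 r)) (?W (of_L2 r))"
      using CP(2) WZ[OF rZ] by blast
    also have "\<dots> \<le> CP * (CW * Z_inner a b (of_L2 r) (of_L2 r))"
      using CW(2) rZ CP(1) by (intro mult_left_mono) blast+
    finally show ?thesis
      unfolding N[OF rZ rZ] Z_inner_of_L2[OF r r] L2_norm_sq[OF r] by (simp only: mult.assoc)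
  qed
  have main: "L2_norm a b (\<lambda>x. u t x - snd (S (of_L2 (u t))) x)
      \<le> sqrt CP / \<epsilon> * exp (- \<alpha> * t) * L2_norm a b (\<lambda>x. u 0 x - snd (S (of_L2 (u 0))) x)"
    if sol: "pde_solution a b n A0 A1 A2 E F u0 u" and t: "0 \<le> t" for u0 u t
  proof -
    have uX: "u s \<in> X_space a b n E F" if "0 \<le> s" for s
      using sol that by (simp add: pde_solution_def)
    obtain ut where ut: "\<forall>t\<ge>0. ut t \<in> X_space a b n E F \<and>
        ((\<lambda>s. W22_norm a b n (\<lambda>x. u s x - u t x - (s - t) \<cdot>\<^sub>v ut t x) / \<bar>s - t\<bar>) \<longlongrightarrow> 0)
          (at t within {0..}) \<and>
        L2_eq a b (ut t) (\<lambda>x. pmat_at A0 x *\<^sub>v u t x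
          + pmat_at A1 x *\<^sub>v wderiv a b n (u t) x
          + pmat_at A2 x *\<^sub>v wderiv a b n (wderiv a b n (u t)) x)"
      using sol unfolding pde_solution_def by blast
    have uL: "u s \<in> L2 a b n" and utL: "ut s \<in> L2 a b n" if "0 \<le> s" for s
      using uX[OF that] ut that by (simp_all add: X_space_def W22_def)
    define V where "V s = Z_inner a b (of_L2 (u s)) (N (of_L2 (u s)))" for s
    define D where "D s = Z_inner a b (of_L2 (ut s)) (N (of_L2 (u s))) + Z_inner a b (of_L2 (u s)) (N (of_L2 (ut s)))" for s
    have deriv: "(V has_real_derivative D s) (at s within {0..})" if s: "0 \<le> s" for s
      unfolding V_def D_def
    proof (rule quadratic_form_deriv[OF adN _ bN uL utL[OF s] s])
      show "0 \<le> CP * CW" using CP(1) CW(1) by simp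
      let ?e = "\<lambda>r x. u r x - u s x - (r - s) \<cdot>\<^sub>v ut s x"
      have lim: "((\<lambda>r. W22_norm a b n (?e r) / \<bar>r - s\<bar>) \<longlongrightarrow> 0) (at s within {0..})" using ut s by blast
      have "norm (L2_norm a b (?e r) / \<bar>r - s\<bar>) \<le> W22_norm a b n (?e r) / \<bar>r - s\<bar>" if "0 \<le> r" for r
      proof -
        have e: "?e r \<in> L2 a b n" by (rule L2_diff[OF L2_diff[OF uL[OF that] uL[OF s]] L2_smult[OF utL[OF s]]])
        show ?thesis
          using L2_norm_nonneg[OF e] divide_right_mono[OF L2_norm_le_W22_norm[OF e], of "\<bar>r - s\<bar>"] by simp
      qed
      then have "eventually (\<lambda>r. norm (L2_norm a b (?e r) / \<bar>r - s\<bar>) \<le> W22_norm a b n (?e r) / \<bar>r - s\<bar>) (at s within {0..})"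
        unfolding eventually_at_filter by (intro always_eventually) simp
      then show "((\<lambda>r. L2_norm a b (?e r) / \<bar>r - s\<bar>) \<longlongrightarrow> 0) (at s within {0..})"
        by (rule Lim_null_comparison[OF _ lim])
    qed
    have decay: "D s \<le> - 2 * \<alpha> * V s" if s: "0 \<le> s" for s
    proof -
      define v where "v = (boundary_value (u s), wderiv a b n (wderiv a b n (u s)))"
      note rep = state_representation[OF uX[OF s], folded v_def]
      note v = rep(1)
      note usZ = of_L2_Z[OF uL[OF s]] and utZ = of_L2_Z[OF utL[OF s]]
      have Tv: "T v \<in> Z a b (0, n)" and Av: "A v \<in> Z a b (0, n)"
        by (rule has_adj_Z[OF adT v] has_adj_Z[OF adA v])+
      have Teq: "Z_eq a b (T v) (of_L2 (u s))"
        using rep(3) by (simp add: Z_eq_def T_def T_op_def of_L2_def)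
      \<comment> \<open>T v, R v and the second component of v represent u, u_x and u_xx, so A v is
        the right-hand side of the PDE.\<close>
      have Aeq: "Z_eq a b (A v) (of_L2 (ut s))"
      proof -
        have "AE x in M. snd (T_op a b n m G H v) x = u s x"
          "AE x in M. snd (R_op a b n m G H v) x = wderiv a b n (u s) x"
          "AE x in M. ut s x = pmat_at A0 x *\<^sub>v u s x
          + pmat_at A1 x *\<^sub>v wderiv a b n (u s) x
          + pmat_at A2 x *\<^sub>v wderiv a b n (wderiv a b n (u s)) x"
          using rep(3,4) ut s by (simp_all add: L2_eq_def)
        then have "AE x in M. snd (A v) x = ut s x"
          by eventually_elim (simp add: A_def A_op_def v_def)
        then show ?thesis by (simp add: Z_eq_def L2_eq_def A_def A_op_def of_L2_def)
      qed
      have Tt: "Tt v \<in> Z a b (0, n)" and At: "At v \<in> Z a b (0, n)"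
        by (rule has_adj_Z[OF adTt v] has_adj_Z[OF adAt v])+
      have Tteq: "Z_eq a b (Tt v) (?W (of_L2 (u s)))" and Ateq: "Z_eq a b (At v) (?W (of_L2 (ut s)))"
        unfolding Tt_def At_def o_apply by (rule id_sub_cong[OF S Tv usZ Teq] id_sub_cong[OF S Av utZ Aeq])+
      note PTteq = PI_ops_cong[OF P Tt WZ[OF usZ] Tteq] and PAteq = PI_ops_cong[OF P At WZ[OF utZ] Ateq]
      have form1: "Z_inner a b (At v) (P (Tt v)) = Z_inner a b (of_L2 (ut s)) (N (of_L2 (u s)))"
        unfolding N[OF utZ usZ] by (rule Z_inner_cong[OF At WZ[OF utZ] PZ[OF Tt] PZ[OF WZ[OF usZ]] Ateq PTteq])
      have form2: "Z_inner a b (Tt v) (P (At v)) = Z_inner a b (of_L2 (u s)) (N (of_L2 (ut s)))"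
        unfolding N[OF usZ utZ] by (rule Z_inner_cong[OF Tt WZ[OF usZ] PZ[OF At] PZ[OF WZ[OF utZ]] Tteq PAteq])
      have form3: "Z_inner a b (Tt v) (P (Tt v)) = V s"
        unfolding V_def N[OF usZ usZ] by (rule Z_inner_cong[OF Tt WZ[OF usZ] PZ[OF Tt] PZ[OF WZ[OF usZ]] Tteq PTteq])
      have Kv: "K v \<in> Z a b (m, 0)" "fst (K v) = 0\<^sub>v m"
        using has_adj_Z[OF adK v] rep(2) by (simp_all add: K_def)
      have XvZ: "adj a b (m, 0) (m, n) X v \<in> Z a b (m, 0)" by (rule adj_Z[OF adX v])
      have XKZ: "X (K v) \<in> Z a b (m, n)" by (rule has_adj_Z[OF adX Kv(1)])
      \<comment> \<open>X is moved onto v by its adjoint, which leaves an inner product with K v =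
        0.\<close>
      have XK: "Z_inner a b v (X (K v)) = 0"
        using Z_inner_commute[OF v XKZ] Z_inner_adj[OF adX Kv(1) v] Z_inner_fst_zero[OF Kv(1) XvZ Kv(2)] by simp
      have KX: "Z_inner a b v (adj a b (m, n) (m, 0) K (adj a b (m, 0) (m, n) X v)) = 0"
        using Z_inner_adj[OF adK v XvZ] Z_inner_fst_zero[OF Kv(1) XvZ Kv(2)] by simp
      let ?L1 = "adj a b (m, n) (0, n) At \<circ> P \<circ> Tt" and ?L2 = "adj a b (m, n) (0, n) Tt \<circ> P \<circ> At"
        and ?L3 = "adj a b (m, n) (0, n) Tt \<circ> P \<circ> Tt"
        and ?L4 = "X \<circ> K" and ?L5 = "adj a b (m, n) (m, 0) K \<circ> adj a b (m, 0) (m, n) X"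
      have Z1: "?L1 v \<in> Z a b (m, n)" and Z2: "?L2 v \<in> Z a b (m, n)" and Z3: "?L3 v \<in> Z a b (m, n)"
        and Z4: "?L4 v \<in> Z a b (m, n)" and Z5: "?L5 v \<in> Z a b (m, n)"
        unfolding o_apply by (rule adj_Z[OF adAt PZ[OF Tt]] adj_Z[OF adTt PZ[OF At]] adj_Z[OF adTt PZ[OF Tt]]
            XKZ adj_Z[OF adK XvZ])+
      let ?L6 = "(- 2 * \<alpha>) \<odot>\<^sub>o ?L3"
      have Z6: "?L6 v \<in> Z a b (m, n)" using Z3 by (rule Z_op_scale)
      have Z64: "(?L6 \<ominus>\<^sub>o ?L4) v \<in> Z a b (m, n)" using Z6 Z4 by (rule Z_op_sub)
      have Z645: "(?L6 \<ominus>\<^sub>o ?L4 \<ominus>\<^sub>o ?L5) v \<in> Z a b (m, n)" using Z64 Z5 by (rule Z_op_sub)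
      have Z12: "(?L1 \<oplus>\<^sub>o ?L2) v \<in> Z a b (m, n)" using Z1 Z2 by (rule Z_op_add)
      have "Z_inner a b v (((?L6 \<ominus>\<^sub>o ?L4 \<ominus>\<^sub>o ?L5) \<ominus>\<^sub>o (?L1 \<oplus>\<^sub>o ?L2)) v)
          = Z_inner a b v ((?L6 \<ominus>\<^sub>o ?L4 \<ominus>\<^sub>o ?L5) v) - Z_inner a b v ((?L1 \<oplus>\<^sub>o ?L2) v)"
        using v Z645 Z12 by (rule Z_inner_op_sub)
      moreover have "Z_inner a b v ((?L6 \<ominus>\<^sub>o ?L4 \<ominus>\<^sub>o ?L5) v) = Z_inner a b v ((?L6 \<ominus>\<^sub>o ?L4) v) - Z_inner a b v (?L5 v)"
        using v Z64 Z5 by (rule Z_inner_op_sub)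
      moreover have "Z_inner a b v ((?L6 \<ominus>\<^sub>o ?L4) v) = Z_inner a b v (?L6 v) - Z_inner a b v (?L4 v)"
        using v Z6 Z4 by (rule Z_inner_op_sub)
      moreover have "Z_inner a b v (?L6 v) = - 2 * \<alpha> * Z_inner a b v (?L3 v)"
        using v Z3 by (rule Z_inner_op_scale)
      moreover have "Z_inner a b v ((?L1 \<oplus>\<^sub>o ?L2) v) = Z_inner a b v (?L1 v) + Z_inner a b v (?L2 v)"
        using v Z1 Z2 by (rule Z_inner_op_add)
      \<comment> \<open>The operator inequality is evaluated at the state v of the solution.\<close>
      moreover have "0 \<le> Z_inner a b v (((?L6 \<ominus>\<^sub>o ?L4 \<ominus>\<^sub>o ?L5) \<ominus>\<^sub>o (?L1 \<oplus>\<^sub>o ?L2)) v)"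
        using ineq v unfolding op_le_def by blast
      ultimately have "0 \<le> - 2 * \<alpha> * Z_inner a b v (?L3 v) - Z_inner a b v (?L4 v) - Z_inner a b v (?L5 v)
          - (Z_inner a b v (?L1 v) + Z_inner a b v (?L2 v))"
        by (simp only:)
      also have "\<dots> = - 2 * \<alpha> * V s - D s"
        unfolding o_apply Z_inner_adj[OF adAt v PZ[OF Tt]] Z_inner_adj[OF adTt v PZ[OF At]]
          Z_inner_adj[OF adTt v PZ[OF Tt]] XK KX form1 form2 form3 D_def by simp
      finally show ?thesis by linarith
    qed
    let ?w = "\<lambda>s. \<lambda>x. u s x - snd (S (of_L2 (u s))) x"
    have w: "snd (?W (of_L2 (u s))) = ?w s" for s
      by (simp add: op_sub_def)
    \<comment> \<open>Coercivity of P gives the lower bound and boundedness of its form the upper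
      one, both at (I - S) u.\<close>
    have wL: "?w s \<in> L2 a b n" and wn: "Z_inner a b (?W (of_L2 (u s))) (?W (of_L2 (u s))) = (L2_norm a b (?w s))\<^sup>2"
      and lower: "\<epsilon>\<^sup>2 * (L2_norm a b (?w s))\<^sup>2 \<le> V s" and upper: "V s \<le> CP * (L2_norm a b (?w s))\<^sup>2"
      if s: "0 \<le> s" for s
    proof -
      note usZ = of_L2_Z[OF uL[OF s]]
      have WuZ: "?W (of_L2 (u s)) \<in> Z a b (0, n)" by (rule WZ[OF usZ])
      then show wL: "?w s \<in> L2 a b n" unfolding w[symmetric] by (simp add: Z_iff)
      show wn: "Z_inner a b (?W (of_L2 (u s))) (?W (of_L2 (u s))) = (L2_norm a b (?w s))\<^sup>2"
        unfolding Z0_inner[OF WuZ WuZ] w L2_norm_sq[OF wL] ..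
      have idZ: "id (?W (of_L2 (u s))) \<in> Z a b (0, n)" using WuZ by simp
      have "0 \<le> Z_inner a b (?W (of_L2 (u s))) ((P \<ominus>\<^sub>o \<epsilon>\<^sup>2 \<odot>\<^sub>o id) (?W (of_L2 (u s))))"
        using coercive WuZ unfolding op_le_def by blast
      also have "\<dots> = Z_inner a b (?W (of_L2 (u s))) (P (?W (of_L2 (u s)))) - \<epsilon>\<^sup>2 * (L2_norm a b (?w s))\<^sup>2"
      proof -
        have eZ: "(\<epsilon>\<^sup>2 \<odot>\<^sub>o id) (?W (of_L2 (u s))) \<in> Z a b (0, n)" using idZ by (rule Z_op_scale)
        have "Z_inner a b (?W (of_L2 (u s))) ((P \<ominus>\<^sub>o \<epsilon>\<^sup>2 \<odot>\<^sub>o id) (?W (of_L2 (u s))))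
            = Z_inner a b (?W (of_L2 (u s))) (P (?W (of_L2 (u s)))) - Z_inner a b (?W (of_L2 (u s))) ((\<epsilon>\<^sup>2 \<odot>\<^sub>o id) (?W (of_L2 (u s))))"
          using WuZ PZ[OF WuZ] eZ by (rule Z_inner_op_sub)
        also have "Z_inner a b (?W (of_L2 (u s))) ((\<epsilon>\<^sup>2 \<odot>\<^sub>o id) (?W (of_L2 (u s)))) = \<epsilon>\<^sup>2 * Z_inner a b (?W (of_L2 (u s))) (id (?W (of_L2 (u s))))"
          using WuZ idZ by (rule Z_inner_op_scale)
        finally show ?thesis unfolding id_apply[of "?W (of_L2 (u s))"] wn .
      qed
      finally show "\<epsilon>\<^sup>2 * (L2_norm a b (?w s))\<^sup>2 \<le> V s" unfolding V_def N[OF usZ usZ] by linarith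
      have "\<bar>Z_inner a b (?W (of_L2 (u s))) (P (?W (of_L2 (u s))))\<bar> \<le> CP * (L2_norm a b (?w s))\<^sup>2"
        using CP(2) WuZ unfolding wn[symmetric] by blast
      then show "V s \<le> CP * (L2_norm a b (?w s))\<^sup>2" unfolding V_def N[OF usZ usZ] by linarith
    qed
    have "(\<epsilon> * L2_norm a b (?w t))\<^sup>2 \<le> V t"
      using lower[OF t] by (simp only: power_mult_distrib)
    also have "\<dots> \<le> exp (- 2 * \<alpha> * t) * V 0"
      by (rule exponential_decay[OF deriv decay t])
    also have "\<dots> \<le> exp (- 2 * \<alpha> * t) * (CP * (L2_norm a b (?w 0))\<^sup>2)"
      using upper[of 0] by (intro mult_left_mono) simp_all
    \<comment> \<open>Writing the bound as a square allows roots to be taken; both bases are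
      nonnegative where this matters.\<close>
    also have "\<dots> = (sqrt CP * exp (- \<alpha> * t) * L2_norm a b (?w 0))\<^sup>2"
    proof -
      have "exp (- 2 * \<alpha> * t) = (exp (- \<alpha> * t))\<^sup>2" by (simp add: power2_eq_square exp_add[symmetric])
      then show ?thesis using CP(1) by (simp add: power_mult_distrib)
    qed
    finally have "\<epsilon> * L2_norm a b (?w t) \<le> sqrt CP * exp (- \<alpha> * t) * L2_norm a b (?w 0)"
      by (rule power2_le_imp_le) (use CP(1) L2_norm_nonneg[OF wL[of 0]] in simp)
    then show ?thesis using \<epsilon> by (simp add: field_simps)
  qed
  show ?thesis using main by (intro exI[of _ "sqrt CP / \<epsilon>"]) blast
qed

end

theorem proposition17:
  fixes a b \<epsilon> \<alpha> :: real and n m :: nat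
    and A0 A1 A2 F F3 :: "real poly mat" and E J E1 E2 G :: "real mat"
    and F1 F2 H :: "real \<Rightarrow> real mat"
    and T A K S P X Tt At :: operator
  assumes "a < b" and "1 \<le> n"
    and "A0 \<in> carrier_mat n n" and "A1 \<in> carrier_mat n n" and "A2 \<in> carrier_mat n n"
    and "E \<in> carrier_mat (2 * n) (4 * n)" and "F \<in> carrier_mat (2 * n) n"
    \<comment> \<open>choice of \<open>m\<close>, \<open>J\<close> and \<open>F3\<close>\<close>
    and "m \<le> 2 * n"
    and "J \<in> carrier_mat (2 * n) (2 * n)" and "invertible_mat J"
    and "E1 = first_rows (2 * n - m) (J * E)"
    and "F1 = (\<lambda>x. first_rows (2 * n - m) (J * pmat_at F x))"
    and "E2 = last_rows m (J * E)"
    and "F2 = (\<lambda>x. last_rows m (J * pmat_at F x))"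
    and "full_row_rank (G_mat a b n E1 F1)"
    and "G_mat a b n E2 F2 = 0\<^sub>m m (2 * n)"
    and "F3 \<in> carrier_mat m n"
    and "G = G_mat a b n (E1 @\<^sub>r 0\<^sub>m m (4 * n)) (\<lambda>x. F1 x @\<^sub>r pmat_at F3 x)"
    and "H = H_mat b n (E1 @\<^sub>r 0\<^sub>m m (4 * n)) (\<lambda>x. F1 x @\<^sub>r pmat_at F3 x)"
    and "invertible_mat G"
    \<comment> \<open>the associated operators\<close>
    and "T = T_op a b n m G H"
    and "A = A_op a b n m A0 A1 A2 G H"
    and "K = K_op a b n m E2 F2"
    and "S \<in> PI_ops a b (0, n) (0, n)"
    and "Tt = (id \<ominus>\<^sub>o S) \<circ> T"
    and "At = (id \<ominus>\<^sub>o S) \<circ> A"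
    \<comment> \<open>the operator inequality\<close>
    and "0 < \<epsilon>" and "0 \<le> \<alpha>"
    and "P \<in> PI_ops a b (0, n) (0, n)"
    and "X \<in> PI_ops a b (m, n) (m, 0)"
    and "op_eq a b (0, n) P (adj a b (0, n) (0, n) P)"
    and "op_le a b (0, n) (\<epsilon>\<^sup>2 \<odot>\<^sub>o id) P"
    and "op_le a b (m, n)
      ((adj a b (m, n) (0, n) At \<circ> P \<circ> Tt) \<oplus>\<^sub>o (adj a b (m, n) (0, n) Tt \<circ> P \<circ> At))
      ((- 2 * \<alpha>) \<odot>\<^sub>o (adj a b (m, n) (0, n) Tt \<circ> P \<circ> Tt)
        \<ominus>\<^sub>o (X \<circ> K)
        \<ominus>\<^sub>o (adj a b (m, n) (m, 0) K \<circ> adj a b (m, 0) (m, n) X))"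
  shows "\<exists>M::real. \<forall>u0\<in>X_space a b n E F. \<forall>u. pde_solution a b n A0 A1 A2 E F u0 u \<longrightarrow>
    (\<forall>t\<ge>0. L2_norm a b (\<lambda>x. u t x - snd (S (of_L2 (u t))) x)
      \<le> M * exp (- \<alpha> * t) * L2_norm a b (\<lambda>x. u 0 x - snd (S (of_L2 (u 0))) x))"
proof -
  interpret pde_setting a b n m E J E1 E2 G F F3 F1 F2 H
    by unfold_locales (rule assms)+
  show ?thesis
    by (rule exponential_stability[OF assms(3-5) assms(24) assms(29) assms(30) assms(21-23) assms(25,26)
          assms(27) assms(32,33)])
qed

end
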